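(* Let $(A,\sigma)$ be a semilocal ring with involution such that $2\in A^\times$. Write $\bar A=A/\mathrm{Jac}\,A$, denote the quotient map by $a\mapsto \bar a$, and let $\bar\sigma$ be the involution of $\bar A$ given by $\bar a^{\bar\sigma}=\overline{a^\sigma}$. Then the image of the map $u\mapsto \bar u: U(A,\sigma)\to U(\bar A,\bar\sigma)$ contains $U^0(\bar A,\bar\sigma)$.
   Context: A ring $A$ is semilocal if $A/\mathrm{Jac}\,A$ is semisimple artinian, where $\mathrm{Jac}\,A$ is the Jacobson radical. An involution of a ring is an additive anti-automorphism of order at most $2$. For a ring with involution $(A,\sigma)$, $U(A,\sigma)=\{u\in A: u^\sigma u=1\}$. For a semisimple artinian ring with involution $(A,\sigma)$, the subgroup $U^0(A,\sigma)\subseteq U(A,\sigma)$ is defined as follows. If $A$ is simple artinian, identify $A\cong M_n(D)$ with $D$ a division ring with center $K$; then $U^0(A,\sigma)=\mathrm{SO}(A,\sigma)=\{u\in U(A,\sigma):\det u=1\}$ if $D=K$ and $\sigma$ is an orthogonal involution (a $K$-linear involution of $M_n(K)$ adjoint to a symmetric nondegenerate bilinear form), and $U^0(A,\sigma)=U(A,\sigma)$ otherwise. If $A=B\times B^{\mathrm{op}}$ with $B$ simple artinian and $(x,y^{\mathrm{op}})^\sigma=(y,x^{\mathrm{op}})$, then $U^0(A,\sigma)=U(A,\sigma)$. In general, $(A,\sigma)$ factors essentially uniquely as $\prod_{i=1}^t(A_i,\sigma_i)$ with each factor of exactly one of the two previous kinds, and $U^0(A,\sigma)=\prod_i U^0(A_i,\sigma_i)$.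 *)

theory Defs
  imports "HOL-Algebra.Algebra"
begin

definition lideal :: "('a, 'b) ring_scheme \<Rightarrow> 'a set \<Rightarrow> bool" where
  "lideal R I \<longleftrightarrow> I \<subseteq> carrier R \<and> \<zero>\<^bsub>R\<^esub> \<in> I
     \<and> (\<forall>x\<in>I. \<forall>y\<in>I. x \<oplus>\<^bsub>R\<^esub> y \<in> I)
     \<and> (\<forall>x\<in>I. \<ominus>\<^bsub>R\<^esub> x \<in> I)
     \<and> (\<forall>r\<in>carrier R. \<forall>x\<in>I. r \<otimes>\<^bsub>R\<^esub> x \<in> I)"

definition maximal_lideal :: "('a, 'b) ring_scheme \<Rightarrow> 'a set \<Rightarrow> bool" where
  "maximal_lideal R I \<longleftrightarrow> lideal R I \<and> I \<noteq> carrier R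
     \<and> (\<forall>J. lideal R J \<and> I \<subseteq> J \<longrightarrow> J = I \<or> J = carrier R)"

definition Jac :: "('a, 'b) ring_scheme \<Rightarrow> 'a set" where
  "Jac R = carrier R \<inter> \<Inter> {I. maximal_lideal R I}"

definition left_artinian :: "('a, 'b) ring_scheme \<Rightarrow> bool" where
  "left_artinian R \<longleftrightarrow>
     \<not> (\<exists>f :: nat \<Rightarrow> 'a set. (\<forall>n. lideal R (f n)) \<and> (\<forall>n. f (Suc n) \<subset> f n))"

definition semisimple_artinian :: "('a, 'b) ring_scheme \<Rightarrow> bool" where
  "semisimple_artinian R \<longleftrightarrow> left_artinian R \<and> Jac R = {\<zero>\<^bsub>R\<^esub>}"

definition semilocal :: "('a, 'b) ring_scheme \<Rightarrow> bool" where
  "semilocal R \<longleftrightarrow> semisimple_artinian (R Quot Jac R)"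

definition involution :: "('a, 'b) ring_scheme \<Rightarrow> ('a \<Rightarrow> 'a) \<Rightarrow> bool" where
  "involution R \<sigma> \<longleftrightarrow> \<sigma> \<in> carrier R \<rightarrow> carrier R
     \<and> (\<forall>a\<in>carrier R. \<forall>b\<in>carrier R.
          \<sigma> (a \<oplus>\<^bsub>R\<^esub> b) = \<sigma> a \<oplus>\<^bsub>R\<^esub> \<sigma> b
        \<and> \<sigma> (a \<otimes>\<^bsub>R\<^esub> b) = \<sigma> b \<otimes>\<^bsub>R\<^esub> \<sigma> a)
     \<and> (\<forall>a\<in>carrier R. \<sigma> (\<sigma> a) = a)"

definition Ugrp :: "('a, 'b) ring_scheme \<Rightarrow> ('a \<Rightarrow> 'a) \<Rightarrow> 'a set" where
  "Ugrp R \<sigma> = {u \<in> carrier R. \<sigma> u \<otimes>\<^bsub>R\<^esub> u = \<one>\<^bsub>R\<^esub>}"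

definition center :: "('a, 'b) ring_scheme \<Rightarrow> 'a set" where
  "center R = {z \<in> carrier R. \<forall>x\<in>carrier R. z \<otimes>\<^bsub>R\<^esub> x = x \<otimes>\<^bsub>R\<^esub> z}"

definition mat_mult :: "('a, 'b) ring_scheme \<Rightarrow> nat \<Rightarrow> (nat \<times> nat \<Rightarrow> 'a) \<Rightarrow> (nat \<times> nat \<Rightarrow> 'a) \<Rightarrow> (nat \<times> nat \<Rightarrow> 'a)" where
  "mat_mult R n M N = (\<lambda>(i, j). if i < n \<and> j < n
      then (\<Oplus>\<^bsub>R\<^esub> k\<in>{..<n}. M (i, k) \<otimes>\<^bsub>R\<^esub> N (k, j)) else \<zero>\<^bsub>R\<^esub>)"

definition mat_add :: "('a, 'b) ring_scheme \<Rightarrow> nat \<Rightarrow> (nat \<times> nat \<Rightarrow> 'a) \<Rightarrow> (nat \<times> nat \<Rightarrow> 'a) \<Rightarrow> (nat \<times> nat \<Rightarrow> 'a)" where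
  "mat_add R n M N = (\<lambda>(i, j). if i < n \<and> j < n then M (i, j) \<oplus>\<^bsub>R\<^esub> N (i, j) else \<zero>\<^bsub>R\<^esub>)"

definition mat_one :: "('a, 'b) ring_scheme \<Rightarrow> nat \<Rightarrow> (nat \<times> nat \<Rightarrow> 'a)" where
  "mat_one R n = (\<lambda>(i, j). if i < n \<and> j < n \<and> i = j then \<one>\<^bsub>R\<^esub> else \<zero>\<^bsub>R\<^esub>)"

definition mat_carrier :: "('a, 'b) ring_scheme \<Rightarrow> nat \<Rightarrow> (nat \<times> nat \<Rightarrow> 'a) set" where
  "mat_carrier R n = {M. \<forall>i j. (i < n \<and> j < n \<longrightarrow> M (i, j) \<in> center R)
                        \<and> (\<not> (i < n \<and> j < n) \<longrightarrow> M (i, j) = \<zero>\<^bsub>R\<^esub>)}"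

definition mat_ring :: "('a, 'b) ring_scheme \<Rightarrow> nat \<Rightarrow> (nat \<times> nat \<Rightarrow> 'a) ring" where
  "mat_ring R n = \<lparr>carrier = mat_carrier R n, monoid.mult = mat_mult R n, one = mat_one R n,
      ring.zero = (\<lambda>_. \<zero>\<^bsub>R\<^esub>), ring.add = mat_add R n\<rparr>"

definition mtranspose :: "(nat \<times> nat \<Rightarrow> 'a) \<Rightarrow> (nat \<times> nat \<Rightarrow> 'a)" where
  "mtranspose M = (\<lambda>(i, j). M (j, i))"

definition mdet :: "('a, 'b) ring_scheme \<Rightarrow> nat \<Rightarrow> (nat \<times> nat \<Rightarrow> 'a) \<Rightarrow> 'a" where
  "mdet R n M =
    (\<Oplus>\<^bsub>R\<^esub> p\<in>{p. p permutes {..<n}}.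
       (if sign p = (1::int) then \<one>\<^bsub>R\<^esub> else \<ominus>\<^bsub>R\<^esub> \<one>\<^bsub>R\<^esub>)
       \<otimes>\<^bsub>R\<^esub> (finprod (R\<lparr>carrier := center R\<rparr>) (\<lambda>i. M (i, p i)) {..<n}))"

text \<open>(R, tau) is split orthogonal: R is identified (via phi) with M_n(K), K the
  centre of R (so D = K), and tau corresponds to the adjoint involution
  X |-> B^{-1} X^T B of a symmetric nondegenerate bilinear form with Gram matrix B.\<close>
definition orth_data :: "('a, 'b) ring_scheme \<Rightarrow> ('a \<Rightarrow> 'a) \<Rightarrow> nat
    \<Rightarrow> ('a \<Rightarrow> (nat \<times> nat \<Rightarrow> 'a)) \<Rightarrow> (nat \<times> nat \<Rightarrow> 'a) \<Rightarrow> bool" where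
  "orth_data R \<tau> n \<phi> B \<longleftrightarrow>
     \<phi> \<in> ring_iso R (mat_ring R n)
     \<and> B \<in> Units (mat_ring R n) \<and> mtranspose B = B
     \<and> (\<forall>x\<in>carrier R. \<phi> (\<tau> x) =
          inv\<^bsub>mat_ring R n\<^esub> B \<otimes>\<^bsub>mat_ring R n\<^esub> mtranspose (\<phi> x) \<otimes>\<^bsub>mat_ring R n\<^esub> B)"

text \<open>U^0 of a simple artinian ring with involution: SO if split orthogonal, U otherwise.\<close>
definition U0_simple :: "('a, 'b) ring_scheme \<Rightarrow> ('a \<Rightarrow> 'a) \<Rightarrow> 'a set" where
  "U0_simple R \<tau> = {u \<in> Ugrp R \<tau>.
      \<forall>n \<phi> B. orth_data R \<tau> n \<phi> B \<longrightarrow> mdet R n (\<phi> u) = \<one>\<^bsub>R\<^esub>}"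

definition prim_central_idem :: "('a, 'b) ring_scheme \<Rightarrow> 'a \<Rightarrow> bool" where
  "prim_central_idem R e \<longleftrightarrow> e \<in> center R \<and> e \<otimes>\<^bsub>R\<^esub> e = e \<and> e \<noteq> \<zero>\<^bsub>R\<^esub>
     \<and> (\<forall>f\<in>center R. f \<otimes>\<^bsub>R\<^esub> f = f \<longrightarrow> f \<otimes>\<^bsub>R\<^esub> e = \<zero>\<^bsub>R\<^esub> \<or> f \<otimes>\<^bsub>R\<^esub> e = e)"

definition factor_ring :: "('a, 'b) ring_scheme \<Rightarrow> 'a \<Rightarrow> ('a, 'b) ring_scheme" where
  "factor_ring R e = R\<lparr>carrier := {e \<otimes>\<^bsub>R\<^esub> x | x. x \<in> carrier R}, one := e\<rparr>"

text \<open>U^0 of a semisimple artinian ring with involution: product over the factors.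
  Factors of the form B x B^op (pairs e, tau e with tau e \<noteq> e) contribute all of U;
  a tau-stable simple factor eR contributes U^0(eR, tau).\<close>
definition U0 :: "('a, 'b) ring_scheme \<Rightarrow> ('a \<Rightarrow> 'a) \<Rightarrow> 'a set" where
  "U0 R \<tau> = {u \<in> Ugrp R \<tau>. \<forall>e. prim_central_idem R e \<and> \<tau> e = e
      \<longrightarrow> e \<otimes>\<^bsub>R\<^esub> u \<in> U0_simple (factor_ring R e) \<tau>}"

end

theory Submission
  imports Defs
begin

text \<open>
  If \<open>c\<close> is a unit with \<open>c + \<sigma>(c) = \<sigma>(y) y\<close>, then the quasi-reflection \<open>1 - y c' \<sigma>(y)\<close>, with \<open>c'\<close>
  the inverse of \<open>c\<close>, is unitary. Such data lift along the Jacobson radical: units lift, and since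
  \<open>2\<close> is invertible one can correct the symmetric part of a lift of \<open>c\<close>. So it suffices to write
  \<open>-u\<close> as a single quasi-reflection in the semisimple quotient, for every \<open>u\<close> in \<open>U0\<close>.

  This can be done on one indecomposable involution-stable factor at a time. If \<open>\<sigma>\<close> exchanges two
  simple factors, \<open>y = (1 + u, 1)\<close> works. On a stable simple factor let \<open>e\<close> be an idempotent with
  \<open>e R = (1 + u) R\<close>. The Wall form \<open>t\<close>, inverse to \<open>1 + u\<close>, satisfies \<open>t + \<sigma>(t) = \<sigma>(e) e\<close>, and one
  may take \<open>y = e\<close> and \<open>c = t + s\<close> for any nondegenerate skew form \<open>s\<close> on \<open>(1 - e) R\<close>. A maximal skew
  form misses at most one simple summand \<open>k R\<close>, and it misses one only if all elements of \<open>\<sigma>(k) R k\<close>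
  are symmetric. Then the factor is split orthogonal, and with a symmetric form \<open>r\<close> on \<open>k R\<close> and the
  unit \<open>c = t + s + r\<close> one computes
  \<open>det (-u) = det (1 - e c' \<sigma>(e)) = det (1 - c' \<sigma>(e) e) = det c' det (-1) det (t + s - r) = - det (-1)\<close>,
  because \<open>t + s - r = c (1 - 2 k)\<close>. Hence \<open>det u = -1\<close> and \<open>u\<close> is not in \<open>U0\<close>.
\<close>

section \<open>Left ideals and the Jacobson radical\<close>

text \<open>The sign in front of \<open>u\<close> is forced. In the split orthogonal case of degree
  n, every quasi-reflection has determinant \<open>det (1 - c' \<sigma>(y) y) = det c' det
  (-\<sigma>(c)) = (-1)^n\<close>, so \<open>-u\<close> can only be one if \<open>det u = 1\<close>.
  The converse is a parity argument: an isometry v satisfies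
  \<open>det v = (-1)^rank(1 - v)\<close>, so for v = \<open>-u\<close> the complement
  \<open>1 - e\<close> of the image of \<open>1 + u\<close> has even rank exactly when
  \<open>det u = 1\<close>, and even rank is what a nondegenerate skew form requires. The proof
  avoids classifying involutions and choosing coordinates: summands are represented by idempotents
  \<open>h\<close>, forms on \<open>h R\<close> by elements of \<open>\<sigma>(h) R h\<close>, and
  maximal objects come from the descending chain condition on left ideals \<open>R (1 - h)\<close>.
  Coordinates enter only in the exceptional orthogonal case, where the conclusion is about a matrix
  determinant. As \<open>U0_simple\<close> quantifies over all matrix identifications, one
  identification with determinant different from 1 excludes \<open>u\<close>.\<close>

lemma lidealD:
  assumes "lideal R I"
  shows "I \<subseteq> carrier R" "\<zero>\<^bsub>R\<^esub> \<in> I"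
    "\<And>x y. x \<in> I \<Longrightarrow> y \<in> I \<Longrightarrow> x \<oplus>\<^bsub>R\<^esub> y \<in> I"
    "\<And>x. x \<in> I \<Longrightarrow> \<ominus>\<^bsub>R\<^esub> x \<in> I"
    "\<And>r x. r \<in> carrier R \<Longrightarrow> x \<in> I \<Longrightarrow> r \<otimes>\<^bsub>R\<^esub> x \<in> I"
    "\<And>x. x \<in> I \<Longrightarrow> x \<in> carrier R"
  using assms unfolding lideal_def by auto

context ring
begin

lemma lidealI:
  assumes "I \<subseteq> carrier R" "\<zero> \<in> I" "\<And>x y. x \<in> I \<Longrightarrow> y \<in> I \<Longrightarrow> x \<oplus> y \<in> I"
    "\<And>r x. r \<in> carrier R \<Longrightarrow> x \<in> I \<Longrightarrow> r \<otimes> x \<in> I"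
  shows "lideal R I"
proof -
  have "\<ominus> x \<in> I" if "x \<in> I" for x
  proof -
    have "x \<in> carrier R" using that assms(1) by auto
    then have "\<ominus> x = (\<ominus> \<one>) \<otimes> x" by (simp add: l_minus)
    then show ?thesis using assms(4)[of "\<ominus> \<one>" x] that by simp
  qed
  then show ?thesis using assms unfolding lideal_def by blast
qed

lemma lideal_carrier: "lideal R (carrier R)"
  by (rule lidealI) auto

lemma lideal_one_imp_carrier:
  assumes "lideal R I" "\<one> \<in> I" shows "I = carrier R"
proof -
  have "x \<in> I" if "x \<in> carrier R" for x
    using lidealD(5)[OF assms(1) that assms(2)] that by simp
  then show ?thesis using lidealD(1)[OF assms(1)] by blast
qed

lemma lideal_Int: "lideal R I \<Longrightarrow> lideal R J \<Longrightarrow> lideal R (I \<inter> J)"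
  unfolding lideal_def by blast

definition princ :: "'a \<Rightarrow> 'a set" where
  "princ a = {r \<otimes> a | r. r \<in> carrier R}"

definition lsum :: "'a set \<Rightarrow> 'a set \<Rightarrow> 'a set" where
  "lsum I J = {x \<oplus> y | x y. x \<in> I \<and> y \<in> J}"

lemma princI: "r \<in> carrier R \<Longrightarrow> x = r \<otimes> a \<Longrightarrow> x \<in> princ a"
  unfolding princ_def by auto

lemma lsumI: "a \<in> I \<Longrightarrow> b \<in> J \<Longrightarrow> x = a \<oplus> b \<Longrightarrow> x \<in> lsum I J"
  unfolding lsum_def by auto

lemma princE:
  assumes "x \<in> princ a" obtains r where "r \<in> carrier R" "x = r \<otimes> a"
  using assms unfolding princ_def mem_Collect_eq by (elim exE conjE)

lemma lsumE:
  assumes "x \<in> lsum I J" obtains a b where "a \<in> I" "b \<in> J" "x = a \<oplus> b"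
  using assms unfolding lsum_def mem_Collect_eq by (elim exE conjE)

lemma lideal_princ: assumes "a \<in> carrier R" shows "lideal R (princ a)"
proof (rule lidealI)
  show "\<zero> \<in> princ a" unfolding princ_def using assms by (auto intro!: exI[of _ \<zero>])
  show "x \<oplus> y \<in> princ a" if xy: "x \<in> princ a" "y \<in> princ a" for x y
  proof -
    obtain r where r: "r \<in> carrier R" "x = r \<otimes> a" using xy(1) by (rule princE)
    obtain s where s: "s \<in> carrier R" "y = s \<otimes> a" using xy(2) by (rule princE)
    show ?thesis by (rule princI[of "r \<oplus> s"]) (simp_all add: assms r s l_distr)
  qed
  show "r \<otimes> x \<in> princ a" if xy: "r \<in> carrier R" "x \<in> princ a" for r x
  proof -
    obtain s where s: "s \<in> carrier R" "x = s \<otimes> a" using xy(2) by (rule princE)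
    show ?thesis by (rule princI[of "r \<otimes> s"]) (simp_all add: assms xy(1) s m_assoc)
  qed
qed (use assms in \<open>auto simp: princ_def\<close>)

lemma princ_self: "a \<in> carrier R \<Longrightarrow> a \<in> princ a"
  unfolding princ_def by (auto intro!: exI[of _ \<one>])

lemma princ_least: "lideal R I \<Longrightarrow> a \<in> I \<Longrightarrow> princ a \<subseteq> I"
  unfolding princ_def lideal_def by auto

lemma lideal_lsum: assumes "lideal R I" "lideal R J" shows "lideal R (lsum I J)"
proof (rule lidealI)
  note I = lidealD[OF assms(1)] and J = lidealD[OF assms(2)]
  show "lsum I J \<subseteq> carrier R" unfolding lsum_def using I(6) J(6) by auto
  show "\<zero> \<in> lsum I J" using I(2) J(2) by (intro lsumI) auto
  show "x \<oplus> y \<in> lsum I J" if xy: "x \<in> lsum I J" "y \<in> lsum I J" for x y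
  proof -
    obtain a b where 1: "a \<in> I" "b \<in> J" "x = a \<oplus> b" using xy(1) by (rule lsumE)
    obtain c d where 2: "c \<in> I" "d \<in> J" "y = c \<oplus> d" using xy(2) by (rule lsumE)
    note * = 1 2
    have "x \<oplus> y = (a \<oplus> c) \<oplus> (b \<oplus> d)" using * I(6) J(6) by (simp add: a_ac)
    then show ?thesis using I(3)[of a c] J(3)[of b d] * by (intro lsumI)
  qed
  show "r \<otimes> x \<in> lsum I J" if xy: "r \<in> carrier R" "x \<in> lsum I J" for r x
  proof -
    obtain a b where *: "a \<in> I" "b \<in> J" "x = a \<oplus> b" using xy(2) by (rule lsumE)
    have "r \<otimes> x = r \<otimes> a \<oplus> r \<otimes> b" using * I(6) J(6) xy(1) by (simp add: r_distr)
    then show ?thesis using I(5)[of r a] J(5)[of r b] * xy(1) by (intro lsumI)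
  qed
qed

lemma lsum_upper1: assumes "lideal R I" "lideal R J" shows "I \<subseteq> lsum I J"
proof
  fix x assume "x \<in> I"
  then have "x = x \<oplus> \<zero>" using lidealD(6)[OF assms(1)] by simp
  then show "x \<in> lsum I J" using \<open>x \<in> I\<close> lidealD(2)[OF assms(2)] by (rule lsumI[rotated 2])
qed

lemma lsum_upper2: assumes "lideal R I" "lideal R J" shows "J \<subseteq> lsum I J"
proof
  fix x assume "x \<in> J"
  then have "x = \<zero> \<oplus> x" using lidealD(6)[OF assms(2)] by simp
  then show "x \<in> lsum I J" using \<open>x \<in> J\<close> lidealD(2)[OF assms(1)] by (intro lsumI)
qed

lemma maximal_lideal_lsum:
  assumes M: "maximal_lideal R M" and J: "lideal R J" and x: "x \<in> J" "x \<notin> M"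
  shows "lsum M J = carrier R"
proof -
  have lM: "lideal R M" using M unfolding maximal_lideal_def by simp
  have "lsum M J = M \<or> lsum M J = carrier R"
    using M lideal_lsum[OF lM J] lsum_upper1[OF lM J] unfolding maximal_lideal_def by blast
  moreover have "x \<in> lsum M J" using x lsum_upper2[OF lM J] by blast
  ultimately show ?thesis using x by auto
qed

text \<open>Zorn's lemma for the left ideals that contain \<open>I\<close> and avoid
  \<open>\<one>\<close>; avoiding \<open>\<one>\<close> is equivalent to being proper and clearly
  passes to unions of chains.\<close>

lemma proper_lideal_in_maximal:
  assumes I: "lideal R I" "I \<noteq> carrier R"
  obtains M where "maximal_lideal R M" "I \<subseteq> M"
proof -
  define S where "S = {J. lideal R J \<and> I \<subseteq> J \<and> \<one> \<notin> J}"
  have "\<exists>M\<in>S. (\<forall>N\<in>S. M \<subseteq> N \<longrightarrow> N = M)"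
  proof (rule subset_Zorn_nonempty)
    have "\<one> \<notin> I" using I(2) lideal_one_imp_carrier[OF I(1)] by metis
    then have "I \<in> S" using I(1) unfolding S_def by simp
    then show "S \<noteq> {}" by blast
    fix C assume C: "C \<noteq> {}" "subset.chain S C"
    have ch: "C \<subseteq> S \<and> (\<forall>V\<in>C. \<forall>W\<in>C. V \<subseteq> W \<or> W \<subseteq> V)"
      using C(2) unfolding subset_chain_def .
    have CS: "C \<subseteq> S" using ch by (rule conjunct1)
    have tot: "V \<subseteq> W \<or> W \<subseteq> V" if "V \<in> C" "W \<in> C" for V W
      using bspec[OF bspec[OF conjunct2[OF ch] that(1)] that(2)] .
    have sub: "lideal R V \<and> I \<subseteq> V \<and> \<one> \<notin> V" if "V \<in> C" for V
      using subsetD[OF CS that] unfolding S_def by simp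
    have lid: "lideal R V" if "V \<in> C" for V using sub[OF that] by simp
    have "lideal R (\<Union> C)"
    proof (rule lidealI)
      show "\<Union> C \<subseteq> carrier R" using lidealD(1)[OF lid] by auto
      show "\<zero> \<in> \<Union> C" using lidealD(2)[OF lid] C(1) by auto
      show "x \<oplus> y \<in> \<Union> C" if xy: "x \<in> \<Union> C" "y \<in> \<Union> C" for x y
      proof -
        obtain V W where VW: "V \<in> C" "x \<in> V" "W \<in> C" "y \<in> W" using xy by auto
        obtain Z where "Z \<in> C" "x \<in> Z" "y \<in> Z"
        proof (cases "V \<subseteq> W")
          case True then show ?thesis using that[of W] VW by auto
        next
          case False then show ?thesis using that[of V] VW tot[OF VW(1) VW(3)] by auto
        qed
        then show ?thesis using lidealD(3)[OF lid] by auto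
      qed
      show "r \<otimes> x \<in> \<Union> C" if "r \<in> carrier R" "x \<in> \<Union> C" for r x
        using that lidealD(5)[OF lid] by auto
    qed
    moreover have "I \<subseteq> \<Union> C" "\<one> \<notin> \<Union> C" using sub C(1) by blast+
    ultimately show "\<Union> C \<in> S" unfolding S_def by blast
  qed
  then obtain M where "M \<in> S" and maxS: "\<forall>N\<in>S. M \<subseteq> N \<longrightarrow> N = M" by (elim bexE)
  then have M: "lideal R M" "I \<subseteq> M" "\<one> \<notin> M" unfolding S_def by simp_all
  have max: "V = M" if V: "lideal R V" "M \<subseteq> V" "\<one> \<notin> V" for V
  proof -
    have "V \<in> S" using V M(2) unfolding S_def by simp
    then show ?thesis using maxS V(2) by simp
  qed
  have "maximal_lideal R M"
    unfolding maximal_lideal_def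
  proof (intro conjI allI impI)
    show "M \<noteq> carrier R" using M(3) by auto
    fix J assume J: "lideal R J \<and> M \<subseteq> J"
    show "J = M \<or> J = carrier R"
      using max[of J] lideal_one_imp_carrier[of J] J M(2) by (cases "\<one> \<in> J") auto
  qed (rule M(1))
  then show ?thesis using that M(2) by blast
qed

lemma lideal_Jac: "lideal R (Jac R)"
  by (rule lidealI) (auto simp: Jac_def maximal_lideal_def dest: lidealD)

lemma Jac_subset: "Jac R \<subseteq> carrier R"
  unfolding Jac_def by auto

lemma Jac_maximal: "x \<in> Jac R \<Longrightarrow> maximal_lideal R M \<Longrightarrow> x \<in> M"
  unfolding Jac_def by auto

text \<open>\<open>Jac\<close> is an intersection of maximal left ideals, so closure under right
  multiplication needs an argument: for a maximal \<open>M\<close> and \<open>a \<notin> M\<close>,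
  the left ideal of all \<open>r\<close> with \<open>r a \<in> M\<close> is again maximal, hence
  contains \<open>x\<close>.\<close>

lemma Jac_mult_right:
  assumes x: "x \<in> Jac R" and a: "a \<in> carrier R"
  shows "x \<otimes> a \<in> Jac R"
proof -
  have xR: "x \<in> carrier R" using x Jac_subset by auto
  have "x \<otimes> a \<in> M" if M: "maximal_lideal R M" for M
  proof (cases "a \<in> M")
    case True
    then show ?thesis using M xR unfolding maximal_lideal_def by (auto dest: lidealD)
  next
    case False
    have lM: "lideal R M" using M unfolding maximal_lideal_def by simp
    note MD = lidealD[OF lM]
    let ?N = "{r \<in> carrier R. r \<otimes> a \<in> M}"
    have lN: "lideal R ?N"
      by (rule lidealI) (use a MD in \<open>auto simp: l_distr m_assoc\<close>)
    have "maximal_lideal R ?N"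
      unfolding maximal_lideal_def
    proof (intro conjI allI impI)
      have "\<one> \<notin> ?N" using False a by simp
      then show "?N \<noteq> carrier R" by blast
      fix J assume J: "lideal R J \<and> ?N \<subseteq> J"
      then have lJ: "lideal R J" and NJ: "?N \<subseteq> J" by simp_all
      show "J = ?N \<or> J = carrier R"
      proof (cases "J \<subseteq> ?N")
        case nsub: False
        then obtain r where r: "r \<in> J" "r \<notin> ?N" by auto
        have rR: "r \<in> carrier R" using r lidealD(6)[OF lJ] by blast
        then have ra: "r \<otimes> a \<notin> M" using r by auto
        \<comment> \<open>Writing \<open>a = m + s r a\<close> along this sum puts
          \<open>1 - s r\<close> into \<open>?N\<close>; together with \<open>s r \<in> J\<close>
          this gives \<open>\<one> \<in> J\<close>.\<close>
        have "lsum M (princ (r \<otimes> a)) = carrier R"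
          using maximal_lideal_lsum[OF M lideal_princ princ_self ra] rR a by auto
        then have "a \<in> lsum M (princ (r \<otimes> a))" using a by simp
        then obtain m s where ms: "m \<in> M" "s \<in> carrier R" "a = m \<oplus> s \<otimes> (r \<otimes> a)"
          unfolding lsum_def princ_def by auto
        have mR: "m \<in> carrier R" using ms MD by auto
        have "(\<one> \<ominus> s \<otimes> r) \<otimes> a = a \<ominus> s \<otimes> (r \<otimes> a)"
          using a rR ms(2) by (simp add: minus_eq l_distr l_minus m_assoc)
        also have "\<dots> = m" using ms a rR mR
          by (metis a_comm add.inv_solve_right' m_closed minus_eq)
        finally have "\<one> \<ominus> s \<otimes> r \<in> ?N" using ms rR by auto
        then have "\<one> \<ominus> s \<otimes> r \<in> J" using NJ by blast
        moreover have "s \<otimes> r \<in> J" using lidealD(5)[OF lJ] r(1) ms(2) by simp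
        ultimately have "(\<one> \<ominus> s \<otimes> r) \<oplus> s \<otimes> r \<in> J" using lidealD(3)[OF lJ] by simp
        moreover have "(\<one> \<ominus> s \<otimes> r) \<oplus> s \<otimes> r = \<one>"
          using rR ms(2) by (simp add: minus_eq a_assoc l_neg)
        ultimately show ?thesis using lideal_one_imp_carrier[OF lJ] by simp
      qed (use NJ in auto)
    qed (rule lN)
    then show ?thesis using Jac_maximal[OF x] by auto
  qed
  then show ?thesis using xR a unfolding Jac_def by auto
qed

lemma ideal_Jac: "ideal (Jac R) R"
proof (rule idealI)
  note J = lidealD[OF lideal_Jac]
  show "subgroup (Jac R) (add_monoid R)"
    using J by (auto intro!: add.subgroupI simp: a_inv_def[symmetric])
qed (use Jac_mult_right lidealD[OF lideal_Jac] in \<open>auto simp: ring_axioms\<close>)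

lemma Jac_left_inverse:
  assumes x: "x \<in> Jac R"
  obtains y where "y \<in> carrier R" "y \<otimes> (\<one> \<ominus> x) = \<one>"
proof -
  have xR: "x \<in> carrier R" using x Jac_subset by auto
  have "princ (\<one> \<ominus> x) = carrier R"
  proof (rule ccontr)
    assume "princ (\<one> \<ominus> x) \<noteq> carrier R"
    then obtain M where M: "maximal_lideal R M" "princ (\<one> \<ominus> x) \<subseteq> M"
      using proper_lideal_in_maximal lideal_princ xR by (metis minus_closed one_closed)
    have lM: "lideal R M" using M unfolding maximal_lideal_def by simp
    have "\<one> \<ominus> x \<in> M" using M princ_self[of "\<one> \<ominus> x"] xR by auto
    then have "(\<one> \<ominus> x) \<oplus> x \<in> M" using Jac_maximal[OF x M(1)] lidealD(3)[OF lM] by blast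
    then have "\<one> \<in> M" using xR by (simp add: minus_eq a_assoc l_neg)
    then show False using lideal_one_imp_carrier[OF lM] M(1) unfolding maximal_lideal_def by simp
  qed
  then have "\<one> \<in> princ (\<one> \<ominus> x)" by simp
  then show ?thesis using that unfolding princ_def by auto
qed

text \<open>A left inverse \<open>y\<close> of \<open>1 - x\<close> equals \<open>1 + y x\<close>,
  which is again \<open>1\<close> minus a radical element and so has a left inverse itself. Hence
  \<open>y\<close> is invertible on both sides.\<close>

lemma Jac_one_minus_Units:
  assumes x: "x \<in> Jac R" shows "\<one> \<ominus> x \<in> Units R"
proof -
  have xR: "x \<in> carrier R" using x Jac_subset by auto
  obtain y where y: "y \<in> carrier R" "y \<otimes> (\<one> \<ominus> x) = \<one>" using Jac_left_inverse[OF x] .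
  have nyx: "\<ominus> (y \<otimes> x) \<in> Jac R"
    using lidealD(4,5)[OF lideal_Jac] y(1) x by blast
  have "y \<ominus> y \<otimes> x = \<one>" using y xR by (simp add: minus_eq r_distr r_minus)
  then have "y = \<one> \<ominus> \<ominus> (y \<otimes> x)"
    using y(1) xR by (metis add.inv_closed add.inv_solve_right' m_closed minus_eq minus_minus one_closed)
  then obtain z where z: "z \<in> carrier R" "z \<otimes> y = \<one>" using Jac_left_inverse[OF nyx] by metis
  have "z = \<one> \<ominus> x" using z y xR by (metis l_one m_assoc minus_closed one_closed r_one)
  then show ?thesis using y z xR unfolding Units_def by auto
qed

lemma Units_of_one_sided:
  assumes "a \<in> carrier R" "b \<in> carrier R" "c \<in> carrier R" "b \<otimes> a = \<one>" "a \<otimes> c = \<one>"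
  shows "a \<in> Units R"
proof -
  have "b = c" using assms by (metis l_one m_assoc r_one)
  then show ?thesis using assms unfolding Units_def by auto
qed

text \<open>The assumptions say that \<open>c'\<close> inverts \<open>c\<close> modulo the radical.
  Then \<open>c c'\<close> and \<open>c' c\<close> are units, which yields a right and a left
  inverse of \<open>c\<close>.\<close>

lemma Jac_Units_lift:
  assumes c: "c \<in> carrier R" "c' \<in> carrier R"
    and 1: "\<one> \<ominus> c \<otimes> c' \<in> Jac R" "\<one> \<ominus> c' \<otimes> c \<in> Jac R"
  shows "c \<in> Units R"
proof -
  have *: "\<one> \<ominus> (\<one> \<ominus> x) = x" if "x \<in> carrier R" for x
    using that by (simp add: minus_eq minus_add a_assoc[symmetric] r_neg)
  have u1: "c \<otimes> c' \<in> Units R" and u2: "c' \<otimes> c \<in> Units R"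
    using Jac_one_minus_Units[OF 1(1)] Jac_one_minus_Units[OF 1(2)] c by (simp_all add: *)
  show ?thesis
  proof (rule Units_of_one_sided)
    show "inv (c' \<otimes> c) \<otimes> c' \<otimes> c = \<one>" using u2 c by (simp add: m_assoc)
    show "c \<otimes> (c' \<otimes> inv (c \<otimes> c')) = \<one>" using u1 c by (simp add: m_assoc[symmetric])
  qed (use u1 u2 c in auto)
qed

end

section \<open>Semisimple artinian rings and idempotents\<close>

context ring
begin

text \<open>The minimum principle behind every extremal choice below. The objects are of arbitrary
  type and are only weighed by a left ideal \<open>L x\<close>: it is applied to left ideals, to
  idempotents and other ring elements, and to systems of matrix units.\<close>

lemma dcc_minimal:
  fixes L :: "'c \<Rightarrow> 'a set"
  assumes art: "left_artinian R" and P: "P x0" and lid: "\<And>x. P x \<Longrightarrow> lideal R (L x)"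
  obtains x where "P x" "\<forall>y. P y \<longrightarrow> \<not> L y \<subset> L x"
proof -
  have W: "wf {(y, x). P y \<and> P x \<and> L y \<subset> L x}"
    unfolding wf_iff_no_infinite_down_chain
  proof
    assume "\<exists>f. \<forall>i. (f (Suc i), f i) \<in> {(y, x). P y \<and> P x \<and> L y \<subset> L x}"
    then obtain f :: "nat \<Rightarrow> 'c" where f: "\<And>i. P (f (Suc i)) \<and> P (f i) \<and> L (f (Suc i)) \<subset> L (f i)"
      by auto
    have "(\<forall>n. lideal R ((L \<circ> f) n)) \<and> (\<forall>n. (L \<circ> f) (Suc n) \<subset> (L \<circ> f) n)"
      using f lid by simp
    then show False using art unfolding left_artinian_def by blast
  qed
  have "x0 \<in> Collect P" using P by simp
  with W have "\<exists>z\<in>Collect P. \<forall>y. (y, z) \<in> {(y, x). P y \<and> P x \<and> L y \<subset> L x} \<longrightarrow> y \<notin> Collect P"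
    unfolding wf_eq_minimal by blast
  then have "\<exists>z. P z \<and> (\<forall>y. P y \<longrightarrow> \<not> L y \<subset> L z)" by auto
  then show ?thesis using that by (elim exE conjE)
qed

text \<open>A minimal \<open>L'\<close> with \<open>L + L' = R\<close> is a complement: a nonzero
  \<open>x\<close> in the intersection avoids some maximal left ideal \<open>M\<close> because the
  radical is zero, and then the smaller \<open>L' \<inter> M\<close> would still satisfy the
  condition.\<close>

lemma lideal_complement:
  assumes ss: "semisimple_artinian R" and L: "lideal R L"
  obtains L' where "lideal R L'" "L \<inter> L' = {\<zero>}" "lsum L L' = carrier R"
proof -
  note LD = lidealD[OF L]
  have art: "left_artinian R" and J0: "Jac R = {\<zero>}" using ss unfolding semisimple_artinian_def by auto
  have "lsum L (carrier R) = carrier R"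
    using lidealD(1)[OF lideal_lsum[OF L lideal_carrier]] lsum_upper2[OF L lideal_carrier] by auto
  define P where "P K \<longleftrightarrow> lideal R K \<and> lsum L K = carrier R" for K
  have P0: "P (carrier R)" unfolding P_def using lideal_carrier \<open>lsum L (carrier R) = carrier R\<close> by simp
  have Pl: "lideal R K" if "P K" for K using that unfolding P_def by simp
  obtain L' where L'0: "P L'" and min: "\<forall>K. P K \<longrightarrow> \<not> K \<subset> L'"
    by (rule dcc_minimal[where P = P and L = "\<lambda>K. K", OF art P0 Pl])
  have L'1: "lideal R L'" "lsum L L' = carrier R" using L'0 unfolding P_def by simp_all
  note L'D = lidealD[OF L'1(1)]
  have "L \<inter> L' \<subseteq> {\<zero>}"
  proof (rule subsetI, rule ccontr)
    fix x assume x: "x \<in> L \<inter> L'" and "x \<notin> {\<zero>}"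
    then have "x \<notin> Jac R" using J0 by simp
    then obtain M where M: "maximal_lideal R M" "x \<notin> M"
      using x LD(6) unfolding Jac_def by auto
    have lM: "lideal R M" using M unfolding maximal_lideal_def by simp
    note MD = lidealD[OF lM]
    have K: "lideal R (L \<inter> L')" using lideal_Int[OF L L'1(1)] .
    have sum: "lsum M (L \<inter> L') = carrier R" using maximal_lideal_lsum[OF M(1) K x M(2)] .
    have LM: "lideal R (L' \<inter> M)" using lideal_Int[OF L'1(1) lM] .
    \<comment> \<open>Splitting an element of \<open>L'\<close> along
      \<open>M + (L \<inter> L')\<close> leaves a first part in \<open>L' \<inter> M\<close>, while
      the second part is absorbed by \<open>L\<close>.\<close>
    have "L' \<subseteq> lsum L (L' \<inter> M)"
    proof
      fix y assume y: "y \<in> L'"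
      then have "y \<in> lsum M (L \<inter> L')" using sum L'D(6) by simp
      then obtain m k where mk: "m \<in> M" "k \<in> L \<inter> L'" "y = m \<oplus> k" by (rule lsumE)
      have c: "m \<in> carrier R" "k \<in> carrier R" using mk MD(6) LD(6) by auto
      have "m = y \<oplus> \<ominus> k" using mk(3) c by (simp add: a_assoc r_neg)
      then have "m \<in> L'" using L'D(3)[OF y L'D(4)[of k]] mk(2) by auto
      then show "y \<in> lsum L (L' \<inter> M)" using mk c by (intro lsumI[of k _ m]) (auto simp: a_comm)
    qed
    moreover have "L \<subseteq> lsum L (L' \<inter> M)" using lsum_upper1[OF L LM] .
    ultimately have sub: "x \<oplus> y \<in> lsum L (L' \<inter> M)" if "x \<in> L" "y \<in> L'" for x y
      using lidealD(3)[OF lideal_lsum[OF L LM]] that by blast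
    have "carrier R \<subseteq> lsum L (L' \<inter> M)"
    proof
      fix z assume "z \<in> carrier R"
      then have "z \<in> lsum L L'" using L'1(2) by simp
      then obtain a b where "a \<in> L" "b \<in> L'" "z = a \<oplus> b" by (rule lsumE)
      then show "z \<in> lsum L (L' \<inter> M)" using sub by simp
    qed
    then have "lsum L (L' \<inter> M) = carrier R" using lidealD(1)[OF lideal_lsum[OF L LM]] by auto
    then have "\<not> L' \<inter> M \<subset> L'" using min LM unfolding P_def by simp
    then show False using x M(2) by auto
  qed
  then have "L \<inter> L' = {\<zero>}" using LD(2) L'D(2) by blast
  then show ?thesis using that[of L'] L'1 by simp
qed

text \<open>Decompose \<open>1 = h + h'\<close> along a complement. For \<open>x \<in> L\<close> the
  element \<open>x h' = x - x h\<close> lies in both summands, so it vanishes.\<close>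

lemma lideal_generated_by_idempotent:
  assumes ss: "semisimple_artinian R" and L: "lideal R L"
  obtains h where "h \<in> L" "\<forall>x\<in>L. x \<otimes> h = x"
proof -
  note LD = lidealD[OF L]
  obtain L' where L': "lideal R L'" "L \<inter> L' = {\<zero>}" "lsum L L' = carrier R"
    using lideal_complement[OF ss L] .
  note L'D = lidealD[OF L'(1)]
  have "\<one> \<in> lsum L L'" using L'(3) by simp
  then obtain h h' where h: "h \<in> L" "h' \<in> L'" "\<one> = h \<oplus> h'" by (rule lsumE)
  have c: "h \<in> carrier R" "h' \<in> carrier R" using h LD(6) L'D(6) by auto
  have "x \<otimes> h = x" if x: "x \<in> L" for x
  proof -
    have xc: "x \<in> carrier R" using x LD(6) by simp
    have eq: "x = x \<otimes> h \<oplus> x \<otimes> h'" using h(3) xc c by (metis r_distr r_one)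
    have "x \<otimes> h' = x \<oplus> \<ominus> (x \<otimes> h)"
    proof -
      have "x \<oplus> \<ominus> (x \<otimes> h) = (x \<otimes> h \<oplus> x \<otimes> h') \<oplus> \<ominus> (x \<otimes> h)" using eq by simp
      also have "\<dots> = x \<otimes> h'" using xc c by (simp add: a_ac r_neg)
      finally show ?thesis by simp
    qed
    then have "x \<otimes> h' \<in> L" using LD(3)[OF x LD(4)[OF LD(5)[OF xc h(1)]]] by simp
    moreover have "x \<otimes> h' \<in> L'" using L'D(5)[OF xc h(2)] .
    ultimately have "x \<otimes> h' = \<zero>" using L'(2) by blast
    then show ?thesis using eq xc c by simp
  qed
  then show ?thesis using that h(1) by blast
qed

text \<open>Von Neumann regularity. In combination with the chain condition it replaces
  semisimplicity from here on, since it passes directly to the factors \<open>e R\<close> and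
  produces relative inverses.\<close>

definition vnr :: bool where
  "vnr \<longleftrightarrow> (\<forall>a\<in>carrier R. \<exists>x\<in>carrier R. a \<otimes> x \<otimes> a = a)"

lemma vnrE:
  assumes vnr "a \<in> carrier R"
  obtains x where "x \<in> carrier R" "a \<otimes> x \<otimes> a = a"
  using assms unfolding vnr_def by auto

lemma semisimple_artinian_vnr:
  assumes ss: "semisimple_artinian R" shows vnr
  unfolding vnr_def
proof
  fix a assume a: "a \<in> carrier R"
  obtain h where h: "h \<in> princ a" "\<forall>x\<in>princ a. x \<otimes> h = x"
    using lideal_generated_by_idempotent[OF ss lideal_princ[OF a]] .
  obtain x where x: "x \<in> carrier R" "h = x \<otimes> a" using h(1) by (rule princE)
  have "a \<otimes> x \<otimes> a = a" using bspec[OF h(2) princ_self[OF a]] x a by (simp add: m_assoc)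
  then show "\<exists>x\<in>carrier R. a \<otimes> x \<otimes> a = a" using x(1) by blast
qed

lemma centerD:
  assumes "z \<in> center R"
  shows "z \<in> carrier R" "\<And>x. x \<in> carrier R \<Longrightarrow> z \<otimes> x = x \<otimes> z"
  using assms unfolding center_def by auto

lemma centerI: "z \<in> carrier R \<Longrightarrow> (\<And>x. x \<in> carrier R \<Longrightarrow> z \<otimes> x = x \<otimes> z) \<Longrightarrow> z \<in> center R"
  unfolding center_def by simp

lemma center_mult: assumes "f \<in> center R" "e \<in> center R" shows "f \<otimes> e \<in> center R"
proof (rule centerI)
  note f = centerD[OF assms(1)] and e = centerD[OF assms(2)]
  fix x assume x: "x \<in> carrier R"
  have "f \<otimes> e \<otimes> x = f \<otimes> (x \<otimes> e)" using f(1) e x by (simp only: m_assoc)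
  also have "\<dots> = x \<otimes> f \<otimes> e" using f(1) f(2)[OF x, symmetric] e(1) x by (simp only: m_assoc[symmetric])
  also have "\<dots> = x \<otimes> (f \<otimes> e)" using f(1) e(1) x by (simp only: m_assoc)
  finally show "f \<otimes> e \<otimes> x = x \<otimes> (f \<otimes> e)" .
qed (use assms centerD(1) in auto)

lemma center_mult_idem:
  assumes "f \<in> center R" "e \<in> carrier R" "f \<otimes> f = f" "e \<otimes> e = e"
  shows "f \<otimes> e \<otimes> (f \<otimes> e) = f \<otimes> e"
proof -
  note f = centerD[OF assms(1)]
  have "f \<otimes> e \<otimes> (f \<otimes> e) = f \<otimes> (e \<otimes> f) \<otimes> e" using f(1) assms(2) by (simp only: m_assoc m_closed)
  also have "\<dots> = f \<otimes> (f \<otimes> e) \<otimes> e" using f(2)[OF assms(2)] by simp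
  also have "\<dots> = (f \<otimes> f) \<otimes> (e \<otimes> e)" using f(1) assms(2) by (simp only: m_assoc m_closed)
  finally show ?thesis using assms by simp
qed

text \<open>Let \<open>h\<close> be a right identity of \<open>L\<close>. As
  \<open>h r \<in> L\<close>, one has \<open>h r h = h r\<close>. For the other half,
  \<open>a = r h - h r h\<close> satisfies \<open>a h = a\<close> and \<open>h a = 0\<close>, so
  regularity gives \<open>a = a x a = a (h x h) a = 0\<close>.\<close>

lemma two_sided_generated_by_central_idempotent:
  assumes ss: "semisimple_artinian R" and L: "lideal R L"
    and right: "\<And>x r. x \<in> L \<Longrightarrow> r \<in> carrier R \<Longrightarrow> x \<otimes> r \<in> L"
  obtains h where "h \<in> L" "h \<in> center R" "h \<otimes> h = h" "\<forall>x\<in>L. x \<otimes> h = x"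
proof -
  obtain h where h: "h \<in> L" "\<forall>x\<in>L. x \<otimes> h = x"
    using lideal_generated_by_idempotent[OF ss L] .
  have hc: "h \<in> carrier R" using h(1) lidealD(6)[OF L] by simp
  have hr: "h \<otimes> r \<otimes> h = h \<otimes> r" if "r \<in> carrier R" for r using h right that by simp
  have "h \<otimes> r = r \<otimes> h" if r: "r \<in> carrier R" for r
  proof -
    define a where "a = r \<otimes> h \<ominus> h \<otimes> r \<otimes> h"
    have ac: "a \<in> carrier R" unfolding a_def using r hc by simp
    obtain x where x: "x \<in> carrier R" "a \<otimes> x \<otimes> a = a"
      using vnrE[OF semisimple_artinian_vnr[OF ss] ac] .
    have ah: "a \<otimes> h = a" unfolding a_def using r hc h
      by (simp add: minus_eq l_distr l_minus m_assoc)
    have ha: "h \<otimes> a = \<zero>" unfolding a_def using r hc h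
      by (simp add: minus_eq r_distr r_minus m_assoc[symmetric] r_neg)
    have "a = a \<otimes> h \<otimes> x \<otimes> a" using x ah by simp
    also have "\<dots> = a \<otimes> (h \<otimes> x \<otimes> h) \<otimes> a" using hr[OF x(1)] x(1) ac hc by (simp add: m_assoc)
    also have "\<dots> = a \<otimes> h \<otimes> x \<otimes> (h \<otimes> a)" using x(1) ac hc by (simp add: m_assoc)
    also have "\<dots> = \<zero>" using ha x(1) ac hc by simp
    finally have "r \<otimes> h \<ominus> h \<otimes> r \<otimes> h = \<zero>" unfolding a_def .
    then have "r \<otimes> h = h \<otimes> r \<otimes> h" using r hc by simp
    then show ?thesis using hr[OF r] by simp
  qed
  then have "h \<in> center R" unfolding center_def using hc by simp
  then show ?thesis using that[of h] h by simp
qed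

text \<open>The factor \<open>e R\<close> is a prime ring: the right annihilator of
  \<open>a R\<close> is two-sided, hence generated by a central idempotent \<open>h\<close>, and
  primitivity leaves only \<open>h e = 0\<close> and \<open>h e = e\<close>. The first forces
  \<open>b = 0\<close>, the second puts \<open>a\<close> into its own annihilator, against
  regularity.\<close>

lemma prim_central_idem_prime:
  assumes ss: "semisimple_artinian R" and e: "prim_central_idem R e"
    and ab: "a \<in> carrier R" "b \<in> carrier R" "e \<otimes> a = a" "e \<otimes> b = b" "a \<noteq> \<zero>" "b \<noteq> \<zero>"
  obtains r where "r \<in> carrier R" "a \<otimes> r \<otimes> b \<noteq> \<zero>"
proof -
  define N where "N = {x \<in> carrier R. \<forall>r\<in>carrier R. a \<otimes> r \<otimes> x = \<zero>}"
  have lN: "lideal R N"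
  proof (rule lidealI)
    fix r x assume r: "r \<in> carrier R" "x \<in> N"
    have "a \<otimes> s \<otimes> (r \<otimes> x) = \<zero>" if "s \<in> carrier R" for s
    proof -
      have "a \<otimes> (s \<otimes> r) \<otimes> x = \<zero>" using r that unfolding N_def by simp
      then show ?thesis using r that ab unfolding N_def by (simp add: m_assoc)
    qed
    then show "r \<otimes> x \<in> N" using r unfolding N_def by simp
  qed (use ab in \<open>auto simp: N_def r_distr\<close>)
  have rN: "x \<otimes> r \<in> N" if "x \<in> N" "r \<in> carrier R" for x r
    using that ab unfolding N_def by (simp add: m_assoc[symmetric])
  obtain h where h: "h \<in> N" "h \<in> center R" "h \<otimes> h = h" "\<forall>x\<in>N. x \<otimes> h = x"
    using two_sided_generated_by_central_idempotent[OF ss lN rN] .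
  note hC = centerD[OF h(2)]
  have ec: "e \<in> center R" using e unfolding prim_central_idem_def by simp
  note eC = centerD[OF ec]
  have "a \<notin> N"
  proof
    assume "a \<in> N"
    moreover obtain x where "x \<in> carrier R" "a \<otimes> x \<otimes> a = a"
      using vnrE[OF semisimple_artinian_vnr[OF ss] ab(1)] .
    ultimately show False using ab(5) unfolding N_def by simp
  qed
  moreover have "b \<notin> N"
  proof
    assume b: "b \<in> N"
    have bh: "b = h \<otimes> b" using bspec[OF h(4) b] hC(2)[OF ab(2)] by simp
    have "h \<otimes> e = \<zero> \<or> h \<otimes> e = e" using e h unfolding prim_central_idem_def by simp
    then show False
    proof
      assume he: "h \<otimes> e = \<zero>"
      have "b = h \<otimes> (e \<otimes> b)" using bh ab by simp
      also have "\<dots> = h \<otimes> e \<otimes> b" using hC(1) eC(1) ab(2) by (simp only: m_assoc)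
      also have "\<dots> = \<zero>" using he ab(2) by simp
      finally show False using ab by simp
    next
      assume he: "h \<otimes> e = e"
      have "h \<otimes> a = h \<otimes> (e \<otimes> a)" using ab by simp
      also have "\<dots> = h \<otimes> e \<otimes> a" using hC(1) eC(1) ab(1) by (simp only: m_assoc)
      also have "\<dots> = a" using he ab(3) by simp
      finally have "h \<otimes> a = a" .
      then have "a \<in> N" using rN[OF h(1) ab(1)] by simp
      then show False using \<open>a \<notin> N\<close> by simp
    qed
  qed
  then show ?thesis using that ab unfolding N_def by blast
qed

text \<open>If \<open>R e\<close> is minimal, a nonzero product \<open>f e\<close> generates all of
  \<open>R e\<close>; then \<open>e\<close> is a multiple of \<open>f e\<close>, and
  \<open>f\<close> acts on it as the identity.\<close>

lemma prim_central_idem_below: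
  assumes art: "left_artinian R" and k: "k \<in> center R" "k \<otimes> k = k" "k \<noteq> \<zero>"
  obtains e where "prim_central_idem R e" "k \<otimes> e = e"
proof -
  let ?P = "\<lambda>e. e \<in> center R \<and> e \<otimes> e = e \<and> e \<noteq> \<zero> \<and> k \<otimes> e = e"
  have P0: "?P k" using k by simp
  have Pl: "lideal R (princ e)" if "?P e" for e
    by (rule lideal_princ[OF centerD(1)[OF conjunct1[OF that]]])
  obtain e where e: "?P e" and min: "\<forall>y. ?P y \<longrightarrow> \<not> princ y \<subset> princ e"
    by (rule dcc_minimal[where P = ?P and L = princ, OF art P0 Pl])
  have eC: "e \<in> center R" using e by simp
  note eC = centerD[OF eC] and kC = centerD[OF k(1)]
  have "f \<otimes> e = \<zero> \<or> f \<otimes> e = e" if f: "f \<in> center R" "f \<otimes> f = f" for f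
  proof (cases "f \<otimes> e = \<zero>")
    case False
    note fC = centerD[OF f(1)]
    have "f \<otimes> e \<otimes> (f \<otimes> e) = f \<otimes> e" using center_mult_idem f e eC(1) by blast
    moreover have "f \<otimes> e \<in> center R" using center_mult f e by blast
    moreover have "k \<otimes> (f \<otimes> e) = f \<otimes> e"
    proof -
      have "k \<otimes> (f \<otimes> e) = f \<otimes> k \<otimes> e"
        using kC(1) fC(1) eC(1) kC(2)[OF fC(1)] by (simp only: m_assoc[symmetric])
      also have "\<dots> = f \<otimes> e" using e kC(1) fC(1) eC(1) by (simp only: m_assoc)
      finally show ?thesis .
    qed
    ultimately have "\<not> princ (f \<otimes> e) \<subset> princ e" using min False by simp
    moreover have "princ (f \<otimes> e) \<subseteq> princ e"
      using princ_least[OF lideal_princ] lidealD(5)[OF lideal_princ] princ_self fC(1) eC(1) by simp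
    ultimately have "e \<in> princ (f \<otimes> e)" using princ_self[OF eC(1)] by blast
    then obtain r where r: "r \<in> carrier R" "e = r \<otimes> (f \<otimes> e)" by (rule princE)
    have "f \<otimes> e = e \<otimes> f" using fC(2)[OF eC(1)] .
    also have "\<dots> = r \<otimes> (f \<otimes> e) \<otimes> f" using r by simp
    also have "\<dots> = r \<otimes> (f \<otimes> (e \<otimes> f))" using r(1) fC(1) eC(1) by (simp only: m_assoc m_closed)
    also have "\<dots> = r \<otimes> (f \<otimes> f \<otimes> e)"
      using r(1) fC(1) eC(1) fC(2)[OF eC(1), symmetric] by (simp only: m_assoc m_closed)
    also have "\<dots> = e" using f r by simp
    finally show ?thesis by simp
  qed simp
  then have "prim_central_idem R e" using e unfolding prim_central_idem_def by simp
  then show ?thesis using that e by simp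
qed

section \<open>Idempotents, corners and primitive idempotents\<close>

definition idem :: "'a \<Rightarrow> bool" where
  "idem p \<longleftrightarrow> p \<in> carrier R \<and> p \<otimes> p = p"

text \<open>For idempotents this is the Peirce component \<open>p R q\<close>. Left multiplication
  makes its elements the homomorphisms from the projective right module \<open>q R\<close> to
  \<open>p R\<close>.\<close>

definition corner :: "'a \<Rightarrow> 'a \<Rightarrow> 'a set" where
  "corner p q = {x \<in> carrier R. p \<otimes> x = x \<and> x \<otimes> q = x}"

definition primitive :: "'a \<Rightarrow> bool" where
  "primitive f \<longleftrightarrow> idem f \<and> f \<noteq> \<zero> \<and> (\<forall>p. idem p \<and> p \<in> corner f f \<longrightarrow> p = \<zero> \<or> p = f)"

lemma idemD: assumes "idem p" shows "p \<in> carrier R" "p \<otimes> p = p"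
  using assms unfolding idem_def by auto

lemma cornerD:
  assumes "x \<in> corner p q" shows "x \<in> carrier R" "p \<otimes> x = x" "x \<otimes> q = x"
  using assms unfolding corner_def by auto

lemma cornerI: "x \<in> carrier R \<Longrightarrow> p \<otimes> x = x \<Longrightarrow> x \<otimes> q = x \<Longrightarrow> x \<in> corner p q"
  unfolding corner_def by auto

lemma idem_corner: "idem p \<Longrightarrow> p \<in> corner p p"
  unfolding idem_def corner_def by auto

lemma corner_mult:
  assumes "idem p" "idem q" "r \<in> carrier R" shows "p \<otimes> r \<otimes> q \<in> corner p q"
proof (rule cornerI)
  note c = idemD[OF assms(1)] idemD[OF assms(2)] assms(3)
  show "p \<otimes> (p \<otimes> r \<otimes> q) = p \<otimes> r \<otimes> q" using c by (simp add: m_assoc[symmetric])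
  show "p \<otimes> r \<otimes> q \<otimes> q = p \<otimes> r \<otimes> q" using c by (simp add: m_assoc)
qed (use assms idemD in auto)

lemma corner_trans:
  assumes "g \<in> carrier R" "k \<in> corner g g" "x \<in> corner k k" shows "x \<in> corner g g"
proof (rule cornerI)
  note k = cornerD[OF assms(2)] and x = cornerD[OF assms(3)]
  have "g \<otimes> (k \<otimes> x) = k \<otimes> x" using k x(1) assms(1) by (simp add: m_assoc[symmetric])
  then show "g \<otimes> x = x" using x by simp
  have "x \<otimes> k \<otimes> g = x \<otimes> k" using k x(1) assms(1) by (simp add: m_assoc)
  then show "x \<otimes> g = x" using x by simp
  show "x \<in> carrier R" using x by simp
qed

lemma primitive_below:
  assumes art: "left_artinian R" and k: "idem k" "k \<noteq> \<zero>"
  obtains f where "primitive f" "f \<in> corner k k"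
proof -
  let ?P = "\<lambda>f. idem f \<and> f \<noteq> \<zero> \<and> f \<in> corner k k"
  have P0: "?P k" using k idem_corner by simp
  have Pl: "lideal R (princ e)" if "?P e" for e
    by (rule lideal_princ[OF idemD(1)[OF conjunct1[OF that]]])
  obtain f where f: "?P f" and min: "\<forall>y. ?P y \<longrightarrow> \<not> princ y \<subset> princ f"
    by (rule dcc_minimal[where P = ?P and L = princ, OF art P0 Pl])
  have fc: "f \<in> carrier R" "idem f" using f idemD by auto
  have "p = f" if p: "idem p" "p \<in> corner f f" "p \<noteq> \<zero>" for p
  proof -
    note pc = idemD[OF p(1)] and pf = cornerD[OF p(2)]
    have "p \<in> corner k k" using corner_trans[OF _ _ p(2)] f k idemD by blast
    then have "\<not> princ p \<subset> princ f" using min p by simp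
    moreover have "princ p \<subseteq> princ f"
      by (rule princ_least[OF lideal_princ]) (use pc pf fc in \<open>auto intro: princI[of p]\<close>)
    ultimately have "f \<in> princ p" using princ_self fc by auto
    then obtain r where r: "r \<in> carrier R" "f = r \<otimes> p" by (rule princE)
    then have "f \<otimes> p = f" using pc by (simp add: m_assoc)
    then show ?thesis using pf by simp
  qed
  then have "primitive f" using f unfolding primitive_def by auto
  then show ?thesis using that f by simp
qed

lemma idem_diff:
  assumes "idem g" "idem h" "h \<in> corner g g"
  shows "idem (g \<ominus> h)" "g \<ominus> h \<in> corner g g" "h \<otimes> (g \<ominus> h) = \<zero>" "(g \<ominus> h) \<otimes> h = \<zero>"
proof -
  note c = idemD[OF assms(1)] idemD[OF assms(2)] cornerD[OF assms(3)]
  have 1: "h \<otimes> (g \<ominus> h) = \<zero>" "(g \<ominus> h) \<otimes> h = \<zero>"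
    using c by (simp_all add: minus_eq l_distr r_distr l_minus r_minus r_neg)
  have 2: "g \<otimes> (g \<ominus> h) = g \<ominus> h" "(g \<ominus> h) \<otimes> g = g \<ominus> h"
    using c by (simp_all add: minus_eq l_distr r_distr l_minus r_minus r_neg)
  have "(g \<ominus> h) \<otimes> (g \<ominus> h) = (g \<ominus> h) \<otimes> g \<ominus> (g \<ominus> h) \<otimes> h"
    using c by (simp add: minus_eq r_distr r_minus)
  then show "idem (g \<ominus> h)" using 1 2 c by (simp add: idem_def minus_eq)
  show "h \<otimes> (g \<ominus> h) = \<zero>" "(g \<ominus> h) \<otimes> h = \<zero>" "g \<ominus> h \<in> corner g g"
    using 1 2 c by (auto intro: cornerI)
qed

text \<open>Schur's lemma for \<open>f' R\<close> and \<open>f R\<close>. If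
  \<open>a x a = a\<close>, then \<open>b = f' x f\<close> makes \<open>a b\<close> and
  \<open>b a\<close> nonzero idempotents of \<open>f R f\<close> and \<open>f' R f'\<close>, and
  primitivity identifies them with \<open>f\<close> and \<open>f'\<close>.\<close>

lemma primitive_corner_inverse:
  assumes v: vnr and f: "primitive f" "primitive f'" and a: "a \<in> corner f f'" "a \<noteq> \<zero>"
  obtains b where "b \<in> corner f' f" "a \<otimes> b = f" "b \<otimes> a = f'"
proof -
  have i: "idem f" "idem f'" using f unfolding primitive_def by auto
  note c = idemD[OF i(1)] idemD[OF i(2)] cornerD[OF a(1)]
  obtain x where x: "x \<in> carrier R" "a \<otimes> x \<otimes> a = a" using vnrE[OF v c(5)] .
  define b where "b = f' \<otimes> x \<otimes> f"
  have b: "b \<in> corner f' f" unfolding b_def using corner_mult[OF i(2,1) x(1)] .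
  note bc = cornerD[OF b]
  have aba: "a \<otimes> b \<otimes> a = a"
  proof -
    have "a \<otimes> b \<otimes> a = (a \<otimes> f') \<otimes> x \<otimes> (f \<otimes> a)" unfolding b_def using c(1,3,5) x(1) by (simp only: m_assoc m_closed)
    then show ?thesis using c x by (simp only:)
  qed
  have "idem (a \<otimes> b)" unfolding idem_def using aba bc c by (simp add: m_assoc[symmetric])
  moreover have "a \<otimes> b \<in> corner f f"
    using bc c by (intro cornerI) (simp_all add: m_assoc[symmetric], simp add: m_assoc)
  moreover have "a \<otimes> b \<noteq> \<zero>" using aba a c by auto
  ultimately have 1: "a \<otimes> b = f" using f(1) unfolding primitive_def by blast
  have "idem (b \<otimes> a)" unfolding idem_def using aba bc c by (simp add: m_assoc)
  moreover have "b \<otimes> a \<in> corner f' f'"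
    using bc c by (intro cornerI) (simp_all add: m_assoc[symmetric], simp add: m_assoc)
  moreover have "b \<otimes> a \<noteq> \<zero>" using aba a c bc by (auto simp: m_assoc)
  ultimately have 2: "b \<otimes> a = f'" using f(2) unfolding primitive_def by blast
  show ?thesis using that[OF b 1 2] .
qed

end

section \<open>Determinants over commutative rings\<close>

lemma (in ring) finsum_swap:
  assumes "finite A" "finite B" "\<And>i j. i \<in> A \<Longrightarrow> j \<in> B \<Longrightarrow> f i j \<in> carrier R"
  shows "(\<Oplus>i\<in>A. \<Oplus>j\<in>B. f i j) = (\<Oplus>j\<in>B. \<Oplus>i\<in>A. f i j)"
  using assms(1,3)
proof (induction A)
  case (insert a A)
  have "(\<Oplus>i\<in>insert a A. \<Oplus>j\<in>B. f i j) = (\<Oplus>j\<in>B. f a j) \<oplus> (\<Oplus>i\<in>A. \<Oplus>j\<in>B. f i j)"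
    using insert by (subst finsum_insert) (auto intro!: finsum_closed)
  also have "\<dots> = (\<Oplus>j\<in>B. f a j) \<oplus> (\<Oplus>j\<in>B. \<Oplus>i\<in>A. f i j)"
    using insert by simp
  also have "\<dots> = (\<Oplus>j\<in>B. f a j \<oplus> (\<Oplus>i\<in>A. f i j))"
    using insert.prems by (subst finsum_addf) (auto intro!: finsum_closed)
  also have "\<dots> = (\<Oplus>j\<in>B. \<Oplus>i\<in>insert a A. f i j)"
    by (rule finsum_cong') (use insert in \<open>auto intro!: finsum_closed\<close>)
  finally show ?case .
qed simp

lemma (in ring) finsum_Times:
  assumes "finite A" "finite B" "\<And>i j. i \<in> A \<Longrightarrow> j \<in> B \<Longrightarrow> f i j \<in> carrier R"
  shows "(\<Oplus>x\<in>A \<times> B. f (fst x) (snd x)) = (\<Oplus>i\<in>A. \<Oplus>j\<in>B. f i j)"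
  using assms(1,3)
proof (induction A)
  case (insert a A)
  have 1: "(\<Oplus>x\<in>Pair a ` B. f (fst x) (snd x)) = (\<Oplus>j\<in>B. f a j)"
    by (subst finsum_reindex) (use insert.prems in \<open>auto simp: inj_on_def\<close>)
  have "insert a A \<times> B = Pair a ` B \<union> A \<times> B" by auto
  then have "(\<Oplus>x\<in>insert a A \<times> B. f (fst x) (snd x))
      = (\<Oplus>x\<in>Pair a ` B. f (fst x) (snd x)) \<oplus> (\<Oplus>x\<in>A \<times> B. f (fst x) (snd x))"
    using insert assms(2) by (simp only:) (rule finsum_Un_disjoint, auto)
  then show ?case using insert 1 by (simp add: Pi_def)
qed simp

context cring
begin

lemma finprod_finsum:
  assumes "finite I" "finite K" "\<And>i k. i \<in> I \<Longrightarrow> k \<in> K \<Longrightarrow> a i k \<in> carrier R"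
  shows "(\<Otimes>i\<in>I. \<Oplus>k\<in>K. a i k) = (\<Oplus>f\<in>I \<rightarrow>\<^sub>E K. \<Otimes>i\<in>I. a i (f i))"
  using assms(1,3)
proof (induction I)
  case empty
  then show ?case by (simp add: PiE_empty_domain)
next
  case (insert j I)
  let ?G = "I \<rightarrow>\<^sub>E K"
  have fG: "finite ?G" using insert(1) assms(2) by (simp add: finite_PiE)
  have pc: "(\<Otimes>i\<in>I. a i (g i)) \<in> carrier R" if "g \<in> ?G" for g
    using that insert by (intro finprod_closed) (auto simp: PiE_iff)
  \<comment> \<open>The pair can be recovered from the updated function because members of
    \<open>?G\<close> are \<open>undefined\<close> at \<open>j\<close>, which lies outside
    \<open>I\<close>.\<close>
  have inj: "inj_on (\<lambda>x. (snd x)(j := fst x)) (K \<times> ?G)"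
  proof (rule inj_onI)
    fix x y assume x: "x \<in> K \<times> ?G" and y: "y \<in> K \<times> ?G" and eq: "(snd x)(j := fst x) = (snd y)(j := fst y)"
    have "fst x = fst y" using fun_cong[OF eq, of j] by simp
    moreover have "snd x = snd y"
    proof
      fix i
      have "snd x j = undefined" "snd y j = undefined"
        using x y insert(2) by (auto simp: PiE_iff extensional_def)
      then show "snd x i = snd y i" using fun_cong[OF eq, of i] by (cases "i = j") auto
    qed
    ultimately show "x = y" by (simp add: prod_eq_iff)
  qed
  have img: "insert j I \<rightarrow>\<^sub>E K = (\<lambda>x. (snd x)(j := fst x)) ` (K \<times> ?G)"
    by (simp add: PiE_insert_eq case_prod_beta')
  have val: "(\<Otimes>i\<in>insert j I. a i (((snd x)(j := fst x)) i)) = a j (fst x) \<otimes> (\<Otimes>i\<in>I. a i (snd x i))"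
    if x: "x \<in> K \<times> ?G" for x
  proof -
    have "(\<Otimes>i\<in>I. a i (((snd x)(j := fst x)) i)) = (\<Otimes>i\<in>I. a i (snd x i))"
      by (rule finprod_cong') (use x insert in \<open>auto simp: PiE_iff\<close>)
    then show ?thesis using x insert by (subst finprod_insert) (auto simp: PiE_iff)
  qed
  have "(\<Oplus>f\<in>insert j I \<rightarrow>\<^sub>E K. \<Otimes>i\<in>insert j I. a i (f i))
      = (\<Oplus>x\<in>K \<times> ?G. \<Otimes>i\<in>insert j I. a i (((snd x)(j := fst x)) i))"
    unfolding img
  proof (rule finsum_reindex[OF _ inj])
    show "(\<lambda>f. \<Otimes>i\<in>insert j I. a i (f i)) \<in> (\<lambda>x. (snd x)(j := fst x)) ` (K \<times> ?G) \<rightarrow> carrier R"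
      unfolding img[symmetric] using insert.prems by (auto intro!: finprod_closed simp: PiE_iff)
  qed
  also have "\<dots> = (\<Oplus>x\<in>K \<times> ?G. a j (fst x) \<otimes> (\<Otimes>i\<in>I. a i (snd x i)))"
    by (rule finsum_cong') (use val insert.prems pc in \<open>auto\<close>)
  also have "\<dots> = (\<Oplus>k\<in>K. \<Oplus>g\<in>?G. a j k \<otimes> (\<Otimes>i\<in>I. a i (g i)))"
    by (rule finsum_Times[where f = "\<lambda>k g. a j k \<otimes> (\<Otimes>i\<in>I. a i (g i))"])
      (use assms(2) fG insert.prems pc in auto)
  also have "\<dots> = (\<Oplus>k\<in>K. a j k \<otimes> (\<Oplus>g\<in>?G. \<Otimes>i\<in>I. a i (g i)))"
    by (rule finsum_cong') (use insert.prems pc fG in \<open>auto intro!: finsum_closed simp: finsum_rdistr\<close>)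
  also have "\<dots> = (\<Oplus>k\<in>K. a j k) \<otimes> (\<Oplus>g\<in>?G. \<Otimes>i\<in>I. a i (g i))"
    using assms(2) insert.prems pc by (subst finsum_ldistr) (auto intro!: finsum_closed)
  also have "\<dots> = (\<Oplus>k\<in>K. a j k) \<otimes> (\<Otimes>i\<in>I. \<Oplus>k\<in>K. a i k)"
    using insert by simp
  also have "\<dots> = (\<Otimes>i\<in>insert j I. \<Oplus>k\<in>K. a i k)"
    using insert by (subst finprod_insert) (auto intro!: finsum_closed)
  finally show ?case by simp
qed

definition psgn :: "(nat \<Rightarrow> nat) \<Rightarrow> 'a" where
  "psgn p = (if sign p = (1::int) then \<one> else \<ominus> \<one>)"

text \<open>The Leibniz formula of \<open>mdet\<close> inside a commutative ring; it is applied to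
  the centre of a noncommutative ring.\<close>

definition cdet :: "nat \<Rightarrow> (nat \<times> nat \<Rightarrow> 'a) \<Rightarrow> 'a" where
  "cdet n M = (\<Oplus>p\<in>{p. p permutes {..<n}}. psgn p \<otimes> (\<Otimes>i\<in>{..<n}. M (i, p i)))"

lemma psgn_closed [simp]: "psgn p \<in> carrier R"
  unfolding psgn_def by simp

lemma psgn_id [simp]: "psgn id = \<one>"
  unfolding psgn_def by simp

lemma psgn_comp:
  assumes "p permutes {..<n}" "q permutes {..<n}"
  shows "psgn (p \<circ> q) = psgn p \<otimes> psgn q"
proof -
  have "permutation p" "permutation q" using assms permutation_permutes by blast+
  then have "sign (p \<circ> q) = sign p * sign q" by (rule sign_compose)
  then show ?thesis unfolding psgn_def by (auto simp: sign_def l_minus)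
qed

lemma psgn_inv:
  assumes "p permutes {..<n}" shows "psgn (inv_into UNIV p) = psgn p"
proof -
  have "permutation p" using assms permutation_permutes by blast
  then show ?thesis unfolding psgn_def by (simp add: sign_inverse)
qed

lemma psgn_transpose:
  assumes "a \<noteq> b" shows "psgn (Transposition.transpose a b) = \<ominus> \<one>"
  using assms unfolding psgn_def by (simp add: sign_swap_id)

lemma fin_perms: "finite {p. p permutes {..<n::nat}}"
  by (rule finite_permutations) simp

lemma permutes_lt: "p permutes {..<n} \<Longrightarrow> i < n \<Longrightarrow> p i < (n::nat)"
  using permutes_in_image[of p "{..<n}" i] by simp

text \<open>Substituting \<open>p \<circ> q\<close> for \<open>p\<close> in the Leibniz sum. The
  selection \<open>f\<close> need not be injective, so the lemma serves both for permuted rows and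
  for repeated rows.\<close>

lemma row_selection_det:
  assumes B: "\<And>i j. i < n \<Longrightarrow> j < n \<Longrightarrow> B (i, j) \<in> carrier R"
    and f: "\<And>i. i < n \<Longrightarrow> f i < n" and q: "q permutes {..<n}"
  shows "cdet n (\<lambda>(i, j). B (f (q i), j)) = psgn q \<otimes> cdet n (\<lambda>(i, j). B (f i, j))"
proof -
  let ?P = "{p. p permutes {..<n}}"
  let ?t = "\<lambda>p. \<Otimes>i\<in>{..<n}. B (f i, p i)"
  have tc: "?t p \<in> carrier R" if "p permutes {..<n}" for p
    using B f permutes_lt[OF that] by (intro finprod_closed) auto
  have bij: "bij_betw (\<lambda>p. p \<circ> q) ?P ?P"
    by (rule bij_betw_byWitness[where f' = "\<lambda>p. p \<circ> inv_into UNIV q"])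
      (use q in \<open>auto simp: comp_assoc permutes_inv_o intro: permutes_compose permutes_inv\<close>)
  have im: "(\<lambda>p. p \<circ> q) ` ?P = ?P" and inj: "inj_on (\<lambda>p. p \<circ> q) ?P"
    using bij unfolding bij_betw_def by auto
  have s: "(\<Otimes>i\<in>{..<n}. B (f (q i), (p \<circ> q) i)) = ?t p" if p: "p permutes {..<n}" for p
  proof -
    have "(\<Otimes>i\<in>q ` {..<n}. B (f i, p i)) = (\<Otimes>i\<in>{..<n}. B (f (q i), p (q i)))"
      by (rule finprod_reindex)
        (use B f permutes_lt[OF p] permutes_lt[OF q] permutes_inj_on[OF q] in auto)
    then show ?thesis using permutes_image[OF q] by simp
  qed
  have sc: "(\<Otimes>i\<in>{..<n}. B (f (q i), p i)) \<in> carrier R" if "p permutes {..<n}" for p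
    using B f permutes_lt[OF that] permutes_lt[OF q] by (intro finprod_closed) auto
  have "cdet n (\<lambda>(i, j). B (f (q i), j))
      = (\<Oplus>p\<in>(\<lambda>p. p \<circ> q) ` ?P. psgn p \<otimes> (\<Otimes>i\<in>{..<n}. B (f (q i), p i)))"
    unfolding cdet_def im by simp
  also have "\<dots> = (\<Oplus>p\<in>?P. psgn (p \<circ> q) \<otimes> (\<Otimes>i\<in>{..<n}. B (f (q i), (p \<circ> q) i)))"
    by (rule finsum_reindex[OF _ inj]) (use im sc in auto)
  also have "\<dots> = (\<Oplus>p\<in>?P. psgn q \<otimes> (psgn p \<otimes> ?t p))"
    by (rule finsum_cong') (use s tc q in \<open>auto simp: psgn_comp m_ac\<close>)
  also have "\<dots> = psgn q \<otimes> cdet n (\<lambda>(i, j). B (f i, j))"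
    unfolding cdet_def using tc fin_perms by (subst finsum_rdistr) auto
  finally show ?thesis .
qed

lemma cdet_closed:
  assumes "\<And>i j. i < n \<Longrightarrow> j < n \<Longrightarrow> B (i, j) \<in> carrier R"
  shows "cdet n B \<in> carrier R"
  unfolding cdet_def using assms permutes_lt
  by (auto intro!: finsum_closed m_closed finprod_closed)

text \<open>Exchanging two equal rows changes the sign but not the matrix, so the determinant is its
  own negative. Absence of 2-torsion finishes the argument.\<close>

lemma row_selection_det_eq_zero:
  assumes two: "\<And>x. x \<in> carrier R \<Longrightarrow> x \<oplus> x = \<zero> \<Longrightarrow> x = \<zero>"
    and B: "\<And>i j. i < n \<Longrightarrow> j < n \<Longrightarrow> B (i, j) \<in> carrier R"
    and f: "\<And>i. i < n \<Longrightarrow> f i < n" and ab: "a < n" "b < n" "a \<noteq> b" "f a = f b"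
  shows "cdet n (\<lambda>(i, j). B (f i, j)) = \<zero>"
proof -
  let ?q = "Transposition.transpose a b"
  let ?D = "cdet n (\<lambda>(i, j). B (f i, j))"
  have q: "?q permutes {..<n}" using ab by (intro permutes_swap_id) auto
  have "f (?q i) = f i" for i using ab by (auto simp: transpose_def)
  then have "?D = psgn ?q \<otimes> ?D"
    using row_selection_det[where n = n and B = B and f = f and q = ?q] B f q by simp
  moreover have D: "?D \<in> carrier R" using B f by (intro cdet_closed) auto
  ultimately have "?D = \<ominus> ?D" using ab(3) by (simp add: psgn_transpose l_minus)
  then have "?D \<oplus> ?D = \<zero>" using D by (metis r_neg)
  then show ?thesis by (rule two[OF D])
qed

text \<open>Expanding each row of the product gives a sum over all functions \<open>f\<close> of a
  product of entries of \<open>A\<close> times the determinant of the rows of \<open>B\<close>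
  selected by \<open>f\<close>. Non-injective \<open>f\<close> contribute zero; the others are
  permutations and contribute a sign.\<close>

lemma cdet_mult:
  assumes two: "\<And>x. x \<in> carrier R \<Longrightarrow> x \<oplus> x = \<zero> \<Longrightarrow> x = \<zero>"
    and A: "\<And>i j. i < n \<Longrightarrow> j < n \<Longrightarrow> A (i, j) \<in> carrier R"
    and B: "\<And>i j. i < n \<Longrightarrow> j < n \<Longrightarrow> B (i, j) \<in> carrier R"
  shows "cdet n (mat_mult R n A B) = cdet n A \<otimes> cdet n B"
proof -
  let ?P = "{p. p permutes {..<n}}"
  let ?F = "{..<n} \<rightarrow>\<^sub>E {..<n}"
  let ?S = "(\<lambda>q. restrict q {..<n}) ` ?P"
  let ?a = "\<lambda>f. \<Otimes>i\<in>{..<n}. A (i, f i)"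
  let ?b = "\<lambda>f p. \<Otimes>i\<in>{..<n}. B (f i, p i)"
  let ?D = "\<lambda>f. cdet n (\<lambda>(i, j). B (f i, j))"
  have fF: "finite ?F" by (simp add: finite_PiE)
  have ac: "?a f \<in> carrier R" if "\<And>i. i < n \<Longrightarrow> f i < n" for f
    using A that by (intro finprod_closed) auto
  have bc: "?b f p \<in> carrier R" if "\<And>i. i < n \<Longrightarrow> f i < n" "p permutes {..<n}" for f p
    using B that(1) permutes_lt[OF that(2)] by (intro finprod_closed) auto
  have Dc: "?D f \<in> carrier R" if "\<And>i. i < n \<Longrightarrow> f i < n" for f
    using B that by (intro cdet_closed) auto
  have Dz: "?D f = \<zero>"
    if "\<And>i. i < n \<Longrightarrow> f i < n" "a < n" "b < n" "a \<noteq> b" "f a = f b" for f a b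
    by (rule row_selection_det_eq_zero[where n = n and B = B and f = f and a = a and b = b];
        (erule (1) two | erule (1) B | erule that(1) | rule that(2-5)))
  have dBc: "cdet n B \<in> carrier R" using B by (rule cdet_closed)
  have Flt: "f i < n" if "f \<in> ?F" "i < n" for f i using that by (auto simp: PiE_iff)
  have one: "(\<Otimes>i\<in>{..<n}. mat_mult R n A B (i, p i)) = (\<Oplus>f\<in>?F. ?a f \<otimes> ?b f p)"
    if p: "p permutes {..<n}" for p
  proof -
    have "(\<Otimes>i\<in>{..<n}. mat_mult R n A B (i, p i))
        = (\<Otimes>i\<in>{..<n}. \<Oplus>k\<in>{..<n}. A (i, k) \<otimes> B (k, p i))"
      by (rule finprod_cong')
        (use A B permutes_lt[OF p] in \<open>auto simp: mat_mult_def intro!: finsum_closed\<close>)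
    also have "\<dots> = (\<Oplus>f\<in>?F. \<Otimes>i\<in>{..<n}. A (i, f i) \<otimes> B (f i, p i))"
      by (rule finprod_finsum) (use A B permutes_lt[OF p] in auto)
    also have "\<dots> = (\<Oplus>f\<in>?F. ?a f \<otimes> ?b f p)"
      by (rule finsum_cong') (use ac bc p Flt A B permutes_lt[OF p] in \<open>auto simp: finprod_multf\<close>)
    finally show ?thesis .
  qed
  have "cdet n (mat_mult R n A B) = (\<Oplus>p\<in>?P. psgn p \<otimes> (\<Oplus>f\<in>?F. ?a f \<otimes> ?b f p))"
    unfolding cdet_def
    by (rule finsum_cong') (use one ac bc Flt in \<open>auto intro!: finsum_closed\<close>)
  also have "\<dots> = (\<Oplus>p\<in>?P. \<Oplus>f\<in>?F. ?a f \<otimes> (psgn p \<otimes> ?b f p))"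
  proof (rule finsum_cong'[OF refl])
    fix p assume "p \<in> ?P"
    then have p: "p permutes {..<n}" by simp
    have "psgn p \<otimes> (\<Oplus>f\<in>?F. ?a f \<otimes> ?b f p) = (\<Oplus>f\<in>?F. psgn p \<otimes> (?a f \<otimes> ?b f p))"
      by (rule finsum_rdistr) (use fF ac bc p Flt in auto)
    also have "\<dots> = (\<Oplus>f\<in>?F. ?a f \<otimes> (psgn p \<otimes> ?b f p))"
      by (rule finsum_cong') (use ac bc p Flt in \<open>auto simp: m_lcomm\<close>)
    finally show "psgn p \<otimes> (\<Oplus>f\<in>?F. ?a f \<otimes> ?b f p) = (\<Oplus>f\<in>?F. ?a f \<otimes> (psgn p \<otimes> ?b f p))" .
  qed (use ac bc Flt in \<open>auto intro!: finsum_closed\<close>)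
  also have "\<dots> = (\<Oplus>f\<in>?F. \<Oplus>p\<in>?P. ?a f \<otimes> (psgn p \<otimes> ?b f p))"
    by (rule finsum_swap) (use fin_perms fF ac bc Flt in auto)
  also have "\<dots> = (\<Oplus>f\<in>?F. ?a f \<otimes> ?D f)"
  proof (rule finsum_cong'[OF refl])
    fix f assume f: "f \<in> ?F"
    show "(\<Oplus>p\<in>?P. ?a f \<otimes> (psgn p \<otimes> ?b f p)) = ?a f \<otimes> ?D f"
      unfolding cdet_def using fin_perms ac[OF Flt[OF f]] bc[OF Flt[OF f]]
      by (subst finsum_rdistr) auto
  qed (use ac Dc Flt in auto)
  also have "\<dots> = (\<Oplus>f\<in>?S. ?a f \<otimes> ?D f)"
  proof (rule add.finprod_mono_neutral_cong_right)
    show "finite ?F" by (rule fF)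
    show "?S \<subseteq> ?F" using permutes_lt by (auto split: if_splits)
    show "?a f \<otimes> ?D f = \<zero>" if f: "f \<in> ?F - ?S" for f
    proof -
      have "\<not> inj_on f {..<n}"
      proof
        assume inj: "inj_on f {..<n}"
        have sub: "f ` {..<n} \<subseteq> {..<n}" using f by (auto simp: PiE_iff)
        have im: "f ` {..<n} = {..<n}" using endo_inj_surj[OF _ sub inj] by simp
        \<comment> \<open>\<open>permutes\<close> demands the identity outside the index set,
          whereas \<open>f\<close> is \<open>undefined\<close> there.\<close>
        let ?q = "\<lambda>i. if i < n then f i else i"
        have "bij_betw ?q {..<n} {..<n}"
          using inj im by (auto simp: bij_betw_def inj_on_def image_def)
        then have "?q permutes {..<n}" by (intro bij_imp_permutes) auto
        moreover have "f = restrict ?q {..<n}"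
          using f by (auto simp: PiE_iff extensional_def fun_eq_iff)
        ultimately show False using f by blast
      qed
      then obtain a b where ab: "a < n" "b < n" "a \<noteq> b" "f a = f b" unfolding inj_on_def by auto
      have "f i < n" if "i < n" for i using Flt that f by blast
      then have "?D f = \<zero>"
        using ab by (rule Dz)
      then show ?thesis using ac[of f] Flt f by auto
    qed
    show "(\<lambda>f. ?a f \<otimes> ?D f) \<in> ?F \<rightarrow> carrier R" using ac Dc Flt by auto
  qed auto
  also have "\<dots> = (\<Oplus>q\<in>?P. ?a (restrict q {..<n}) \<otimes> ?D (restrict q {..<n}))"
  proof (rule finsum_reindex)
    show "(\<lambda>f. ?a f \<otimes> ?D f) \<in> ?S \<rightarrow> carrier R"
      using ac Dc permutes_lt by (auto simp: restrict_def)
    show "inj_on (\<lambda>q. restrict q {..<n}) ?P"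
    proof (rule inj_onI)
      fix p q assume p: "p \<in> ?P" and q: "q \<in> ?P" and eq: "restrict p {..<n} = restrict q {..<n}"
      show "p = q"
      proof
        fix i show "p i = q i"
        proof (cases "i < n")
          case True then show ?thesis using fun_cong[OF eq, of i] by simp
        next
          case False then show ?thesis using p q by (auto simp: permutes_def)
        qed
      qed
    qed
  qed
  also have "\<dots> = (\<Oplus>q\<in>?P. (psgn q \<otimes> ?a q) \<otimes> cdet n B)"
  proof (rule finsum_cong'[OF refl])
    fix q assume "q \<in> ?P"
    then have q: "q permutes {..<n}" by simp
    have 1: "?a (restrict q {..<n}) = ?a q"
      by (rule finprod_cong') (use A permutes_lt[OF q] in auto)
    have cong: "cdet n M = cdet n N"
      if "\<And>i j. i < n \<Longrightarrow> j < n \<Longrightarrow> M (i, j) = N (i, j)" "\<And>i j. i < n \<Longrightarrow> j < n \<Longrightarrow> N (i, j) \<in> carrier R" for M N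
    proof -
      have "(\<Otimes>i\<in>{..<n}. M (i, p i)) = (\<Otimes>i\<in>{..<n}. N (i, p i))" if p: "p permutes {..<n}" for p
        by (rule finprod_cong') (use \<open>\<And>i j. i < n \<Longrightarrow> j < n \<Longrightarrow> M (i, j) = N (i, j)\<close>
          \<open>\<And>i j. i < n \<Longrightarrow> j < n \<Longrightarrow> N (i, j) \<in> carrier R\<close> permutes_lt[OF p] in auto)
      then show ?thesis unfolding cdet_def using that permutes_lt
        by (intro finsum_cong') (auto intro!: finprod_closed)
    qed
    have "?D (restrict q {..<n}) = ?D q"
      by (rule cong) (use B permutes_lt[OF q] in auto)
    also have "\<dots> = psgn q \<otimes> cdet n (\<lambda>(i, j). B (i, j))"
      using row_selection_det[where n = n and B = B and f = "\<lambda>i. i" and q = q] B q by simp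
    finally have 2: "?D (restrict q {..<n}) = psgn q \<otimes> cdet n B" by simp
    show "?a (restrict q {..<n}) \<otimes> ?D (restrict q {..<n}) = psgn q \<otimes> ?a q \<otimes> cdet n B"
      unfolding 1 2 using ac permutes_lt[OF q] dBc by (simp add: m_ac)
  qed (use ac permutes_lt dBc in auto)
  also have "\<dots> = cdet n A \<otimes> cdet n B"
    unfolding cdet_def[of n A] using ac permutes_lt dBc fin_perms
    by (subst finsum_ldistr) auto
  finally show ?thesis .
qed

lemma cdet_transpose:
  assumes A: "\<And>i j. i < n \<Longrightarrow> j < n \<Longrightarrow> A (i, j) \<in> carrier R"
  shows "cdet n (mtranspose A) = cdet n A"
proof -
  let ?P = "{p. p permutes {..<n}}"
  let ?inv = "\<lambda>p::nat \<Rightarrow> nat. inv_into UNIV p"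
  have "bij_betw ?inv ?P ?P"
    by (rule bij_betw_byWitness[where f' = ?inv]) (auto simp: permutes_inv_inv intro: permutes_inv)
  then have im: "?inv ` ?P = ?P" and inj: "inj_on ?inv ?P"
    unfolding bij_betw_def by simp_all
  have s: "(\<Otimes>i\<in>{..<n}. A (?inv p i, i)) = (\<Otimes>i\<in>{..<n}. A (i, p i))" if p: "p permutes {..<n}" for p
  proof -
    have h: "(\<lambda>i. A (?inv p i, i)) \<in> p ` {..<n} \<rightarrow> carrier R"
      unfolding permutes_image[OF p] using permutes_lt[OF permutes_inv[OF p]] A by simp
    have "(\<Otimes>i\<in>p ` {..<n}. A (?inv p i, i)) = (\<Otimes>i\<in>{..<n}. A (?inv p (p i), p i))"
      by (rule finprod_reindex[OF h permutes_inj_on[OF p]])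
    then show ?thesis by (simp only: permutes_image[OF p] permutes_inverses(2)[OF p])
  qed
  have c: "(\<Otimes>i\<in>{..<n}. A (p i, i)) \<in> carrier R" if "p permutes {..<n}" for p
    using A permutes_lt[OF that] by (intro finprod_closed) auto
  have "cdet n (mtranspose A) = (\<Oplus>p\<in>?inv ` ?P. psgn p \<otimes> (\<Otimes>i\<in>{..<n}. A (p i, i)))"
    unfolding cdet_def im mtranspose_def by simp
  also have "\<dots> = (\<Oplus>p\<in>?P. psgn (?inv p) \<otimes> (\<Otimes>i\<in>{..<n}. A (?inv p i, i)))"
    by (rule finsum_reindex[OF _ inj]) (use c im in auto)
  also have "\<dots> = cdet n A"
    unfolding cdet_def
    by (rule finsum_cong') (use s psgn_inv A permutes_lt in \<open>auto intro!: finprod_closed\<close>)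
  finally show ?thesis .
qed

lemma finprod_zero_factor:
  assumes "finite I" "j \<in> I" "f j = \<zero>" "f \<in> I \<rightarrow> carrier R"
  shows "finprod R f I = \<zero>"
proof -
  have "finprod R f (insert j (I - {j})) = f j \<otimes> finprod R f (I - {j})"
    using assms by (intro finprod_insert) auto
  moreover have "finprod R f (I - {j}) \<in> carrier R" using assms by (intro finprod_closed) auto
  ultimately show ?thesis using assms by (simp add: insert_absorb)
qed

lemma cdet_diagonal:
  assumes A: "\<And>i j. i < n \<Longrightarrow> j < n \<Longrightarrow> A (i, j) \<in> carrier R"
    and 0: "\<And>i j. i < n \<Longrightarrow> j < n \<Longrightarrow> i \<noteq> j \<Longrightarrow> A (i, j) = \<zero>"
  shows "cdet n A = (\<Otimes>i\<in>{..<n}. A (i, i))"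
proof -
  let ?P = "{p. p permutes {..<n}}"
  let ?t = "\<lambda>p. psgn p \<otimes> (\<Otimes>i\<in>{..<n}. A (i, p i))"
  have tc: "?t p \<in> carrier R" if "p permutes {..<n}" for p
    using A permutes_lt[OF that] by (intro m_closed finprod_closed) auto
  have "cdet n A = (\<Oplus>p\<in>{id}. ?t p)"
    unfolding cdet_def
  proof (rule add.finprod_mono_neutral_cong_right)
    show "?t p = \<zero>" if p: "p \<in> ?P - {id}" for p
    proof -
      have pp: "p permutes {..<n}" using p by simp
      obtain j where j: "p j \<noteq> j" using p by (auto simp: fun_eq_iff)
      then have jn: "j < n" using pp unfolding permutes_def by auto
      have "(\<Otimes>i\<in>{..<n}. A (i, p i)) = \<zero>"
        by (rule finprod_zero_factor[of _ j])
          (use jn j 0[of j "p j"] A permutes_lt[OF pp] in auto)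
      then show ?thesis by simp
    qed
  qed (use tc fin_perms permutes_id in auto)
  also have "\<dots> = (\<Otimes>i\<in>{..<n}. A (i, i))"
    using A by (subst finsum_insert) (auto intro!: finprod_closed)
  finally show ?thesis .
qed

end

section \<open>Matrix units\<close>

lemma (in ring) finsum_single:
  assumes "finite A" "a \<in> A" "g \<in> A \<rightarrow> carrier R" "\<And>i. i \<in> A \<Longrightarrow> i \<noteq> a \<Longrightarrow> g i = \<zero>"
  shows "finsum R g A = g a"
proof -
  have "finsum R g (insert a (A - {a})) = g a \<oplus> finsum R g (A - {a})"
    using assms(1-3) by (intro finsum_insert) auto
  moreover have "finsum R g (A - {a}) = \<zero>"
    using assms(4) by (intro add.finprod_one_eqI) auto
  moreover have "g a \<in> carrier R" using assms by auto
  ultimately show ?thesis using assms(2) by (simp add: insert_absorb)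
qed

locale ring_with_involution = ring R for R (structure) +
  fixes \<sigma> :: "'a \<Rightarrow> 'a"
  assumes involution: "involution R \<sigma>"
begin

lemma sig_closed [simp, intro]: "x \<in> carrier R \<Longrightarrow> \<sigma> x \<in> carrier R"
  using involution unfolding involution_def by auto

lemma sig_add [simp]: "x \<in> carrier R \<Longrightarrow> y \<in> carrier R \<Longrightarrow> \<sigma> (x \<oplus> y) = \<sigma> x \<oplus> \<sigma> y"
  using involution unfolding involution_def by auto

lemma sig_mult [simp]: "x \<in> carrier R \<Longrightarrow> y \<in> carrier R \<Longrightarrow> \<sigma> (x \<otimes> y) = \<sigma> y \<otimes> \<sigma> x"
  using involution unfolding involution_def by auto

lemma sig_sig [simp]: "x \<in> carrier R \<Longrightarrow> \<sigma> (\<sigma> x) = x"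
  using involution unfolding involution_def by auto

lemma sig_one [simp]: "\<sigma> \<one> = \<one>"
proof -
  have "\<sigma> (\<sigma> \<one> \<otimes> \<one>) = \<sigma> \<one> \<otimes> \<sigma> (\<sigma> \<one>)" by (rule sig_mult) auto
  then show ?thesis by simp
qed

lemma sig_zero [simp]: "\<sigma> \<zero> = \<zero>"
proof -
  have "\<sigma> (\<zero> \<oplus> \<zero>) = \<sigma> \<zero> \<oplus> \<sigma> \<zero>" by (rule sig_add) auto
  then show ?thesis by (metis add.r_cancel_one sig_closed zero_closed r_zero)
qed

lemma sig_minus [simp]: "x \<in> carrier R \<Longrightarrow> \<sigma> (\<ominus> x) = \<ominus> \<sigma> x"
  by (metis a_inv_closed l_neg minus_equality sig_add sig_closed sig_zero)

lemma sig_diff [simp]: "x \<in> carrier R \<Longrightarrow> y \<in> carrier R \<Longrightarrow> \<sigma> (x \<ominus> y) = \<sigma> x \<ominus> \<sigma> y"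
  by (simp add: minus_eq)

lemma sig_eqI: "x \<in> carrier R \<Longrightarrow> y \<in> carrier R \<Longrightarrow> \<sigma> x = \<sigma> y \<Longrightarrow> x = y"
  by (metis sig_sig)

lemma sig_idem: "idem p \<Longrightarrow> idem (\<sigma> p)"
  unfolding idem_def using sig_mult[of p p] by simp

lemma sig_corner: "x \<in> corner p q \<Longrightarrow> p \<in> carrier R \<Longrightarrow> q \<in> carrier R \<Longrightarrow> \<sigma> x \<in> corner (\<sigma> q) (\<sigma> p)"
  unfolding corner_def using sig_mult[of p x] sig_mult[of x q] by simp

lemma sig_corner': "x \<in> corner (\<sigma> p) q \<Longrightarrow> p \<in> carrier R \<Longrightarrow> q \<in> carrier R \<Longrightarrow> \<sigma> x \<in> corner (\<sigma> q) p"
  using sig_corner[of x "\<sigma> p" q] by simp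

lemma sig_primitive:
  assumes "primitive f" shows "primitive (\<sigma> f)"
  unfolding primitive_def
proof (intro conjI allI impI)
  have f: "idem f" "f \<noteq> \<zero>" and fc: "f \<in> carrier R" using assms idemD unfolding primitive_def by auto
  show "idem (\<sigma> f)" using f sig_idem by simp
  show "\<sigma> f \<noteq> \<zero>" using f(2) sig_sig[OF fc] sig_zero by metis
  fix p assume p: "idem p \<and> p \<in> corner (\<sigma> f) (\<sigma> f)"
  then have "idem (\<sigma> p)" "\<sigma> p \<in> corner f f" and pc: "p \<in> carrier R"
    using sig_idem sig_corner[of p "\<sigma> f" "\<sigma> f"] fc idemD by auto
  then have "\<sigma> p = \<zero> \<or> \<sigma> p = f" using assms unfolding primitive_def by blast
  then show "p = \<zero> \<or> p = \<sigma> f" using sig_sig[OF pc] sig_zero by metis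
qed

end

section \<open>The centre as a commutative ring\<close>

context ring
begin

text \<open>The record in which \<open>mdet\<close> forms its products. Its sums are formed in
  \<open>R\<close> instead, which makes comparisons such as \<open>center_finsum\<close>
  necessary.\<close>

abbreviation Cen :: "('a, 'b) ring_scheme" where "Cen \<equiv> R\<lparr>carrier := center R\<rparr>"

lemma center_closed:
  "\<zero> \<in> center R" "\<one> \<in> center R"
  "x \<in> center R \<Longrightarrow> y \<in> center R \<Longrightarrow> x \<oplus> y \<in> center R"
  "x \<in> center R \<Longrightarrow> \<ominus> x \<in> center R"
  unfolding center_def by (auto simp: l_distr r_distr l_minus r_minus)

lemma center_cring: "cring Cen"
proof (rule cringI)
  show "abelian_group Cen"
  proof (rule abelian_groupI)
    fix x assume "x \<in> carrier Cen"
    then show "\<exists>y\<in>carrier Cen. y \<oplus>\<^bsub>Cen\<^esub> x = \<zero>\<^bsub>Cen\<^esub>"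
      using center_closed(4) centerD(1) by (auto intro!: bexI[of _ "\<ominus> x"] simp: l_neg)
  qed (use center_closed centerD(1) in \<open>auto simp: a_ac\<close>)
  show "comm_monoid Cen"
  proof (rule comm_monoidI)
    show "x \<otimes>\<^bsub>Cen\<^esub> y = y \<otimes>\<^bsub>Cen\<^esub> x" if "x \<in> carrier Cen" "y \<in> carrier Cen" for x y
      using centerD(2)[of x y] centerD(1)[of y] that by simp
  qed (use center_closed centerD(1) center_mult in \<open>auto simp: m_assoc\<close>)
qed (use centerD(1) in \<open>auto simp: l_distr\<close>)

lemma center_a_inv: assumes "x \<in> center R" shows "\<ominus>\<^bsub>Cen\<^esub> x = \<ominus> x"
proof -
  interpret Z: cring Cen by (rule center_cring)
  have "\<ominus> x \<oplus>\<^bsub>Cen\<^esub> x = \<zero>\<^bsub>Cen\<^esub>" using assms centerD(1) by (simp add: l_neg)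
  then show ?thesis using Z.minus_equality[of "\<ominus> x" x] assms center_closed(4) by simp
qed

lemma center_finsum:
  assumes "finite A" "f \<in> A \<rightarrow> center R" shows "finsum Cen f A = finsum R f A"
  using assms
proof (induction A)
  case empty
  interpret Z: cring Cen by (rule center_cring)
  show ?case by simp
next
  case (insert a A)
  interpret Z: cring Cen by (rule center_cring)
  have "finsum Cen f (insert a A) = f a \<oplus> finsum Cen f A"
    using insert by (subst Z.finsum_insert) auto
  also have "\<dots> = finsum R f (insert a A)"
    using insert centerD(1) by (subst finsum_insert) auto
  finally show ?case .
qed

lemma mdet_eq_cdet:
  assumes "\<And>i j. i < n \<Longrightarrow> j < n \<Longrightarrow> M (i, j) \<in> center R"
  shows "mdet R n M = cring.cdet Cen n M"
proof -
  interpret Z: cring Cen by (rule center_cring)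
  have c: "finprod Cen (\<lambda>i. M (i, p i)) {..<n} \<in> center R" if "p permutes {..<n}" for p
    using Z.finprod_closed[of "\<lambda>i. M (i, p i)" "{..<n}"] assms Z.permutes_lt[OF that] by auto
  have "cring.cdet Cen n M = (\<Oplus>\<^bsub>R\<^esub> p\<in>{p. p permutes {..<n}}. Z.psgn p \<otimes> finprod Cen (\<lambda>i. M (i, p i)) {..<n})"
    unfolding Z.cdet_def
    using c Z.psgn_closed by (subst center_finsum[OF Z.fin_perms]) (auto intro!: center_mult)
  moreover have "Z.psgn = (\<lambda>p. if sign p = (1::int) then \<one> else \<ominus> \<one>)"
    using center_a_inv[OF center_closed(2)] by (intro ext) (simp add: Z.psgn_def)
  ultimately show ?thesis unfolding mdet_def by simp
qed

end

text \<open>Matrix units split into halves: the products \<open>q i p j\<close> behave like the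
  usual units with one nonzero entry, and \<open>q i p i\<close> are orthogonal idempotents
  isomorphic to \<open>f\<close>. The system is partial because these idempotents need not add up to
  \<open>1\<close>.\<close>

locale partial_matrix_units = ring R for R (structure) +
  fixes n :: nat and f :: 'a and p q :: "nat \<Rightarrow> 'a"
  assumes idem_f: "idem f"
    and p_closed [simp, intro]: "\<And>i. i < n \<Longrightarrow> p i \<in> carrier R"
    and q_closed [simp, intro]: "\<And>i. i < n \<Longrightarrow> q i \<in> carrier R"
    and f_p: "\<And>i. i < n \<Longrightarrow> f \<otimes> p i = p i"
    and q_f: "\<And>i. i < n \<Longrightarrow> q i \<otimes> f = q i"
    and p_q: "\<And>i j. i < n \<Longrightarrow> j < n \<Longrightarrow> p i \<otimes> q j = (if i = j then f else \<zero>)"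
begin

lemma f_closed [simp, intro]: "f \<in> carrier R" and f_f: "f \<otimes> f = f"
  using idem_f idemD by auto

lemma p_sum_q:
  assumes "\<And>k. k < n \<Longrightarrow> g k \<in> carrier R" "i < n"
  shows "p i \<otimes> (\<Oplus>k\<in>{..<n}. q k \<otimes> g k) = f \<otimes> g i"
proof -
  have "p i \<otimes> (\<Oplus>k\<in>{..<n}. q k \<otimes> g k) = (\<Oplus>k\<in>{..<n}. p i \<otimes> (q k \<otimes> g k))"
    using assms by (intro finsum_rdistr) auto
  also have "\<dots> = (\<Oplus>k\<in>{..<n}. p i \<otimes> q k \<otimes> g k)"
    by (rule finsum_cong') (use assms in \<open>auto simp: m_assoc\<close>)
  also have "\<dots> = p i \<otimes> q i \<otimes> g i"
    by (rule finsum_single) (use assms p_q in auto)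
  finally show ?thesis using assms p_q by simp
qed

lemma sum_p_q:
  assumes "\<And>k. k < n \<Longrightarrow> g k \<in> carrier R" "i < n"
  shows "(\<Oplus>k\<in>{..<n}. g k \<otimes> p k) \<otimes> q i = g i \<otimes> f"
proof -
  have "(\<Oplus>k\<in>{..<n}. g k \<otimes> p k) \<otimes> q i = (\<Oplus>k\<in>{..<n}. g k \<otimes> p k \<otimes> q i)"
    using assms by (intro finsum_ldistr) auto
  also have "\<dots> = (\<Oplus>k\<in>{..<n}. g k \<otimes> (p k \<otimes> q i))"
    by (rule finsum_cong') (use assms in \<open>auto simp: m_assoc\<close>)
  also have "\<dots> = g i \<otimes> (p i \<otimes> q i)"
    by (rule finsum_single) (use assms p_q in auto)
  finally show ?thesis using assms p_q by simp
qed

end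

text \<open>Completeness makes \<open>R\<close> a matrix ring over \<open>f R f\<close>;
  commutativity of this corner makes it a copy of the centre of \<open>R\<close>.\<close>

locale matrix_units = partial_matrix_units +
  assumes q_p: "(\<Oplus>i\<in>{..<n}. q i \<otimes> p i) = \<one>"
    and corner_comm: "\<And>x y. x \<in> corner f f \<Longrightarrow> y \<in> corner f f \<Longrightarrow> x \<otimes> y = y \<otimes> x"
begin

lemma expand:
  assumes "x \<in> carrier R"
  shows "x = (\<Oplus>i\<in>{..<n}. q i \<otimes> (p i \<otimes> x))" "x = (\<Oplus>i\<in>{..<n}. x \<otimes> q i \<otimes> p i)"
proof -
  have "x = (\<Oplus>i\<in>{..<n}. q i \<otimes> p i) \<otimes> x" using assms q_p by simp
  also have "\<dots> = (\<Oplus>i\<in>{..<n}. q i \<otimes> p i \<otimes> x)" using assms by (intro finsum_ldistr) auto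
  also have "\<dots> = (\<Oplus>i\<in>{..<n}. q i \<otimes> (p i \<otimes> x))"
    by (rule finsum_cong') (use assms in \<open>auto simp: m_assoc\<close>)
  finally show "x = (\<Oplus>i\<in>{..<n}. q i \<otimes> (p i \<otimes> x))" .
  have "x = x \<otimes> (\<Oplus>i\<in>{..<n}. q i \<otimes> p i)" using assms q_p by simp
  also have "\<dots> = (\<Oplus>i\<in>{..<n}. x \<otimes> (q i \<otimes> p i))" using assms by (intro finsum_rdistr) auto
  also have "\<dots> = (\<Oplus>i\<in>{..<n}. x \<otimes> q i \<otimes> p i)"
    by (rule finsum_cong') (use assms in \<open>auto simp: m_assoc\<close>)
  finally show "x = (\<Oplus>i\<in>{..<n}. x \<otimes> q i \<otimes> p i)" .
qed

lemma left_separation: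
  assumes "x \<in> carrier R" "y \<in> carrier R" "\<And>i. i < n \<Longrightarrow> p i \<otimes> x = p i \<otimes> y"
  shows "x = y"
proof -
  have "(\<Oplus>i\<in>{..<n}. q i \<otimes> (p i \<otimes> x)) = (\<Oplus>i\<in>{..<n}. q i \<otimes> (p i \<otimes> y))"
    by (rule finsum_cong') (use assms in auto)
  then show ?thesis using expand(1)[OF assms(1)] expand(1)[OF assms(2)] by simp
qed

lemma right_separation:
  assumes "x \<in> carrier R" "y \<in> carrier R" "\<And>j. j < n \<Longrightarrow> x \<otimes> q j = y \<otimes> q j"
  shows "x = y"
proof -
  have "(\<Oplus>i\<in>{..<n}. x \<otimes> q i \<otimes> p i) = (\<Oplus>i\<in>{..<n}. y \<otimes> q i \<otimes> p i)"
    by (rule finsum_cong') (use assms in auto)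
  then show ?thesis using expand(2)[OF assms(1)] expand(2)[OF assms(2)] by simp
qed

lemma separation:
  assumes "x \<in> carrier R" "y \<in> carrier R"
    and "\<And>i j. i < n \<Longrightarrow> j < n \<Longrightarrow> p i \<otimes> x \<otimes> q j = p i \<otimes> y \<otimes> q j"
  shows "x = y"
  by (rule left_separation[OF assms(1,2)], rule right_separation) (use assms in auto)

abbreviation D where "D \<equiv> corner f f"

lemma D_closed: "d \<in> D \<Longrightarrow> d \<in> carrier R"
  using cornerD by simp

lemma entry_in_D: assumes "x \<in> carrier R" "i < n" "j < n" shows "p i \<otimes> x \<otimes> q j \<in> D"
proof (rule cornerI)
  have "f \<otimes> (p i \<otimes> x \<otimes> q j) = f \<otimes> p i \<otimes> x \<otimes> q j" using assms by (simp only: m_assoc m_closed p_closed q_closed f_closed)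
  then show "f \<otimes> (p i \<otimes> x \<otimes> q j) = p i \<otimes> x \<otimes> q j" using f_p assms by simp
  show "p i \<otimes> x \<otimes> q j \<otimes> f = p i \<otimes> x \<otimes> q j" using q_f assms by (simp add: m_assoc)
qed (use assms in auto)

text \<open>The scalar matrix with diagonal entry \<open>d\<close>. It carries \<open>f R f\<close>
  to the centre, with inverse \<open>z \<mapsto> z f\<close>, and is needed because
  \<open>mat_ring\<close> takes its entries from the centre rather than from the corner.\<close>

definition lift :: "'a \<Rightarrow> 'a" where
  "lift d = (\<Oplus>k\<in>{..<n}. q k \<otimes> (d \<otimes> p k))"

lemma lift_closed: "d \<in> D \<Longrightarrow> lift d \<in> carrier R"
  unfolding lift_def using D_closed by (intro finsum_closed) auto

lemma p_lift: assumes "d \<in> D" "i < n" shows "p i \<otimes> lift d = d \<otimes> p i"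
proof -
  have "p i \<otimes> lift d = f \<otimes> (d \<otimes> p i)" unfolding lift_def
    by (rule p_sum_q) (use assms D_closed in auto)
  then show ?thesis using assms cornerD[OF assms(1)] by (simp add: m_assoc[symmetric])
qed

lemma lift_q: assumes "d \<in> D" "i < n" shows "lift d \<otimes> q i = q i \<otimes> d"
proof -
  have "lift d = (\<Oplus>k\<in>{..<n}. (q k \<otimes> d) \<otimes> p k)" unfolding lift_def
    by (rule finsum_cong') (use assms D_closed in \<open>auto simp: m_assoc\<close>)
  then have "lift d \<otimes> q i = q i \<otimes> d \<otimes> f"
    using sum_p_q[of "\<lambda>k. q k \<otimes> d" i] assms D_closed by simp
  then show ?thesis using assms cornerD[OF assms(1)] by (simp add: m_assoc)
qed

lemma D_mult: "d \<in> D \<Longrightarrow> d' \<in> D \<Longrightarrow> d \<otimes> d' \<in> D"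
  using f_closed by (auto simp: corner_def m_assoc) (simp add: m_assoc[symmetric])

lemma D_add: "d \<in> D \<Longrightarrow> d' \<in> D \<Longrightarrow> d \<oplus> d' \<in> D"
  by (auto simp: corner_def l_distr r_distr)

lemma D_minus: "d \<in> D \<Longrightarrow> \<ominus> d \<in> D"
  by (auto simp: corner_def l_minus r_minus)

lemma f_in_D: "f \<in> D" and zero_in_D: "\<zero> \<in> D"
  using f_f by (auto simp: corner_def)

lemma lift_center: assumes d: "d \<in> D" shows "lift d \<in> center R"
proof (rule centerI)
  note dc = D_closed[OF d] and lc = lift_closed[OF d]
  show "lift d \<in> carrier R" by (rule lc)
  fix x assume x: "x \<in> carrier R"
  show "lift d \<otimes> x = x \<otimes> lift d"
  proof (rule separation)
    fix i j assume ij: "i < n" "j < n"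
    have "p i \<otimes> (lift d \<otimes> x) \<otimes> q j = p i \<otimes> lift d \<otimes> x \<otimes> q j"
      using ij x lc by (simp only: m_assoc m_closed p_closed q_closed)
    also have "\<dots> = d \<otimes> (p i \<otimes> x \<otimes> q j)"
      using ij x dc p_lift[OF d] by (simp only: m_assoc m_closed p_closed q_closed)
    also have "\<dots> = p i \<otimes> x \<otimes> q j \<otimes> d" by (rule corner_comm[OF d entry_in_D[OF x ij]])
    also have "\<dots> = p i \<otimes> x \<otimes> (lift d \<otimes> q j)"
      using ij x dc lift_q[OF d] by (simp only: m_assoc m_closed p_closed q_closed)
    also have "\<dots> = p i \<otimes> (x \<otimes> lift d) \<otimes> q j"
      using ij x lc by (simp only: m_assoc m_closed p_closed q_closed)
    finally show "p i \<otimes> (lift d \<otimes> x) \<otimes> q j = p i \<otimes> (x \<otimes> lift d) \<otimes> q j" .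
  qed (use x lc in auto)
qed

lemma lift_add: assumes "d \<in> D" "d' \<in> D" shows "lift (d \<oplus> d') = lift d \<oplus> lift d'"
  by (rule left_separation)
    (use assms lift_closed D_add D_closed p_lift in \<open>auto simp: l_distr r_distr\<close>)

lemma lift_minus: assumes "d \<in> D" shows "lift (\<ominus> d) = \<ominus> lift d"
  by (rule left_separation)
    (use assms lift_closed D_minus D_closed p_lift in \<open>auto simp: l_minus r_minus\<close>)

lemma lift_mult: assumes "d \<in> D" "d' \<in> D" shows "lift (d \<otimes> d') = lift d \<otimes> lift d'"
proof (rule left_separation)
  fix i assume i: "i < n"
  have "p i \<otimes> (lift d \<otimes> lift d') = d \<otimes> (p i \<otimes> lift d')"
  proof -
    have "p i \<otimes> (lift d \<otimes> lift d') = p i \<otimes> lift d \<otimes> lift d'"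
      using i assms lift_closed by (simp add: m_assoc)
    also have "\<dots> = d \<otimes> (p i \<otimes> lift d')"
      using i assms lift_closed D_closed by (simp only: p_lift m_assoc p_closed)
    finally show ?thesis .
  qed
  then show "p i \<otimes> lift (d \<otimes> d') = p i \<otimes> (lift d \<otimes> lift d')"
    using i assms D_closed D_mult by (simp add: p_lift m_assoc)
qed (use assms lift_closed D_mult in auto)

lemma lift_zero: "lift \<zero> = \<zero>"
  by (rule left_separation) (use lift_closed zero_in_D p_lift in auto)

lemma lift_f: "lift f = \<one>"
  by (rule left_separation) (use lift_closed f_in_D p_lift f_p in auto)

lemma lift_center_mult: assumes z: "z \<in> center R" shows "lift (z \<otimes> f) = z" "z \<otimes> f \<in> D"
proof -
  note zD = centerD[OF z]
  show zf: "z \<otimes> f \<in> D"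
  proof (rule cornerI)
    show "f \<otimes> (z \<otimes> f) = z \<otimes> f"
      using zD(1) zD(2)[OF f_closed] f_f by (metis f_closed m_assoc)
  qed (use zD(1) f_f in \<open>auto simp: m_assoc\<close>)
  show "lift (z \<otimes> f) = z"
  proof (rule left_separation)
    fix i assume i: "i < n"
    have "p i \<otimes> lift (z \<otimes> f) = z \<otimes> (f \<otimes> p i)" using zf i zD(1) by (simp add: p_lift m_assoc)
    then show "p i \<otimes> lift (z \<otimes> f) = p i \<otimes> z" using zD(2) i by (simp add: f_p)
  qed (use zf lift_closed zD in auto)
qed

lemma lift_inj: assumes "n > 0" "d \<in> D" "d' \<in> D" "lift d = lift d'" shows "d = d'"
proof -
  have "d \<otimes> (p 0 \<otimes> q 0) = d' \<otimes> (p 0 \<otimes> q 0)"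
    using p_lift[OF assms(2,1)] p_lift[OF assms(3,1)] assms(1) D_closed[OF assms(2)] D_closed[OF assms(3)] assms(4)
    by (simp add: m_assoc[symmetric])
  then show ?thesis using assms(1) p_q cornerD[OF assms(2)] cornerD[OF assms(3)] by simp
qed

lemma lift_finsum:
  assumes "finite A" "\<And>k. k \<in> A \<Longrightarrow> g k \<in> D"
  shows "(\<Oplus>k\<in>A. g k) \<in> D" "lift (\<Oplus>k\<in>A. g k) = (\<Oplus>k\<in>A. lift (g k))"
proof -
  have "(\<Oplus>k\<in>A. g k) \<in> D \<and> lift (\<Oplus>k\<in>A. g k) = (\<Oplus>k\<in>A. lift (g k))"
    using assms
  proof (induction A)
    case empty
    then show ?case using zero_in_D lift_zero by simp
  next
    case (insert a A)
    have "(\<Oplus>k\<in>insert a A. g k) = g a \<oplus> (\<Oplus>k\<in>A. g k)"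
      using insert D_closed by (intro finsum_insert) auto
    moreover have "(\<Oplus>k\<in>insert a A. lift (g k)) = lift (g a) \<oplus> (\<Oplus>k\<in>A. lift (g k))"
      using insert lift_closed by (intro finsum_insert) auto
    ultimately show ?case using insert D_add lift_add by simp
  qed
  then show "(\<Oplus>k\<in>A. g k) \<in> D" "lift (\<Oplus>k\<in>A. g k) = (\<Oplus>k\<in>A. lift (g k))" by simp_all
qed

text \<open>The value outside the square is prescribed by \<open>mat_carrier\<close>; without it the
  map onto matrices would not be well defined as an isomorphism.\<close>

definition mat :: "'a \<Rightarrow> nat \<times> nat \<Rightarrow> 'a" where
  "mat x = (\<lambda>(i, j). if i < n \<and> j < n then lift (p i \<otimes> x \<otimes> q j) else \<zero>)"

lemma mat_apply: "i < n \<Longrightarrow> j < n \<Longrightarrow> mat x (i, j) = lift (p i \<otimes> x \<otimes> q j)"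
  unfolding mat_def by simp

lemma mat_center: "x \<in> carrier R \<Longrightarrow> i < n \<Longrightarrow> j < n \<Longrightarrow> mat x (i, j) \<in> center R"
  using mat_apply lift_center entry_in_D by simp

lemma mat_eqI:
  assumes "\<And>i j. i < n \<Longrightarrow> j < n \<Longrightarrow> lift (p i \<otimes> x \<otimes> q j) = M (i, j)"
    and "\<And>i j. \<not> (i < n \<and> j < n) \<Longrightarrow> M (i, j) = \<zero>"
  shows "mat x = M"
  using assms unfolding mat_def by (intro ext) auto

lemma mat_mult:
  assumes x: "x \<in> carrier R" and y: "y \<in> carrier R"
  shows "mat (x \<otimes> y) = mat_mult R n (mat x) (mat y)"
proof (rule mat_eqI)
  fix i j assume ij: "i < n" "j < n"
  have "p i \<otimes> (x \<otimes> y) \<otimes> q j = p i \<otimes> x \<otimes> (y \<otimes> q j)" using ij x y by (simp add: m_assoc)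
  also have "\<dots> = p i \<otimes> x \<otimes> (\<Oplus>k\<in>{..<n}. q k \<otimes> (p k \<otimes> (y \<otimes> q j)))"
    using expand(1)[of "y \<otimes> q j"] ij y by simp
  also have "\<dots> = (\<Oplus>k\<in>{..<n}. p i \<otimes> x \<otimes> (q k \<otimes> (p k \<otimes> (y \<otimes> q j))))"
    using ij x y by (intro finsum_rdistr) auto
  also have "\<dots> = (\<Oplus>k\<in>{..<n}. (p i \<otimes> x \<otimes> q k) \<otimes> (p k \<otimes> y \<otimes> q j))"
    by (rule finsum_cong') (use ij x y in \<open>auto simp: m_assoc\<close>)
  finally have "lift (p i \<otimes> (x \<otimes> y) \<otimes> q j) = (\<Oplus>k\<in>{..<n}. lift ((p i \<otimes> x \<otimes> q k) \<otimes> (p k \<otimes> y \<otimes> q j)))"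
    using lift_finsum(2)[of "{..<n}" "\<lambda>k. (p i \<otimes> x \<otimes> q k) \<otimes> (p k \<otimes> y \<otimes> q j)"]
      D_mult entry_in_D ij x y by simp
  also have "\<dots> = (\<Oplus>k\<in>{..<n}. mat x (i, k) \<otimes> mat y (k, j))"
    by (rule finsum_cong') (use ij x y mat_apply lift_mult entry_in_D lift_closed in auto)
  finally show "lift (p i \<otimes> (x \<otimes> y) \<otimes> q j) = mat_mult R n (mat x) (mat y) (i, j)"
    unfolding mat_mult_def using ij by simp
qed (auto simp: mat_mult_def)

lemma mat_add:
  assumes x: "x \<in> carrier R" and y: "y \<in> carrier R"
  shows "mat (x \<oplus> y) = mat_add R n (mat x) (mat y)"
proof (rule mat_eqI)
  fix i j assume ij: "i < n" "j < n"
  have "p i \<otimes> (x \<oplus> y) \<otimes> q j = p i \<otimes> x \<otimes> q j \<oplus> p i \<otimes> y \<otimes> q j"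
    using ij x y by (simp add: l_distr r_distr)
  then show "lift (p i \<otimes> (x \<oplus> y) \<otimes> q j) = mat_add R n (mat x) (mat y) (i, j)"
    unfolding mat_add_def using ij x y by (simp add: mat_apply lift_add entry_in_D)
qed (auto simp: mat_add_def)

lemma mat_one: "mat \<one> = mat_one R n"
  by (rule mat_eqI) (auto simp: mat_one_def p_q lift_f lift_zero)

lemma mat_surj:
  assumes M: "M \<in> mat_carrier R n" obtains x where "x \<in> carrier R" "mat x = M"
proof -
  have Mz: "M (i, j) \<in> center R" if "i < n" "j < n" for i j
    using M that unfolding mat_carrier_def by auto
  have Mc: "M (i, j) \<in> carrier R" if "i < n" "j < n" for i j
    using centerD(1)[OF Mz[OF that]] .
  define y where "y i = (\<Oplus>j\<in>{..<n}. M (i, j) \<otimes> p j)" for i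
  define x where "x = (\<Oplus>i\<in>{..<n}. q i \<otimes> y i)"
  have yc: "y i \<in> carrier R" if "i < n" for i
    unfolding y_def using Mc that by (intro finsum_closed) auto
  have xc: "x \<in> carrier R" unfolding x_def using yc by (intro finsum_closed) auto
  have "mat x = M"
  proof (rule mat_eqI)
    fix i j assume ij: "i < n" "j < n"
    have "p i \<otimes> x \<otimes> q j = f \<otimes> y i \<otimes> q j" unfolding x_def using p_sum_q[of y i] yc ij by simp
    also have "\<dots> = f \<otimes> (y i \<otimes> q j)" using yc ij by (simp add: m_assoc)
    also have "y i \<otimes> q j = M (i, j) \<otimes> f" unfolding y_def using sum_p_q[of "\<lambda>j. M (i, j)" j] Mc ij by simp
    also have "f \<otimes> (M (i, j) \<otimes> f) = M (i, j) \<otimes> f"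
      using cornerD(2)[OF lift_center_mult(2)[OF Mz[OF ij]]] .
    finally show "lift (p i \<otimes> x \<otimes> q j) = M (i, j)" using lift_center_mult(1)[OF Mz[OF ij]] by simp
  next
    fix i j assume "\<not> (i < n \<and> j < n)"
    then show "M (i, j) = \<zero>" using M unfolding mat_carrier_def by blast
  qed
  then show ?thesis using that xc by blast
qed

lemma mat_inj:
  assumes "n > 0" "x \<in> carrier R" "y \<in> carrier R" "mat x = mat y" shows "x = y"
proof (rule separation)
  fix i j assume ij: "i < n" "j < n"
  show "p i \<otimes> x \<otimes> q j = p i \<otimes> y \<otimes> q j"
  proof (rule lift_inj[OF assms(1)])
    show "lift (p i \<otimes> x \<otimes> q j) = lift (p i \<otimes> y \<otimes> q j)"
      using ij fun_cong[OF assms(4), of "(i, j)"] by (simp add: mat_apply)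
  qed (use entry_in_D ij assms in auto)
qed (use assms in auto)

lemma mat_iso: assumes "n > 0" shows "mat \<in> ring_iso R (mat_ring R n)"
proof (rule ring_iso_memI)
  show c: "mat x \<in> carrier (mat_ring R n)" if "x \<in> carrier R" for x
    using mat_center[OF that] unfolding mat_ring_def mat_carrier_def by (auto simp: mat_def)
  show "mat (x \<otimes> y) = mat x \<otimes>\<^bsub>mat_ring R n\<^esub> mat y" "mat (x \<oplus> y) = mat x \<oplus>\<^bsub>mat_ring R n\<^esub> mat y"
    if "x \<in> carrier R" "y \<in> carrier R" for x y
    using that mat_mult mat_add unfolding mat_ring_def by simp_all
  show "mat \<one> = \<one>\<^bsub>mat_ring R n\<^esub>" using mat_one unfolding mat_ring_def by simp
  show "bij_betw mat (carrier R) (carrier (mat_ring R n))"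
  proof (rule bij_betw_imageI)
    show "inj_on mat (carrier R)" using mat_inj[OF assms] by (intro inj_onI)
    show "mat ` carrier R = carrier (mat_ring R n)"
    proof
      show "carrier (mat_ring R n) \<subseteq> mat ` carrier R"
      proof
        fix M assume "M \<in> carrier (mat_ring R n)"
        then have "M \<in> mat_carrier R n" unfolding mat_ring_def by simp
        then obtain x where "x \<in> carrier R" "mat x = M" by (rule mat_surj)
        then show "M \<in> mat ` carrier R" by blast
      qed
    qed (use c in auto)
  qed
qed

definition det :: "'a \<Rightarrow> 'a" where "det x = mdet R n (mat x)"

lemma det_cdet: "x \<in> carrier R \<Longrightarrow> det x = cring.cdet Cen n (mat x)"
  unfolding det_def using mat_center by (intro mdet_eq_cdet)

lemma det_center: assumes "x \<in> carrier R" shows "det x \<in> center R"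
proof -
  interpret Z: cring Cen by (rule center_cring)
  have "cring.cdet Cen n (mat x) \<in> carrier Cen" by (rule Z.cdet_closed) (use mat_center assms in simp)
  then show ?thesis using assms det_cdet by simp
qed

lemma det_mult:
  assumes two: "\<And>x. x \<in> carrier R \<Longrightarrow> x \<oplus> x = \<zero> \<Longrightarrow> x = \<zero>"
    and x: "x \<in> carrier R" and y: "y \<in> carrier R"
  shows "det (x \<otimes> y) = det x \<otimes> det y"
proof -
  interpret Z: cring Cen by (rule center_cring)
  have mm: "mat_mult R n (mat x) (mat y) = mat_mult Cen n (mat x) (mat y)"
    unfolding mat_mult_def
    using mat_center x y center_mult by (intro ext) (auto simp: center_finsum)
  have "Z.cdet n (mat_mult Cen n (mat x) (mat y)) = Z.cdet n (mat x) \<otimes>\<^bsub>Cen\<^esub> Z.cdet n (mat y)"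
  proof (rule Z.cdet_mult)
    show "w = \<zero>\<^bsub>Cen\<^esub>" if "w \<in> carrier Cen" "w \<oplus>\<^bsub>Cen\<^esub> w = \<zero>\<^bsub>Cen\<^esub>" for w
      using two[of w] that centerD(1)[of w] by simp
  qed (use mat_center x y in simp_all)
  then show ?thesis using x y by (simp add: det_cdet mat_mult mm)
qed

text \<open>With this normalization \<open>f = q 0 p 0\<close> is the matrix unit at position (0,
  0), so the element is diagonal with entries \<open>-1, 1, ..., 1\<close>.\<close>

lemma det_one_minus_two_f:
  assumes n: "n > 0" and pq0: "p 0 = f" "q 0 = f"
  shows "det (\<one> \<ominus> (f \<oplus> f)) = \<ominus> \<one>"
proof -
  interpret Z: cring Cen by (rule center_cring)
  let ?x = "\<one> \<ominus> (f \<oplus> f)"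
  have xc: "?x \<in> carrier R" by simp
  have pf: "p i \<otimes> f \<otimes> q j = (if i = 0 \<and> j = 0 then f else \<zero>)" if "i < n" "j < n" for i j
  proof -
    have "p i \<otimes> f \<otimes> q j = (p i \<otimes> q 0) \<otimes> (p 0 \<otimes> q j)"
      using that n pq0 f_f by (metis f_closed m_assoc m_closed p_closed q_closed)
    then show ?thesis using that n f_f by (auto simp: p_q)
  qed
  have e: "mat ?x (i, j) = (if i = j then if i = 0 then \<ominus> \<one> else \<one> else \<zero>)" if ij: "i < n" "j < n" for i j
  proof -
    have "p i \<otimes> ?x \<otimes> q j = p i \<otimes> q j \<ominus> (p i \<otimes> f \<otimes> q j \<oplus> p i \<otimes> f \<otimes> q j)"
      using ij by (simp add: minus_eq l_distr r_distr l_minus r_minus)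
    also have "\<dots> = (if i = j then if i = 0 then \<ominus> f else f else \<zero>)"
      using ij by (simp add: pf p_q minus_eq minus_add a_assoc[symmetric] r_neg)
    finally show ?thesis using ij f_in_D by (simp add: mat_apply lift_f lift_zero lift_minus)
  qed
  have "det ?x = finprod Cen (\<lambda>i. mat ?x (i, i)) {..<n}"
    unfolding det_cdet[OF xc] by (rule Z.cdet_diagonal) (use e center_closed in auto)
  also have "\<dots> = finprod Cen (\<lambda>i. mat ?x (i, i)) (insert 0 ({..<n} - {0}))"
    using n by (simp add: insert_absorb)
  also have "\<dots> = mat ?x (0, 0) \<otimes>\<^bsub>Cen\<^esub> finprod Cen (\<lambda>i. mat ?x (i, i)) ({..<n} - {0})"
    by (rule Z.finprod_insert) (use n mat_center xc in auto)
  also have "finprod Cen (\<lambda>i. mat ?x (i, i)) ({..<n} - {0}) = \<one>\<^bsub>Cen\<^esub>"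
    by (rule Z.finprod_one_eqI) (use e in auto)
  finally show ?thesis using e n by simp
qed

lemma det_one: "det \<one> = \<one>"
proof -
  interpret Z: cring Cen by (rule center_cring)
  have e: "mat \<one> (i, j) = (if i = j then \<one> else \<zero>)" if "i < n" "j < n" for i j
    using that unfolding mat_one by (simp add: mat_one_def)
  have "det \<one> = finprod Cen (\<lambda>i. mat \<one> (i, i)) {..<n}"
    unfolding det_cdet[OF one_closed] by (rule Z.cdet_diagonal) (use e center_closed in auto)
  also have "\<dots> = \<one>\<^bsub>Cen\<^esub>" by (rule Z.finprod_one_eqI) (use e in auto)
  finally show ?thesis by simp
qed

end

section \<open>Chain condition, division by two and the calculus of corners\<close>

context ring
begin

text \<open>Among right invertible \<open>x\<close> choose one with \<open>R x\<close> minimal. As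
  \<open>a x\<close> is again right invertible, \<open>x = r a x\<close> for some \<open>r\<close>,
  and cancelling the right inverse of \<open>x\<close> gives \<open>r a = 1\<close>.\<close>

lemma left_artinian_inverse_comm:
  assumes art: "left_artinian R" and ab: "a \<in> carrier R" "b \<in> carrier R" "a \<otimes> b = \<one>"
  shows "b \<otimes> a = \<one>"
proof -
  let ?P = "\<lambda>x. x \<in> carrier R \<and> (\<exists>y\<in>carrier R. x \<otimes> y = \<one>)"
  have P0: "?P \<one>" by auto
  have Pl: "lideal R (princ x)" if "?P x" for x using lideal_princ that by simp
  obtain x where x: "?P x" and min: "\<forall>y. ?P y \<longrightarrow> \<not> princ y \<subset> princ x"
    by (rule dcc_minimal[where P = ?P and L = princ, OF art P0 Pl])
  have xc: "x \<in> carrier R" using x by simp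
  obtain y where y: "y \<in> carrier R" "x \<otimes> y = \<one>" using x by blast
  have "a \<otimes> x \<otimes> (y \<otimes> b) = a \<otimes> (x \<otimes> y) \<otimes> b" using ab(1,2) xc y(1) by (simp only: m_assoc m_closed)
  then have "a \<otimes> x \<otimes> (y \<otimes> b) = \<one>" using ab y by simp
  then have "?P (a \<otimes> x)" using ab(1,2) xc y(1) by (intro conjI bexI[of _ "y \<otimes> b"]) auto
  then have "\<not> princ (a \<otimes> x) \<subset> princ x" using min by blast
  moreover have "princ (a \<otimes> x) \<subseteq> princ x"
    using princ_least[OF lideal_princ[OF xc]] princI[OF ab(1) refl] by blast
  ultimately have "x \<in> princ (a \<otimes> x)" using princ_self[OF xc] by blast
  then obtain r where r: "r \<in> carrier R" "x = r \<otimes> (a \<otimes> x)" by (rule princE)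
  have "\<one> = r \<otimes> (a \<otimes> x) \<otimes> y" using r(2) y(2) by simp
  also have "\<dots> = r \<otimes> a \<otimes> (x \<otimes> y)" using r(1) ab(1) xc y(1) by (simp only: m_assoc m_closed)
  also have "\<dots> = r \<otimes> a" using r(1) ab(1) y(2) by simp
  finally have ra: "r \<otimes> a = \<one>" by simp
  have "r = r \<otimes> (a \<otimes> b)" using r(1) ab(3) by simp
  also have "\<dots> = b" using r(1) ab(1,2) ra by (simp add: m_assoc[symmetric])
  finally show ?thesis using ra by simp
qed

lemma half:
  assumes "\<one> \<oplus> \<one> \<in> Units R"
  obtains h where "h \<in> center R" "h \<oplus> h = \<one>"
proof -
  define h where "h = inv (\<one> \<oplus> \<one>)"
  have hc: "h \<in> carrier R" unfolding h_def using assms by simp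
  have "(\<one> \<oplus> \<one>) \<otimes> h = \<one>" unfolding h_def using assms by simp
  then have hh: "h \<oplus> h = \<one>" using hc by (simp add: l_distr)
  have "h \<in> center R"
  proof (rule centerI[OF hc])
    fix x assume x: "x \<in> carrier R"
    have "h \<otimes> x = h \<otimes> (x \<otimes> (h \<oplus> h))" using hh x by simp
    also have "\<dots> = (h \<oplus> h) \<otimes> (x \<otimes> h)" using hc x by (simp add: l_distr r_distr)
    also have "\<dots> = x \<otimes> h" using hh x hc by simp
    finally show "h \<otimes> x = x \<otimes> h" .
  qed
  then show ?thesis using that hh by blast
qed

lemma half_mult:
  assumes "h \<in> center R" "h \<oplus> h = \<one>" "x \<in> carrier R"
  shows "h \<otimes> (x \<oplus> x) = x"
proof -
  have "h \<otimes> (x \<oplus> x) = (h \<oplus> h) \<otimes> x"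
    using centerD(1)[OF assms(1)] assms(3) by (simp add: l_distr r_distr)
  then show ?thesis using assms by simp
qed

lemma double_eq_zero:
  assumes "\<one> \<oplus> \<one> \<in> Units R" "x \<in> carrier R" "x \<oplus> x = \<zero>"
  shows "x = \<zero>"
proof -
  obtain h where h: "h \<in> center R" "h \<oplus> h = \<one>" using half[OF assms(1)] .
  show ?thesis using half_mult[OF h assms(2)] assms(3) centerD(1)[OF h(1)] by simp
qed

lemma corner_orth:
  assumes "x \<in> corner p e" "y \<in> corner h q" "e \<otimes> h = \<zero>" "e \<in> carrier R" "h \<in> carrier R"
  shows "x \<otimes> y = \<zero>"
proof -
  note x = cornerD[OF assms(1)] and y = cornerD[OF assms(2)]
  have "x \<otimes> y = (x \<otimes> e) \<otimes> (h \<otimes> y)" using x y by simp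
  also have "\<dots> = x \<otimes> (e \<otimes> h) \<otimes> y" using x(1) y(1) assms(4,5) by (simp only: m_assoc m_closed)
  finally show ?thesis using x(1) y(1) assms(3) by simp
qed

lemma corner_mult_corner:
  assumes "x \<in> corner p e" "y \<in> corner e' q" "p \<in> carrier R" "q \<in> carrier R"
  shows "x \<otimes> y \<in> corner p q"
proof (rule cornerI)
  note x = cornerD[OF assms(1)] and y = cornerD[OF assms(2)]
  show "p \<otimes> (x \<otimes> y) = x \<otimes> y" using x y(1) assms(3) by (simp add: m_assoc[symmetric])
  show "x \<otimes> y \<otimes> q = x \<otimes> y" using x(1) y assms(4) by (simp add: m_assoc)
qed (use cornerD assms in auto)

lemma corner_add:
  assumes "x \<in> corner p q" "y \<in> corner p q" "p \<in> carrier R" "q \<in> carrier R"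
  shows "x \<oplus> y \<in> corner p q"
  using assms unfolding corner_def by (auto simp: l_distr r_distr)

lemma corner_minus:
  assumes "x \<in> corner p q" "p \<in> carrier R" "q \<in> carrier R"
  shows "\<ominus> x \<in> corner p q"
  using assms unfolding corner_def by (auto simp: l_minus r_minus)

lemma corner_mono:
  assumes "x \<in> corner p q" "p \<otimes> p' = p" "p' \<otimes> p = p" "q \<otimes> q' = q" "q' \<otimes> q = q"
    "p \<in> carrier R" "q \<in> carrier R" "p' \<in> carrier R" "q' \<in> carrier R"
  shows "x \<in> corner p' q'"
proof (rule cornerI)
  note x = cornerD[OF assms(1)]
  have "p' \<otimes> (p \<otimes> x) = p' \<otimes> p \<otimes> x" using x(1) assms(6,8) by (simp only: m_assoc)
  then show "p' \<otimes> x = x" using x assms by simp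
  have "x \<otimes> q \<otimes> q' = x \<otimes> (q \<otimes> q')" using x(1) assms(7,9) by (simp only: m_assoc)
  then show "x \<otimes> q' = x" using x assms by simp
  show "x \<in> carrier R" using x by simp
qed

lemma idem_add:
  assumes "idem h" "idem k" "h \<otimes> k = \<zero>" "k \<otimes> h = \<zero>"
  shows "idem (h \<oplus> k)" "h \<otimes> (h \<oplus> k) = h" "(h \<oplus> k) \<otimes> h = h" "k \<otimes> (h \<oplus> k) = k" "(h \<oplus> k) \<otimes> k = k"
  using assms unfolding idem_def by (simp_all add: l_distr r_distr)

text \<open>The strict descent used in the maximality arguments: when an idempotent with complement
  \<open>k\<close> is enlarged by a nonzero \<open>k1\<close> inside \<open>k\<close>, the left
  ideal of the complement shrinks.\<close>

lemma princ_diff_strict: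
  assumes k: "idem k" and k1: "idem k1" "k1 \<in> corner k k" "k1 \<noteq> \<zero>"
  shows "princ (k \<ominus> k1) \<subset> princ k"
proof -
  note kc = idemD[OF k] and k1c = idemD[OF k1(1)] and d = idem_diff[OF k k1(1,2)]
  have "princ (k \<ominus> k1) \<subseteq> princ k"
    by (rule princ_least[OF lideal_princ[OF kc(1)]])
      (rule princI[of "k \<ominus> k1"], use kc k1c cornerD[OF d(2)] in auto)
  moreover have "k \<notin> princ (k \<ominus> k1)"
  proof
    assume "k \<in> princ (k \<ominus> k1)"
    then obtain r where r: "r \<in> carrier R" "k = r \<otimes> (k \<ominus> k1)" by (rule princE)
    have "k1 = k \<otimes> k1" using cornerD[OF k1(2)] by simp
    also have "\<dots> = r \<otimes> (k \<ominus> k1) \<otimes> k1" using r by simp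
    also have "\<dots> = r \<otimes> ((k \<ominus> k1) \<otimes> k1)" using r(1) kc k1c by (simp only: m_assoc minus_closed)
    finally show False using d(4) r(1) k1(3) by simp
  qed
  ultimately show ?thesis using princ_self[OF kc(1)] by blast
qed

definition prime_ring :: bool where
  "prime_ring \<longleftrightarrow> (\<forall>a\<in>carrier R. \<forall>b\<in>carrier R. a \<noteq> \<zero> \<longrightarrow> b \<noteq> \<zero> \<longrightarrow> (\<exists>r\<in>carrier R. a \<otimes> r \<otimes> b \<noteq> \<zero>))"

lemma prime_ring_corner:
  assumes "prime_ring" "idem p" "idem q" "p \<noteq> \<zero>" "q \<noteq> \<zero>"
  obtains x where "x \<in> corner p q" "x \<noteq> \<zero>"
proof -
  obtain r where r: "r \<in> carrier R" "p \<otimes> r \<otimes> q \<noteq> \<zero>"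
    using assms idemD unfolding prime_ring_def by blast
  show ?thesis using that[of "p \<otimes> r \<otimes> q"] corner_mult[OF assms(2,3) r(1)] r(2) by simp
qed

lemma primitiveD: assumes "primitive f" shows "idem f" "f \<noteq> \<zero>" "f \<in> carrier R" "f \<otimes> f = f"
  using assms idemD unfolding primitive_def by auto

text \<open>Take a system for which \<open>R (1 - E)\<close> is minimal, where \<open>E\<close> is
  the sum of the \<open>q i p i\<close>. If \<open>1 - E\<close> were nonzero, it would contain a
  primitive idempotent, isomorphic to \<open>f\<close> by primeness and Schur's lemma, and the
  isomorphism and its inverse would extend the system. The normalization at index 0 is kept
  throughout for the sake of \<open>det_one_minus_two_f\<close>.\<close>

lemma matrix_units_exist:
  assumes art: "left_artinian R" and v: vnr and pr: prime_ring and f: "primitive f"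
    and comm: "\<And>x y. x \<in> corner f f \<Longrightarrow> y \<in> corner f f \<Longrightarrow> x \<otimes> y = y \<otimes> x"
  obtains n p q where "matrix_units R n f p q" "n > 0" "p 0 = f" "q 0 = f"
proof -
  note fD = primitiveD[OF f]
  let ?E = "\<lambda>(n::nat, p, q). \<Oplus>i\<in>{..<n}. q i \<otimes> p i"
  define Q where "Q = (\<lambda>(n::nat, p::nat \<Rightarrow> 'a, q::nat \<Rightarrow> 'a). n > 0 \<and> p 0 = f \<and> q 0 = f
    \<and> (\<forall>i<n. p i \<in> carrier R \<and> q i \<in> carrier R \<and> f \<otimes> p i = p i \<and> q i \<otimes> f = q i)
    \<and> (\<forall>i<n. \<forall>j<n. p i \<otimes> q j = (if i = j then f else \<zero>)))"
  have Ec: "?E x \<in> carrier R" if "Q x" for x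
    using that unfolding Q_def by (auto intro!: finsum_closed)
  have Q0: "Q (1, \<lambda>_. f, \<lambda>_. f)" unfolding Q_def using fD by auto
  have Ql: "lideal R (princ (\<one> \<ominus> ?E x))" if "Q x" for x
    by (rule lideal_princ) (use Ec[OF that] in simp)
  obtain x where Qx: "Q x" and min: "\<forall>y. Q y \<longrightarrow> \<not> princ (\<one> \<ominus> ?E y) \<subset> princ (\<one> \<ominus> ?E x)"
    by (rule dcc_minimal[where P = Q and L = "\<lambda>x. princ (\<one> \<ominus> ?E x)", OF art Q0 Ql])
  obtain n p q where x: "x = (n, p, q)" by (cases x)
  have n: "n > 0" "p 0 = f" "q 0 = f" using Qx unfolding Q_def x by simp_all
  have pq: "p i \<in> carrier R" "q i \<in> carrier R" "f \<otimes> p i = p i" "q i \<otimes> f = q i" if "i < n" for i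
    using Qx that unfolding Q_def x by simp_all
  have del: "p i \<otimes> q j = (if i = j then f else \<zero>)" if "i < n" "j < n" for i j
    using Qx that unfolding Q_def x by simp
  define E where "E = (\<Oplus>i\<in>{..<n}. q i \<otimes> p i)"
  have EC: "E \<in> carrier R" using Ec[OF Qx] unfolding E_def x by simp
  interpret M: partial_matrix_units R n f p q by unfold_locales (use pq del fD in auto)
  have pE: "p i \<otimes> E = p i" if "i < n" for i
    unfolding E_def using M.p_sum_q[of p i] that pq by simp
  have Eq: "E \<otimes> q i = q i" if "i < n" for i
    unfolding E_def using M.sum_p_q[of q i] that pq by simp
  have EE: "E \<otimes> E = E"
  proof -
    have "E \<otimes> E = (\<Oplus>k\<in>{..<n}. E \<otimes> (q k \<otimes> p k))"
      unfolding E_def[symmetric] by (subst (2) E_def) (rule finsum_rdistr, use pq EC in auto)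
    also have "\<dots> = (\<Oplus>k\<in>{..<n}. q k \<otimes> p k)"
      by (rule finsum_cong') (use pq EC Eq in \<open>auto simp: m_assoc[symmetric]\<close>)
    finally show ?thesis unfolding E_def .
  qed
  have iE: "idem E" unfolding idem_def using EC EE by simp
  define k where "k = \<one> \<ominus> E"
  have i1: "idem \<one>" unfolding idem_def by simp
  have E1: "E \<in> corner \<one> \<one>" unfolding corner_def using EC by simp
  note kD = idem_diff[OF i1 iE E1, folded k_def]
  have kc: "k \<in> carrier R" using kD(1) idemD by blast
  have "k = \<zero>"
  proof (rule ccontr)
    assume "k \<noteq> \<zero>"
    then obtain f' where f': "primitive f'" "f' \<in> corner k k" using primitive_below[OF art kD(1)] by blast
    note f'D = primitiveD[OF f'(1)] and f'k = cornerD[OF f'(2)]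
    obtain a where a: "a \<in> corner f f'" "a \<noteq> \<zero>"
      using prime_ring_corner[OF pr fD(1) f'D(1) fD(2) f'D(2)] .
    obtain b where b: "b \<in> corner f' f" "a \<otimes> b = f" "b \<otimes> a = f'"
      using primitive_corner_inverse[OF v f f'(1) a] .
    note aD = cornerD[OF a(1)] and bD = cornerD[OF b(1)]
    have Ef': "E \<otimes> f' = \<zero>"
    proof -
      have "E \<otimes> f' = E \<otimes> k \<otimes> f'" using f'k EC kc f'D by (simp add: m_assoc)
      then show ?thesis using kD(3) f'D by simp
    qed
    have f'E: "f' \<otimes> E = \<zero>"
    proof -
      have "f' \<otimes> E = f' \<otimes> (k \<otimes> E)" using f'k EC kc f'D by (simp add: m_assoc[symmetric])
      then show ?thesis using kD(4) f'D by simp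
    qed
    have pb: "p i \<otimes> b = \<zero>" if i: "i < n" for i
    proof -
      have "p i \<otimes> b = (p i \<otimes> E) \<otimes> (f' \<otimes> b)" using pE[OF i] bD by simp
      also have "\<dots> = p i \<otimes> (E \<otimes> f') \<otimes> b" using pq(1)[OF i] EC f'D(3) bD(1) by (simp only: m_assoc m_closed)
      finally show ?thesis using Ef' pq i bD(1) by simp
    qed
    have aq: "a \<otimes> q i = \<zero>" if i: "i < n" for i
    proof -
      have "a \<otimes> q i = (a \<otimes> f') \<otimes> (E \<otimes> q i)" using Eq[OF i] aD by simp
      also have "\<dots> = a \<otimes> (f' \<otimes> E) \<otimes> q i" using pq(2)[OF i] EC f'D(3) aD(1) by (simp only: m_assoc m_closed)
      finally show ?thesis using f'E pq i aD(1) by simp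
    qed
    let ?y = "(Suc n, p(n := a), q(n := b))"
    have "Q ?y" unfolding Q_def using n pq del pb aq aD bD b(2)
      by (auto simp: less_Suc_eq)
    then have "\<not> princ (\<one> \<ominus> ?E ?y) \<subset> princ (\<one> \<ominus> ?E x)" using min by blast
    moreover have "?E ?y = f' \<oplus> E"
    proof -
      have "(\<Oplus>i\<in>{..<n}. (q(n := b)) i \<otimes> (p(n := a)) i) = E"
        unfolding E_def by (rule finsum_cong') (use pq in auto)
      then show ?thesis using pq aD bD b(3) by (simp add: lessThan_Suc, subst finsum_insert) auto
    qed
    moreover have "\<one> \<ominus> (f' \<oplus> E) = k \<ominus> f'"
      unfolding k_def using EC f'D(3) by (simp add: minus_eq minus_add a_ac)
    moreover have "\<one> \<ominus> ?E x = k" unfolding k_def E_def x by simp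
    ultimately have "\<not> princ (k \<ominus> f') \<subset> princ k" by simp
    then show False using princ_diff_strict[OF kD(1) f'D(1) f'(2) f'D(2)] by simp
  qed
  then have "E = \<one>" unfolding k_def using EC by simp
  then have "matrix_units R n f p q"
    using comm unfolding E_def
    by (intro matrix_units.intro M.partial_matrix_units_axioms matrix_units_axioms.intro)
  then show ?thesis using that n by blast
qed

end

context matrix_units
begin

text \<open>Let \<open>M\<close> be half of \<open>N\<close>. Since \<open>M M = 0\<close>,
  \<open>1 - N\<close> is the square of \<open>1 - M\<close>, and the reflection
  \<open>1 - 2 e\<close> conjugates \<open>1 - M\<close> into its inverse \<open>1 + M\<close>.
  Hence \<open>det (1 - M)\<close> squares to 1. This needs no basis adapted to
  \<open>e\<close>.\<close>

lemma det_unipotent: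
  assumes two: "\<one> \<oplus> \<one> \<in> Units R" and e: "idem e" and N: "N \<in> corner e (\<one> \<ominus> e)"
  shows "det (\<one> \<ominus> N) = \<one>"
proof -
  note dm = det_mult[OF double_eq_zero[OF two]]
  note ec = idemD[OF e]
  obtain h where h: "h \<in> center R" "h \<oplus> h = \<one>" using half[OF two] .
  define M where "M = h \<otimes> N"
  note Nc = cornerD[OF N] and hD = centerD[OF h(1)]
  have Mc: "M \<in> carrier R" unfolding M_def using hD(1) Nc(1) by simp
  have eM: "e \<otimes> M = M"
  proof -
    have "e \<otimes> M = (h \<otimes> e) \<otimes> N" unfolding M_def using hD(1) hD(2)[OF ec(1)] ec(1) Nc(1) by (simp add: m_assoc[symmetric])
    then show ?thesis unfolding M_def using hD(1) ec(1) Nc by (simp add: m_assoc)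
  qed
  have Me: "M \<otimes> e = \<zero>"
  proof -
    have "N \<otimes> e = N \<otimes> (\<one> \<ominus> e) \<otimes> e" using Nc by simp
    also have "\<dots> = N \<otimes> ((\<one> \<ominus> e) \<otimes> e)" using Nc(1) ec(1) by (simp only: m_assoc minus_closed one_closed)
    also have "(\<one> \<ominus> e) \<otimes> e = \<zero>" using ec by (simp add: minus_eq l_distr l_minus r_neg)
    finally have "N \<otimes> e = \<zero>" using Nc(1) by simp
    then show ?thesis unfolding M_def using hD(1) ec(1) Nc(1) by (simp add: m_assoc)
  qed
  have MM: "M \<otimes> M = \<zero>"
  proof -
    have "M \<otimes> M = M \<otimes> (e \<otimes> M)" using eM by simp
    also have "\<dots> = M \<otimes> e \<otimes> M" using Mc ec by (simp only: m_assoc)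
    finally show ?thesis using Me Mc by simp
  qed
  have N2: "N = M \<oplus> M" unfolding M_def using h(2) hD(1) Nc(1) by (simp add: l_distr[symmetric])
  have sq: "(\<one> \<ominus> M) \<otimes> (\<one> \<ominus> M) = \<one> \<ominus> N"
    unfolding N2 using Mc MM by (simp add: minus_eq l_distr r_distr l_minus r_minus minus_add a_ac)
  have inv: "(\<one> \<oplus> M) \<otimes> (\<one> \<ominus> M) = \<one>"
    using Mc MM by (simp add: minus_eq l_distr r_distr l_minus r_minus minus_add a_assoc r_neg l_neg)
  let ?s = "\<one> \<ominus> (e \<oplus> e)"
  have ss: "?s \<otimes> ?s = \<one>"
    using ec by (simp add: minus_eq l_distr r_distr l_minus r_minus minus_add a_assoc)
      (simp add: a_assoc[symmetric] r_neg l_neg)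
  have sM: "?s \<otimes> (\<one> \<ominus> M) \<otimes> ?s = \<one> \<oplus> M"
  proof -
    have "(\<one> \<ominus> M) \<otimes> ?s = ?s \<ominus> M"
      using ec(1) Mc Me by (simp add: minus_eq l_distr r_distr l_minus r_minus a_ac)
    then have "?s \<otimes> (\<one> \<ominus> M) \<otimes> ?s = ?s \<otimes> (?s \<ominus> M)" using ec(1) Mc by (simp add: m_assoc)
    also have "\<dots> = \<one> \<ominus> ?s \<otimes> M" using ss ec(1) Mc by (simp add: minus_eq[of _ M] r_distr r_minus) (simp add: minus_eq)
    also have "?s \<otimes> M = \<ominus> M" using ec(1) Mc eM by (simp add: minus_eq l_distr l_minus minus_add a_assoc[symmetric] r_neg)
    finally show ?thesis using Mc by (simp add: minus_eq)
  qed
  have dc: "det x \<otimes> det y = det y \<otimes> det x" if "x \<in> carrier R" "y \<in> carrier R" for x y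
    using centerD(2)[OF det_center[OF that(1)]] centerD(1)[OF det_center[OF that(2)]] by simp
  have "det (\<one> \<oplus> M) = det ?s \<otimes> det (\<one> \<ominus> M) \<otimes> det ?s"
    unfolding sM[symmetric] using ec(1) Mc by (simp add: dm)
  also have "\<dots> = det (\<one> \<ominus> M) \<otimes> (det ?s \<otimes> det ?s)"
    using dc[of ?s "\<one> \<ominus> M"] ec(1) Mc centerD(1)[OF det_center] by (simp add: m_assoc)
  also have "det ?s \<otimes> det ?s = \<one>" using dm[of ?s ?s] ss ec(1) det_one by simp
  finally have "det (\<one> \<oplus> M) = det (\<one> \<ominus> M)" using Mc centerD(1)[OF det_center] by simp
  then have "det (\<one> \<ominus> M) \<otimes> det (\<one> \<ominus> M) = \<one>"
    using dm[of "\<one> \<oplus> M" "\<one> \<ominus> M"] inv det_one Mc by simp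
  then show ?thesis using dm[of "\<one> \<ominus> M" "\<one> \<ominus> M"] sq Mc by simp
qed

text \<open>Sylvester's identity, by factoring both sides into \<open>\<one> \<ominus> e w e\<close> and a unipotent.\<close>
lemma det_one_minus_swap:
  assumes two: "\<one> \<oplus> \<one> \<in> Units R" and e: "idem e" and w: "w \<in> carrier R"
  shows "det (\<one> \<ominus> e \<otimes> w) = det (\<one> \<ominus> w \<otimes> e)"
proof -
  note dm = det_mult[OF double_eq_zero[OF two]] and ec = idemD[OF e]
  define g where "g = \<one> \<ominus> e"
  have i1: "idem \<one>" unfolding idem_def by simp
  have e1: "e \<in> corner \<one> \<one>" unfolding corner_def using ec by simp
  note gD = idem_diff[OF i1 e e1, folded g_def]
  note gc = idemD[OF gD(1)]
  have eg: "\<one> \<ominus> g = e" unfolding g_def using ec by (simp add: minus_eq minus_add a_assoc[symmetric] r_neg)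
  have sum: "e \<oplus> g = \<one>" unfolding g_def using ec by (simp add: minus_eq a_comm[of e] a_assoc l_neg)
  define P where "P = e \<otimes> w \<otimes> e"
  define Q where "Q = e \<otimes> w \<otimes> g"
  define S where "S = g \<otimes> w \<otimes> e"
  have c: "P \<in> carrier R" "Q \<in> carrier R" "S \<in> carrier R" unfolding P_def Q_def S_def using ec gc w by simp_all
  have QP: "Q \<otimes> P = \<zero>"
    by (rule corner_orth[of _ e g _ e e]) (use corner_mult e gD w ec gc P_def Q_def in auto)
  have PS: "P \<otimes> S = \<zero>"
    by (rule corner_orth[of _ e e _ g e]) (use corner_mult e gD w ec gc P_def S_def in auto)
  have ew: "e \<otimes> w = P \<oplus> Q"
  proof -
    have "e \<otimes> w = e \<otimes> w \<otimes> (e \<oplus> g)" using sum ec w by simp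
    then show ?thesis unfolding P_def Q_def using ec(1) gc(1) w by (simp add: r_distr)
  qed
  have we: "w \<otimes> e = P \<oplus> S"
  proof -
    have "w \<otimes> e = (e \<oplus> g) \<otimes> (w \<otimes> e)" using sum ec w by simp
    then show ?thesis unfolding P_def S_def using ec(1) gc(1) w by (simp add: l_distr m_assoc)
  qed
  have "\<one> \<ominus> e \<otimes> w = (\<one> \<ominus> Q) \<otimes> (\<one> \<ominus> P)"
    unfolding ew using c QP by (simp add: minus_eq l_distr r_distr l_minus r_minus minus_add a_ac)
  moreover have "\<one> \<ominus> w \<otimes> e = (\<one> \<ominus> P) \<otimes> (\<one> \<ominus> S)"
    unfolding we using c PS by (simp add: minus_eq l_distr r_distr l_minus r_minus minus_add a_ac)
  moreover have "det (\<one> \<ominus> Q) = \<one>"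
    by (rule det_unipotent[OF two e]) (use corner_mult[OF e gD(1) w] Q_def g_def in simp)
  moreover have "det (\<one> \<ominus> S) = \<one>"
    by (rule det_unipotent[OF two gD(1)]) (use corner_mult[OF gD(1) e w] S_def eg in simp)
  ultimately show ?thesis using dm c centerD(1)[OF det_center] by simp
qed

end

section \<open>Orthogonal matrix units\<close>

lemma (in monoid) Units_of_two_sided_inverse:
  assumes "b \<in> carrier G" "c \<in> carrier G" "b \<otimes> c = \<one>" "c \<otimes> b = \<one>"
  shows "b \<in> Units G" "inv b = c"
  using assms inv_char by (auto simp: Units_def)

text \<open>Here \<open>r\<close> is a nondegenerate form on \<open>f R\<close> with inverse
  \<open>r'\<close>, and \<open>symm\<close> says that every form on \<open>f R\<close> is
  symmetric. This is the exceptional case in which a maximal skew form misses the summand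
  \<open>f R\<close>.\<close>

locale orthogonal_matrix_units = matrix_units R n f p q + ring_with_involution R \<sigma>
  for R (structure) and n f p q \<sigma> +
  fixes r r' :: 'a
  assumes n_pos: "n > 0"
    and r: "r \<in> corner (\<sigma> f) f" and r': "r' \<in> corner f (\<sigma> f)"
    and r_r': "r \<otimes> r' = \<sigma> f" and r'_r: "r' \<otimes> r = f"
    and symm: "\<And>x. x \<in> corner (\<sigma> f) f \<Longrightarrow> \<sigma> x = x"
begin

lemmas rD = cornerD[OF r] and r'D = cornerD[OF r']

text \<open>With respect to the basis \<open>q\<close> of the column space \<open>R f\<close>, \<open>gram\<close> represents the bilinear
  form \<open>(x, y) \<mapsto> r' \<otimes> \<sigma> x \<otimes> y\<close>, to which \<open>\<sigma>\<close> is adjoint.\<close>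
definition gram :: 'a where "gram = (\<Oplus>k\<in>{..<n}. q k \<otimes> (r' \<otimes> \<sigma> (q k)))"

definition gram_inv :: 'a where "gram_inv = (\<Oplus>k\<in>{..<n}. \<sigma> (p k) \<otimes> r \<otimes> p k)"

lemma gram_closed [simp]: "gram \<in> carrier R" and gram_inv_closed [simp]: "gram_inv \<in> carrier R"
  unfolding gram_def gram_inv_def using rD(1) r'D(1) by (auto intro!: finsum_closed)

lemma p_gram: assumes "i < n" shows "p i \<otimes> gram = r' \<otimes> \<sigma> (q i)"
proof -
  have "p i \<otimes> gram = f \<otimes> (r' \<otimes> \<sigma> (q i))"
    unfolding gram_def by (rule p_sum_q) (use assms r'D in auto)
  also have "\<dots> = f \<otimes> r' \<otimes> \<sigma> (q i)" using assms r'D(1) by (simp add: m_assoc)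
  finally show ?thesis using r'D by simp
qed

lemma gram_inv_q: assumes "i < n" shows "gram_inv \<otimes> q i = \<sigma> (p i) \<otimes> r"
proof -
  have "gram_inv \<otimes> q i = \<sigma> (p i) \<otimes> r \<otimes> f"
    unfolding gram_inv_def by (rule sum_p_q) (use assms rD in auto)
  then show ?thesis using assms rD by (simp add: m_assoc)
qed

lemma sig_q_p: assumes "i < n" "j < n" shows "\<sigma> (q i) \<otimes> \<sigma> (p j) = (if i = j then \<sigma> f else \<zero>)"
proof -
  have "\<sigma> (q i) \<otimes> \<sigma> (p j) = \<sigma> (p j \<otimes> q i)" using assms by simp
  then show ?thesis using assms by (simp only: p_q) simp
qed

lemma gram_gram_inv: "gram \<otimes> gram_inv = \<one>"
proof (rule separation)
  fix i j assume ij: "i < n" "j < n"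
  have "p i \<otimes> (gram \<otimes> gram_inv) \<otimes> q j = (p i \<otimes> gram) \<otimes> (gram_inv \<otimes> q j)"
    using ij by (simp only: m_assoc m_closed p_closed q_closed gram_closed gram_inv_closed)
  also have "\<dots> = r' \<otimes> \<sigma> (q i) \<otimes> (\<sigma> (p j) \<otimes> r)" using ij by (simp only: p_gram gram_inv_q)
  also have "\<dots> = r' \<otimes> (\<sigma> (q i) \<otimes> \<sigma> (p j)) \<otimes> r"
    using ij rD(1) r'D(1) by (simp only: m_assoc m_closed p_closed q_closed sig_closed)
  also have "\<dots> = p i \<otimes> q j" using ij rD r'D r'_r by (simp add: sig_q_p p_q)
  finally show "p i \<otimes> (gram \<otimes> gram_inv) \<otimes> q j = p i \<otimes> \<one> \<otimes> q j" using ij by simp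
qed simp_all

lemma gram_sig_p: assumes "i < n" shows "gram \<otimes> \<sigma> (p i) = q i \<otimes> r'"
proof (rule left_separation)
  fix j assume j: "j < n"
  have "p j \<otimes> (gram \<otimes> \<sigma> (p i)) = p j \<otimes> gram \<otimes> \<sigma> (p i)" using assms j by (simp add: m_assoc)
  also have "\<dots> = r' \<otimes> (\<sigma> (q j) \<otimes> \<sigma> (p i))"
    using assms j r'D(1) by (simp only: p_gram m_assoc p_closed q_closed sig_closed)
  also have "\<dots> = p j \<otimes> q i \<otimes> r'" using assms j r'D by (simp add: sig_q_p p_q)
  finally show "p j \<otimes> (gram \<otimes> \<sigma> (p i)) = p j \<otimes> (q i \<otimes> r')"
    using assms j r'D(1) by (simp add: m_assoc)
qed (use assms r'D in auto)

lemma sig_q_gram_inv: assumes "i < n" shows "\<sigma> (q i) \<otimes> gram_inv = r \<otimes> p i"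
proof (rule right_separation)
  fix j assume j: "j < n"
  have "\<sigma> (q i) \<otimes> gram_inv \<otimes> q j = \<sigma> (q i) \<otimes> (gram_inv \<otimes> q j)" using assms j by (simp add: m_assoc)
  also have "\<dots> = \<sigma> (q i) \<otimes> \<sigma> (p j) \<otimes> r"
    using assms j rD(1) by (simp only: gram_inv_q m_assoc p_closed q_closed sig_closed)
  also have "\<dots> = r \<otimes> (p i \<otimes> q j)" using assms j rD by (simp add: sig_q_p p_q)
  finally show "\<sigma> (q i) \<otimes> gram_inv \<otimes> q j = r \<otimes> p i \<otimes> q j"
    using assms j rD(1) by (simp add: m_assoc)
qed (use assms rD in auto)

lemma gram_inv_gram: "gram_inv \<otimes> gram = \<one>"
proof (rule sig_eqI)
  \<comment> \<open>The available formulas give the outer products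
    \<open>\<sigma> (q i) \<otimes> gram_inv\<close> and
    \<open>gram \<otimes> \<sigma> (p i)\<close>; after applying \<open>\<sigma>\<close>, these are
    what the entrywise comparison asks for.\<close>
  show "\<sigma> (gram_inv \<otimes> gram) = \<sigma> \<one>"
  proof (rule separation)
    fix i j assume ij: "i < n" "j < n"
    have "\<sigma> (q j) \<otimes> (gram_inv \<otimes> gram) \<otimes> \<sigma> (p i) = (\<sigma> (q j) \<otimes> gram_inv) \<otimes> (gram \<otimes> \<sigma> (p i))"
      using ij by (simp only: m_assoc m_closed p_closed q_closed gram_closed gram_inv_closed sig_closed)
    also have "\<dots> = r \<otimes> p j \<otimes> (q i \<otimes> r')" using ij by (simp only: sig_q_gram_inv gram_sig_p)
    also have "\<dots> = r \<otimes> (p j \<otimes> q i) \<otimes> r'"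
      using ij rD(1) r'D(1) by (simp only: m_assoc m_closed p_closed q_closed)
    also have "\<dots> = \<sigma> (q j) \<otimes> \<sigma> (p i)" using ij rD r'D r_r' by (simp add: sig_q_p p_q)
    finally have "\<sigma> (\<sigma> (q j) \<otimes> (gram_inv \<otimes> gram) \<otimes> \<sigma> (p i)) = \<sigma> (\<sigma> (q j) \<otimes> \<sigma> (p i))" by simp
    then show "p i \<otimes> \<sigma> (gram_inv \<otimes> gram) \<otimes> q j = p i \<otimes> \<sigma> \<one> \<otimes> q j"
      using ij by (simp add: m_assoc)
  qed simp_all
qed simp_all

text \<open>The form \<open>r d\<close> on \<open>f R\<close> is symmetric like \<open>r\<close>, so
  \<open>\<sigma>(d) r = r d\<close>: the involution of \<open>f R f\<close> adjoint to
  \<open>r\<close> is trivial.\<close>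

lemma r'_sig: assumes "d \<in> D" shows "r' \<otimes> \<sigma> d \<otimes> r = d"
proof -
  note dc = cornerD[OF assms]
  have "r \<otimes> d \<in> corner (\<sigma> f) f" using corner_mult_corner[OF r assms] by simp
  then have "\<sigma> (r \<otimes> d) = r \<otimes> d" by (rule symm)
  then have "\<sigma> d \<otimes> r = r \<otimes> d" using symm[OF r] rD(1) dc(1) by simp
  then have "r' \<otimes> \<sigma> d \<otimes> r = r' \<otimes> r \<otimes> d" using rD(1) r'D(1) dc(1) by (simp add: m_assoc)
  then show ?thesis using r'_r dc by simp
qed

text \<open>The (i, j) entry on the left is \<open>r' \<sigma>(d) r\<close> for the (j, i) entry
  \<open>d\<close> of \<open>x\<close>, and this twist is trivial.\<close>

lemma mat_transpose:
  assumes x: "x \<in> carrier R"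
  shows "mat (gram \<otimes> \<sigma> x \<otimes> gram_inv) = mtranspose (mat x)"
proof (rule mat_eqI)
  fix i j assume ij: "i < n" "j < n"
  have "p i \<otimes> (gram \<otimes> \<sigma> x \<otimes> gram_inv) \<otimes> q j = (p i \<otimes> gram) \<otimes> \<sigma> x \<otimes> (gram_inv \<otimes> q j)"
    using ij x by (simp only: m_assoc m_closed p_closed q_closed gram_closed gram_inv_closed sig_closed)
  also have "\<dots> = r' \<otimes> \<sigma> (q i) \<otimes> \<sigma> x \<otimes> (\<sigma> (p j) \<otimes> r)" using ij by (simp only: p_gram gram_inv_q)
  also have "\<dots> = r' \<otimes> \<sigma> (p j \<otimes> x \<otimes> q i) \<otimes> r" using ij x rD(1) r'D(1) by (simp add: m_assoc)
  also have "\<dots> = p j \<otimes> x \<otimes> q i" by (rule r'_sig[OF entry_in_D[OF x ij(2,1)]])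
  finally show "lift (p i \<otimes> (gram \<otimes> \<sigma> x \<otimes> gram_inv) \<otimes> q j) = mtranspose (mat x) (i, j)"
    using ij by (simp add: mtranspose_def mat_apply)
qed (auto simp: mtranspose_def mat_def)

text \<open>The inverse \<open>r'\<close> of the symmetric form \<open>r\<close> is symmetric, hence
  so is \<open>gram\<close>. For \<open>x = gram\<close> the element transposed by
  \<open>mat_transpose\<close> is then \<open>gram\<close> itself.\<close>

lemma mat_gram_symmetric: "mtranspose (mat gram) = mat gram"
proof -
  have "\<sigma> gram = gram"
  proof (rule left_separation)
    fix i assume i: "i < n"
    have "p i \<otimes> \<sigma> gram = \<sigma> (gram \<otimes> \<sigma> (p i))" using i by simp
    also have "\<dots> = \<sigma> r' \<otimes> \<sigma> (q i)" using i r'D(1) by (simp add: gram_sig_p)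
    also have "\<sigma> r' = r'"
    proof -
      have s: "\<sigma> r' \<in> corner f (\<sigma> f)" using sig_corner[OF r'] by simp
      note sD = cornerD[OF s]
      have rr: "r \<otimes> \<sigma> r' = \<sigma> f"
        using sig_mult[OF r'D(1) rD(1)] r'_r symm[OF r] by simp
      have "\<sigma> r' = r' \<otimes> r \<otimes> \<sigma> r'" using r'_r sD by simp
      also have "\<dots> = r' \<otimes> (r \<otimes> \<sigma> r')" using rD(1) r'D(1) by (simp add: m_assoc)
      finally show ?thesis using rr r'D by simp
    qed
    finally show "p i \<otimes> \<sigma> gram = p i \<otimes> gram" using i by (simp add: p_gram)
  qed simp_all
  then show ?thesis using mat_transpose[of gram] gram_gram_inv by (simp add: m_assoc)
qed

text \<open>Transport along the isomorphism \<open>mat\<close> yields a ring whose zero is written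
  \<open>mat \<zero>\<close>; the monoid axioms do not mention zero, so they hold for
  \<open>mat_ring R n\<close> as it stands.\<close>

lemma mat_ring_monoid: "monoid (mat_ring R n)"
proof -
  have iso: "mat \<in> ring_iso R (mat_ring R n)" by (rule mat_iso[OF n_pos])
  have "monoid (mat_ring R n\<lparr>zero := mat \<zero>\<rparr>)"
    by (rule ring.is_monoid[OF ring_iso_imp_img_ring[OF iso]])
  then show ?thesis unfolding monoid_def by simp
qed

lemma orth_data: "orth_data R \<sigma> n mat (mat gram)"
proof -
  let ?M = "mat_ring R n"
  interpret M: monoid ?M by (rule mat_ring_monoid)
  have iso: "mat \<in> ring_iso R ?M" by (rule mat_iso[OF n_pos])
  note isoE = ring_iso_memE[OF iso]
  have m: "mat (x \<otimes> y) = mat x \<otimes>\<^bsub>?M\<^esub> mat y" if "x \<in> carrier R" "y \<in> carrier R" for x y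
    using isoE(2) that by simp
  have c: "mat x \<in> carrier ?M" if "x \<in> carrier R" for x using isoE(1) that by simp
  have bc: "mat gram \<otimes>\<^bsub>?M\<^esub> mat gram_inv = \<one>\<^bsub>?M\<^esub>" "mat gram_inv \<otimes>\<^bsub>?M\<^esub> mat gram = \<one>\<^bsub>?M\<^esub>"
    using m[of gram gram_inv] m[of gram_inv gram] gram_gram_inv gram_inv_gram isoE(4) by simp_all
  have U: "mat gram \<in> Units ?M" and I: "inv\<^bsub>?M\<^esub> mat gram = mat gram_inv"
    using M.Units_of_two_sided_inverse[OF c c bc] by simp_all
  have "mat (\<sigma> x) = mat gram_inv \<otimes>\<^bsub>?M\<^esub> mtranspose (mat x) \<otimes>\<^bsub>?M\<^esub> mat gram" if x: "x \<in> carrier R" for x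
  proof -
    have "gram_inv \<otimes> (gram \<otimes> \<sigma> x \<otimes> gram_inv) \<otimes> gram = (gram_inv \<otimes> gram) \<otimes> \<sigma> x \<otimes> (gram_inv \<otimes> gram)"
      using x by (simp only: m_assoc m_closed sig_closed gram_closed gram_inv_closed)
    also have "\<dots> = \<sigma> x" using x gram_inv_gram by simp
    finally have "mat (\<sigma> x) = mat (gram_inv \<otimes> (gram \<otimes> \<sigma> x \<otimes> gram_inv) \<otimes> gram)" by simp
    then show ?thesis using x m mat_transpose[OF x] by simp
  qed
  then show ?thesis unfolding orth_data_def using iso U I mat_gram_symmetric by simp
qed

text \<open>Up to conjugation by \<open>gram\<close>, the matrix of \<open>\<sigma> x\<close> is the
  transpose of that of \<open>x\<close>.\<close>

lemma det_sig:
  assumes two: "\<one> \<oplus> \<one> \<in> Units R" and x: "x \<in> carrier R"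
  shows "det (\<sigma> x) = det x"
proof -
  interpret Z: cring Cen by (rule center_cring)
  note dm = det_mult[OF double_eq_zero[OF two]]
  have dc: "det x \<in> carrier R" if "x \<in> carrier R" for x using centerD(1)[OF det_center[OF that]] .
  have "det (gram \<otimes> \<sigma> x \<otimes> gram_inv) = det x"
    using x mat_center[OF x] Z.cdet_transpose[of n "mat x"]
    by (simp add: det_cdet mat_transpose)
  moreover have "det (gram \<otimes> \<sigma> x \<otimes> gram_inv) = det gram \<otimes> det gram_inv \<otimes> det (\<sigma> x)"
    using x dc centerD(2)[OF det_center, of "\<sigma> x" "det gram_inv"] by (simp add: dm m_assoc)
  moreover have "det gram \<otimes> det gram_inv = \<one>" using dm[of gram gram_inv] gram_gram_inv det_one by simp
  ultimately show ?thesis using dc x by simp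
qed

end

section \<open>Sesquilinear and skew forms on projective modules\<close>

context ring_with_involution
begin

text \<open>A nondegenerate sesquilinear form on the projective module \<open>h R\<close> is an element \<open>s\<close> of
  \<open>\<sigma>(h) R h\<close> together with its inverse \<open>s'\<close> in the opposite corner.\<close>
definition dual_pair :: "'a \<Rightarrow> 'a \<Rightarrow> 'a \<Rightarrow> bool" where
  "dual_pair h s s' \<longleftrightarrow> idem h \<and> s \<in> corner (\<sigma> h) h \<and> s' \<in> corner h (\<sigma> h)
     \<and> s \<otimes> s' = \<sigma> h \<and> s' \<otimes> s = h"

lemma dual_pair_add:
  assumes "dual_pair h s s'" "dual_pair k t t'" "h \<otimes> k = \<zero>" "k \<otimes> h = \<zero>"
  shows "dual_pair (h \<oplus> k) (s \<oplus> t) (s' \<oplus> t')"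
proof -
  have h: "idem h" "s \<in> corner (\<sigma> h) h" "s' \<in> corner h (\<sigma> h)" "s \<otimes> s' = \<sigma> h" "s' \<otimes> s = h"
    and k: "idem k" "t \<in> corner (\<sigma> k) k" "t' \<in> corner k (\<sigma> k)" "t \<otimes> t' = \<sigma> k" "t' \<otimes> t = k"
    using assms(1,2) unfolding dual_pair_def by simp_all
  note hc = idemD[OF h(1)] and kc = idemD[OF k(1)]
  note c = cornerD(1)[OF h(2)] cornerD(1)[OF h(3)] cornerD(1)[OF k(2)] cornerD(1)[OF k(3)]
  have sh: "\<sigma> h \<otimes> \<sigma> k = \<zero>" "\<sigma> k \<otimes> \<sigma> h = \<zero>"
    using sig_mult[of k h] sig_mult[of h k] hc kc assms(3,4) by simp_all
  have z: "s \<otimes> t' = \<zero>" "t \<otimes> s' = \<zero>" "s' \<otimes> t = \<zero>" "t' \<otimes> s = \<zero>"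
    using corner_orth[OF h(2) k(3)] corner_orth[OF k(2) h(3)] corner_orth[OF h(3) k(2)] corner_orth[OF k(3) h(2)]
      assms(3,4) sh hc kc by simp_all
  note a = idem_add[OF h(1) k(1) assms(3,4)]
  have sa: "\<sigma> h \<otimes> \<sigma> (h \<oplus> k) = \<sigma> h" "\<sigma> (h \<oplus> k) \<otimes> \<sigma> h = \<sigma> h"
    "\<sigma> k \<otimes> \<sigma> (h \<oplus> k) = \<sigma> k" "\<sigma> (h \<oplus> k) \<otimes> \<sigma> k = \<sigma> k"
    using a idemD[OF a(1)] hc(1) kc(1)
    by (metis sig_mult add.m_closed)+
  have mono: "s \<in> corner (\<sigma> (h \<oplus> k)) (h \<oplus> k)" "t \<in> corner (\<sigma> (h \<oplus> k)) (h \<oplus> k)"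
    "s' \<in> corner (h \<oplus> k) (\<sigma> (h \<oplus> k))" "t' \<in> corner (h \<oplus> k) (\<sigma> (h \<oplus> k))"
    using corner_mono[OF h(2) sa(1,2) a(2,3)] corner_mono[OF k(2) sa(3,4) a(4,5)]
      corner_mono[OF h(3) a(2,3) sa(1,2)] corner_mono[OF k(3) a(4,5) sa(3,4)] hc kc by simp_all
  have "(s \<oplus> t) \<otimes> (s' \<oplus> t') = \<sigma> (h \<oplus> k)" "(s' \<oplus> t') \<otimes> (s \<oplus> t) = h \<oplus> k"
    using c z h k hc kc by (simp_all add: l_distr r_distr)
  then show ?thesis unfolding dual_pair_def
    using a(1) corner_add[OF mono(1,2)] corner_add[OF mono(3,4)] hc kc by simp
qed

definition skew_pair :: "'a \<Rightarrow> 'a \<Rightarrow> 'a \<Rightarrow> bool" where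
  "skew_pair h s s' \<longleftrightarrow> dual_pair h s s' \<and> \<sigma> s = \<ominus> s"

lemma dual_pair_closed:
  assumes "dual_pair h s s'" shows "h \<in> carrier R" "s \<in> carrier R" "s' \<in> carrier R"
  using assms idemD cornerD unfolding dual_pair_def by auto

lemma skew_pair_add:
  assumes "skew_pair h s s'" "skew_pair k t t'" "h \<otimes> k = \<zero>" "k \<otimes> h = \<zero>"
  shows "skew_pair (h \<oplus> k) (s \<oplus> t) (s' \<oplus> t')"
  using assms dual_pair_add dual_pair_closed unfolding skew_pair_def by (auto simp: minus_add)

lemma primitive_dual_pair:
  assumes v: vnr and f: "primitive f" and x: "x \<in> corner (\<sigma> f) f" "x \<noteq> \<zero>"
  obtains x' where "dual_pair f x x'"
proof -
  obtain x' where "x' \<in> corner f (\<sigma> f)" "x \<otimes> x' = \<sigma> f" "x' \<otimes> x = f"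
    using primitive_corner_inverse[OF v sig_primitive[OF f] f x] .
  then show ?thesis using that[of x'] x primitiveD[OF f] unfolding dual_pair_def by simp
qed

text \<open>A hyperbolic plane. Primeness supplies a nonzero pairing \<open>x\<close> between the
  two summands, Schur's lemma its inverse \<open>y\<close>, and \<open>x - \<sigma>(x)\<close> is
  skew with inverse \<open>y - \<sigma>(y)\<close>: the mixed products vanish and the two signs
  cancel.\<close>

lemma primitive_pair_skew:
  assumes v: vnr and pr: prime_ring and f: "primitive f" "primitive f'"
    and orth: "f \<otimes> f' = \<zero>" "f' \<otimes> f = \<zero>"
  obtains s s' where "skew_pair (f \<oplus> f') s s'"
proof -
  note fD = primitiveD[OF f(1)] and f'D = primitiveD[OF f(2)]
  note sf = primitiveD[OF sig_primitive[OF f(1)]]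
  obtain x where x: "x \<in> corner (\<sigma> f) f'" "x \<noteq> \<zero>"
    using prime_ring_corner[OF pr sf(1) f'D(1) sf(2) f'D(2)] .
  obtain y where y: "y \<in> corner f' (\<sigma> f)" "x \<otimes> y = \<sigma> f" "y \<otimes> x = f'"
    using primitive_corner_inverse[OF v sig_primitive[OF f(1)] f(2) x] .
  note xD = cornerD[OF x(1)] and yD = cornerD[OF y(1)]
  have sx: "\<sigma> x \<in> corner (\<sigma> f') f" using sig_corner'[OF x(1)] fD f'D by simp
  have sy: "\<sigma> y \<in> corner f (\<sigma> f')" using sig_corner[OF y(1)] fD f'D by simp
  have orth': "\<sigma> f \<otimes> \<sigma> f' = \<zero>" "\<sigma> f' \<otimes> \<sigma> f = \<zero>"
    using sig_mult[of f' f] sig_mult[of f f'] fD f'D orth by simp_all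
  note a = idem_add[OF fD(1) f'D(1) orth]
  have sa: "\<sigma> f \<otimes> \<sigma> (f \<oplus> f') = \<sigma> f" "\<sigma> (f \<oplus> f') \<otimes> \<sigma> f = \<sigma> f"
    "\<sigma> f' \<otimes> \<sigma> (f \<oplus> f') = \<sigma> f'" "\<sigma> (f \<oplus> f') \<otimes> \<sigma> f' = \<sigma> f'"
    using a idemD[OF a(1)] fD(3) f'D(3) by (metis sig_mult add.m_closed)+
  let ?h = "f \<oplus> f'"
  have hc: "?h \<in> carrier R" using fD f'D by simp
  have m: "x \<in> corner (\<sigma> ?h) ?h" "\<sigma> x \<in> corner (\<sigma> ?h) ?h" "y \<in> corner ?h (\<sigma> ?h)" "\<sigma> y \<in> corner ?h (\<sigma> ?h)"
    using corner_mono[OF x(1) sa(1,2) a(4,5)] corner_mono[OF sx sa(3,4) a(2,3)]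
      corner_mono[OF y(1) a(4,5) sa(1,2)] corner_mono[OF sy a(2,3) sa(3,4)] fD f'D by simp_all
  have c: "x \<ominus> \<sigma> x \<in> corner (\<sigma> ?h) ?h" "y \<ominus> \<sigma> y \<in> corner ?h (\<sigma> ?h)"
    unfolding minus_eq using corner_add corner_minus m hc by simp_all
  have z: "x \<otimes> \<sigma> y = \<zero>" "\<sigma> x \<otimes> y = \<zero>" "y \<otimes> \<sigma> x = \<zero>" "\<sigma> y \<otimes> x = \<zero>"
    using corner_orth[OF x(1) sy] corner_orth[OF sx y(1)] corner_orth[OF y(1) sx] corner_orth[OF sy x(1)]
      orth orth' fD f'D by simp_all
  have p: "\<sigma> x \<otimes> \<sigma> y = \<sigma> f'" "\<sigma> y \<otimes> \<sigma> x = f"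
    using sig_mult[OF yD(1) xD(1)] sig_mult[OF xD(1) yD(1)] y fD by simp_all
  have "(x \<ominus> \<sigma> x) \<otimes> (y \<ominus> \<sigma> y) = \<sigma> ?h"
    using xD(1) yD(1) z p y fD(3) f'D(3) by (simp add: minus_eq l_distr r_distr l_minus r_minus)
  moreover have "(y \<ominus> \<sigma> y) \<otimes> (x \<ominus> \<sigma> x) = ?h"
    using xD(1) yD(1) z p y fD(3) f'D(3) by (simp add: minus_eq l_distr r_distr l_minus r_minus a_comm)
  ultimately have "dual_pair ?h (x \<ominus> \<sigma> x) (y \<ominus> \<sigma> y)"
    unfolding dual_pair_def using a(1) c by simp
  moreover have "\<sigma> (x \<ominus> \<sigma> x) = \<ominus> (x \<ominus> \<sigma> x)"
    using xD(1) by (simp add: minus_eq minus_add a_comm)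
  ultimately show ?thesis using that unfolding skew_pair_def by blast
qed

text \<open>Choose \<open>h\<close> with \<open>R (g - h)\<close> minimal. Two orthogonal primitive
  idempotents inside \<open>g - h\<close> would carry a hyperbolic plane, so \<open>g - h\<close> is
  zero or primitive. In the latter case a non-symmetric \<open>x\<close> would give the nonzero skew
  form \<open>x - \<sigma>(x)\<close>, nondegenerate by Schur's lemma.\<close>

lemma maximal_skew_pair:
  assumes art: "left_artinian R" and v: vnr and pr: prime_ring and g: "idem g"
  obtains h s s' where "skew_pair h s s'" "h \<in> corner g g"
    "g \<ominus> h = \<zero> \<or> (primitive (g \<ominus> h) \<and> (\<forall>x\<in>corner (\<sigma> (g \<ominus> h)) (g \<ominus> h). \<sigma> x = x))"
proof -
  let ?P = "\<lambda>h. h \<in> corner g g \<and> (\<exists>s s'. skew_pair h s s')"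
  note gc = idemD[OF g]
  have i: "idem h" if "?P h" for h using that unfolding skew_pair_def dual_pair_def by blast
  have P0: "?P \<zero>"
    using gc by (auto simp: corner_def skew_pair_def dual_pair_def idem_def intro!: exI[of _ \<zero>])
  have Pl: "lideal R (princ (g \<ominus> h))" if "?P h" for h
    by (rule lideal_princ) (use gc idemD[OF i[OF that]] in simp)
  obtain h where h: "?P h" and min: "\<forall>y. ?P y \<longrightarrow> \<not> princ (g \<ominus> y) \<subset> princ (g \<ominus> h)"
    by (rule dcc_minimal[where P = ?P and L = "\<lambda>h. princ (g \<ominus> h)", OF art P0 Pl])
  have ih: "idem h" by (rule i[OF h])
  obtain s s' where s: "skew_pair h s s'" using h by blast
  define k where "k = g \<ominus> h"
  note hc = idemD[OF ih]
  have hg: "h \<in> corner g g" using h by simp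
  note kD = idem_diff[OF g ih hg, folded k_def]
  note kc = idemD[OF kD(1)]
  have no: False if k1: "skew_pair k1 t t'" "k1 \<in> corner k k" "k1 \<noteq> \<zero>" for k1 t t'
  proof -
    have ik1: "idem k1" using k1(1) unfolding skew_pair_def dual_pair_def by simp
    note k1c = idemD[OF ik1]
    have o: "h \<otimes> k1 = \<zero>" "k1 \<otimes> h = \<zero>"
      using corner_orth[OF idem_corner[OF ih] k1(2)] corner_orth[OF k1(2) idem_corner[OF ih]] kD hc kc by simp_all
    have "h \<oplus> k1 \<in> corner g g"
      using corner_add[OF hg corner_trans[OF gc(1) kD(2) k1(2)]] gc by simp
    then have "?P (h \<oplus> k1)" using skew_pair_add[OF s k1(1) o] by blast
    then have "\<not> princ (g \<ominus> (h \<oplus> k1)) \<subset> princ (g \<ominus> h)" using min by blast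
    moreover have "g \<ominus> (h \<oplus> k1) = k \<ominus> k1"
      unfolding k_def using gc hc k1c by (simp add: minus_eq minus_add a_assoc)
    ultimately show False using princ_diff_strict[OF kD(1) ik1 k1(2,3)] unfolding k_def[symmetric] by simp
  qed
  have "k = \<zero> \<or> (primitive k \<and> (\<forall>x\<in>corner (\<sigma> k) k. \<sigma> x = x))"
  proof (cases "k = \<zero>")
    case False
    obtain f where f: "primitive f" "f \<in> corner k k" using primitive_below[OF art kD(1) False] by blast
    note fD = primitiveD[OF f(1)]
    have "k = f"
    proof (rule ccontr)
      assume "k \<noteq> f"
      note d = idem_diff[OF kD(1) fD(1) f(2)]
      have "k \<ominus> f \<noteq> \<zero>" using \<open>k \<noteq> f\<close> kc fD by simp
      then obtain f' where f': "primitive f'" "f' \<in> corner (k \<ominus> f) (k \<ominus> f)"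
        using primitive_below[OF art d(1)] by blast
      note f'D = primitiveD[OF f'(1)]
      have o: "f \<otimes> f' = \<zero>" "f' \<otimes> f = \<zero>"
        using corner_orth[OF idem_corner[OF fD(1)] f'(2)] corner_orth[OF f'(2) idem_corner[OF fD(1)]]
          d idemD[OF d(1)] fD by simp_all
      obtain t t' where t: "skew_pair (f \<oplus> f') t t'"
        using primitive_pair_skew[OF v pr f(1) f'(1) o] .
      have "f \<oplus> f' \<in> corner k k"
        using corner_add[OF f(2) corner_trans[OF kc(1) d(2) f'(2)]] kc by simp
      moreover have "f \<oplus> f' \<noteq> \<zero>"
        using idem_add(2)[OF fD(1) f'D(1) o] fD by auto
      ultimately show False using no[OF t] by simp
    qed
    moreover have "\<sigma> x = x" if x: "x \<in> corner (\<sigma> f) f" for x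
    proof (rule ccontr)
      assume ne: "\<sigma> x \<noteq> x"
      note xc = cornerD(1)[OF x]
      let ?y = "x \<ominus> \<sigma> x"
      have sx: "\<sigma> x \<in> corner (\<sigma> f) f" using sig_corner'[OF x] fD by simp
      have y: "?y \<in> corner (\<sigma> f) f" unfolding minus_eq using corner_add[OF x corner_minus[OF sx]] fD by simp
      have "?y \<noteq> \<zero>" using ne xc by auto
      then obtain y' where "dual_pair f ?y y'" using primitive_dual_pair[OF v f(1) y] by blast
      moreover have "\<sigma> ?y = \<ominus> ?y" using xc by (simp add: minus_eq minus_add a_comm)
      ultimately have "skew_pair f ?y y'" unfolding skew_pair_def by simp
      then show False using no f(2) fD(2) by blast
    qed
    ultimately show ?thesis using f by simp
  qed simp
  then show ?thesis using that[OF s hg] unfolding k_def by blast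
qed

end

section \<open>Quasi-reflections in simple rings with involution\<close>

lemma (in ring) add_diff_cancel_right:
  assumes "x \<in> carrier R" "y \<in> carrier R" shows "x \<oplus> (y \<ominus> x) = y"
proof -
  have "x \<oplus> (y \<ominus> x) = y \<ominus> x \<oplus> x" using assms by (simp add: a_comm)
  then show ?thesis using assms by (simp add: minus_eq a_assoc l_neg)
qed

context ring_with_involution
begin

text \<open>The inverse of \<open>\<one> \<oplus> u\<close> on its support is the Wall form of the isometry \<open>\<ominus> u\<close>.\<close>
lemma wall_form:
  assumes v: vnr and u: "u \<in> carrier R" "\<sigma> u \<otimes> u = \<one>" "u \<otimes> \<sigma> u = \<one>"
  obtains e t where "dual_pair e t (\<one> \<oplus> u)" "t \<oplus> \<sigma> t = \<sigma> e \<otimes> e"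
proof -
  define a where "a = \<one> \<oplus> u"
  have ac: "a \<in> carrier R" unfolding a_def using u by simp
  have au: "a \<otimes> \<sigma> u = \<sigma> a" and ua: "\<sigma> a \<otimes> u = a"
    unfolding a_def using u by (simp_all add: l_distr a_comm)
  have sa: "\<sigma> a \<otimes> a = a \<oplus> \<sigma> a"
    unfolding a_def using u by (simp add: l_distr r_distr a_ac)
  obtain x where x: "x \<in> carrier R" "a \<otimes> x \<otimes> a = a" using vnrE[OF v ac] .
  define e where "e = a \<otimes> x"
  have ec: "e \<in> carrier R" unfolding e_def using ac x by simp
  have ea: "e \<otimes> a = a" unfolding e_def using x by simp
  have ie: "idem e" unfolding idem_def using ec ea ac x(1) by (simp add: e_def m_assoc[symmetric])
  note ee = idemD(2)[OF ie]
  \<comment> \<open>By unitarity \<open>\<sigma>(a) = a \<sigma>(u)\<close>, so \<open>e\<close> is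
    a left identity of \<open>\<sigma>(a)\<close> as well as of \<open>a\<close>; applying
    \<open>\<sigma>\<close> moves it to the right of \<open>a\<close>.\<close>
  have ase: "a \<otimes> \<sigma> e = a"
  proof -
    have "e \<otimes> \<sigma> a = e \<otimes> a \<otimes> \<sigma> u" using au[symmetric] ec ac u(1) by (simp add: m_assoc)
    then have "e \<otimes> \<sigma> a = \<sigma> a" using ea au by simp
    then have "\<sigma> (e \<otimes> \<sigma> a) = a" using ac by simp
    then show ?thesis using ec ac by simp
  qed
  define t where "t = \<sigma> e \<otimes> x \<otimes> e"
  have tcor: "t \<in> corner (\<sigma> e) e" unfolding t_def using corner_mult[OF sig_idem[OF ie] ie x(1)] .
  note tD = cornerD[OF tcor]
  have at: "a \<otimes> t = e"
  proof -
    have "a \<otimes> t = (a \<otimes> \<sigma> e) \<otimes> x \<otimes> e" unfolding t_def using ac ec x(1) by (simp add: m_assoc)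
    then show ?thesis using ase ee unfolding e_def by simp
  qed
  \<comment> \<open>The defect \<open>d = x a - 1\<close> satisfies \<open>a d = 0\<close>. Since
    \<open>a = \<sigma>(a) u\<close>, this gives \<open>\<sigma>(d) a = \<sigma>(a d) u = 0\<close>,
    hence \<open>\<sigma>(d) e = 0\<close>.\<close>
  have ta: "t \<otimes> a = \<sigma> e"
  proof -
    define d where "d = x \<otimes> a \<ominus> \<one>"
    have dc: "d \<in> carrier R" unfolding d_def using x ac by simp
    have "a \<otimes> d = a \<otimes> x \<otimes> a \<ominus> a" unfolding d_def using x(1) ac by (simp add: minus_eq r_distr r_minus m_assoc)
    then have ad: "a \<otimes> d = \<zero>" using x ac by (simp add: minus_eq r_neg)
    have "\<sigma> d \<otimes> e = \<sigma> d \<otimes> (\<sigma> a \<otimes> u) \<otimes> x" unfolding e_def ua using dc ac x(1) by (simp add: m_assoc)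
    also have "\<dots> = \<sigma> (a \<otimes> d) \<otimes> u \<otimes> x" using dc ac x(1) u(1) by (simp add: m_assoc)
    also have "\<dots> = \<zero>" using ad u(1) x(1) by simp
    finally have "\<sigma> (\<sigma> d \<otimes> e) = \<zero>" by simp
    then have sed: "\<sigma> e \<otimes> d = \<zero>" using dc ec by simp
    have "x \<otimes> a = d \<oplus> \<one>" unfolding d_def using x(1) ac by (simp add: minus_eq a_assoc l_neg)
    then have "\<sigma> e \<otimes> (x \<otimes> a) = \<sigma> e" using sed dc ec by (simp add: r_distr)
    moreover have "t \<otimes> a = \<sigma> e \<otimes> (x \<otimes> a)" unfolding t_def using ea ec ac x(1) by (simp add: m_assoc)
    ultimately show ?thesis by simp
  qed
  have "a \<in> corner e (\<sigma> e)" using ac ea ase by (rule cornerI)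
  then have "dual_pair e t a" unfolding dual_pair_def using ie tcor at ta by simp
  moreover have "t \<oplus> \<sigma> t = \<sigma> e \<otimes> e"
  proof -
    have ste: "\<sigma> t \<otimes> e = \<sigma> t" using cornerD(3)[OF sig_corner'[OF tcor ec ec]] .
    have "\<sigma> e \<otimes> e = \<sigma> (a \<otimes> t) \<otimes> (a \<otimes> t)" using at by simp
    also have "\<dots> = \<sigma> t \<otimes> (\<sigma> a \<otimes> a) \<otimes> t" using ac tD(1) by (simp add: m_assoc)
    also have "\<dots> = \<sigma> t \<otimes> (a \<otimes> t) \<oplus> \<sigma> (a \<otimes> t) \<otimes> t"
      unfolding sa using ac tD(1) by (simp add: l_distr r_distr m_assoc)
    also have "\<dots> = \<sigma> t \<oplus> t" using at ste tD by simp
    finally show ?thesis using tD(1) by (simp add: a_comm)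
  qed
  ultimately show ?thesis using that unfolding a_def by blast
qed

text \<open>Symmetry of \<open>r\<close> and of \<open>r w\<close> gives
  \<open>\<sigma>(w) r = r w\<close> for all \<open>w\<close> in \<open>k R k\<close>. The
  involution of \<open>k R k\<close> adjoint to \<open>r\<close> is thus the identity, and an
  anti-automorphism can be the identity only on a commutative ring.\<close>

lemma symmetric_corner_comm:
  assumes d: "dual_pair k r r'" and sym: "\<And>x. x \<in> corner (\<sigma> k) k \<Longrightarrow> \<sigma> x = x"
    and x: "x \<in> corner k k" and y: "y \<in> corner k k"
  shows "x \<otimes> y = y \<otimes> x"
proof -
  have r: "idem k" "r \<in> corner (\<sigma> k) k" "r' \<in> corner k (\<sigma> k)" "r' \<otimes> r = k"
    using d unfolding dual_pair_def by simp_all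
  note c = cornerD(1)[OF r(2)] cornerD(1)[OF r(3)] cornerD(1)[OF x] cornerD(1)[OF y] idemD(1)[OF r(1)]
  have s: "\<sigma> w \<otimes> r = r \<otimes> w" if w: "w \<in> corner k k" for w
  proof -
    have "\<sigma> (r \<otimes> w) = r \<otimes> w" using sym corner_mult_corner[OF r(2) w] c by simp
    then show ?thesis using c cornerD(1)[OF w] sym[OF r(2)] by simp
  qed
  have xy: "x \<otimes> y \<in> corner k k" using corner_mult_corner[OF x y] c by simp
  have "r \<otimes> (x \<otimes> y) = \<sigma> y \<otimes> (\<sigma> x \<otimes> r)" using s[OF xy] c by (simp add: m_assoc)
  also have "\<dots> = \<sigma> y \<otimes> r \<otimes> x" using s[OF x] c by (simp add: m_assoc)
  also have "\<dots> = r \<otimes> (y \<otimes> x)" using s[OF y] c by (simp add: m_assoc)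
  finally have "r' \<otimes> (r \<otimes> (x \<otimes> y)) = r' \<otimes> (r \<otimes> (y \<otimes> x))" by simp
  then have "k \<otimes> (x \<otimes> y) = k \<otimes> (y \<otimes> x)" using c r(4) by (simp add: m_assoc[symmetric])
  then show ?thesis using cornerD(2)[OF x] cornerD(2)[OF y] c by (simp add: m_assoc[symmetric])
qed

text \<open>On the factor \<open>z R\<close> the element \<open>\<ominus> u\<close> is a quasi-reflection \<open>\<one> \<ominus> y c' \<sigma>(y)\<close>, where \<open>c'\<close> is the
  inverse of \<open>c\<close>.\<close>
definition cayley :: "'a \<Rightarrow> 'a \<Rightarrow> bool" where
  "cayley z u \<longleftrightarrow> (\<exists>y\<in>corner z z. \<exists>c\<in>corner z z. \<exists>c'\<in>corner z z. c \<otimes> c' = z \<and> c' \<otimes> c = z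
     \<and> c \<oplus> \<sigma> c = \<sigma> y \<otimes> y \<and> y \<otimes> c' \<otimes> \<sigma> y = z \<otimes> (\<one> \<oplus> u))"

lemma corner_one: "corner \<one> \<one> = carrier R"
  unfolding corner_def by auto

text \<open>The second alternative is the failure of the condition defining
  \<open>U0_simple\<close>, witnessed by the identification built from matrix units. The ring is
  only assumed to be regular, prime and left artinian, which is how the factors \<open>e R\<close>
  will be presented.\<close>

theorem simple_cayley_or_det:
  assumes art: "left_artinian R" and v: vnr and pr: prime_ring
    and two: "\<one> \<oplus> \<one> \<in> Units R" and nz: "\<one> \<noteq> \<zero>"
    and u: "u \<in> carrier R" "\<sigma> u \<otimes> u = \<one>"
  shows "cayley \<one> u \<or> (\<exists>n \<phi> B. orth_data R \<sigma> n \<phi> B \<and> mdet R n (\<phi> u) \<noteq> \<one>)"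
proof -
  have uu: "u \<otimes> \<sigma> u = \<one>" using left_artinian_inverse_comm[OF art _ u(1) u(2)] u(1) by simp
  define a where "a = \<one> \<oplus> u"
  obtain e t where et: "dual_pair e t a" and tt: "t \<oplus> \<sigma> t = \<sigma> e \<otimes> e"
    using wall_form[OF v u uu] unfolding a_def .
  have ie: "idem e" and tcor: "t \<in> corner (\<sigma> e) e" and acor: "a \<in> corner e (\<sigma> e)"
    using et unfolding dual_pair_def by simp_all
  note ec = idemD[OF ie] and tD = cornerD[OF tcor] and aD = cornerD[OF acor]
  define g where "g = \<one> \<ominus> e"
  have i1: "idem \<one>" unfolding idem_def by simp
  have e1: "e \<in> corner \<one> \<one>" unfolding corner_def using ec by simp
  note gD = idem_diff[OF i1 ie e1, folded g_def]
  note gc = idemD[OF gD(1)]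
  obtain h s s' where sk: "skew_pair h s s'" and hg: "h \<in> corner g g"
    and max: "g \<ominus> h = \<zero> \<or> (primitive (g \<ominus> h) \<and> (\<forall>x\<in>corner (\<sigma> (g \<ominus> h)) (g \<ominus> h). \<sigma> x = x))"
    using maximal_skew_pair[OF art v pr gD(1)] .
  have ds: "dual_pair h s s'" and skew: "\<sigma> s = \<ominus> s" using sk unfolding skew_pair_def by simp_all
  have ih: "idem h" and scor: "s \<in> corner (\<sigma> h) h" and s'cor: "s' \<in> corner h (\<sigma> h)"
    using ds unfolding dual_pair_def by simp_all
  note hc = idemD[OF ih] and sD = cornerD[OF scor] and s'D = cornerD[OF s'cor]
  define k where "k = g \<ominus> h"
  note kD = idem_diff[OF gD(1) ih hg, folded k_def]
  note kc = idemD[OF kD(1)]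
  have eh: "e \<otimes> h = \<zero>" "h \<otimes> e = \<zero>"
    using corner_orth[OF idem_corner[OF ie] hg] corner_orth[OF hg idem_corner[OF ie]] gD gc ec by simp_all
  have ek: "e \<otimes> k = \<zero>" "k \<otimes> e = \<zero>"
    using corner_orth[OF idem_corner[OF ie] kD(2)] corner_orth[OF kD(2) idem_corner[OF ie]] gD gc ec by simp_all
  have sum1: "e \<oplus> h \<oplus> k = \<one>"
    using add_diff_cancel_right[OF hc(1) gc(1)] add_diff_cancel_right[OF ec(1) one_closed] ec(1) hc(1) kc(1)
    unfolding k_def[symmetric] g_def[symmetric] by (simp add: a_assoc)
  note dh = dual_pair_add[OF et ds eh]
  have es': "e \<otimes> s' = \<zero>"
    using corner_orth[OF idem_corner[OF ie] s'cor] eh ec hc by simp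
  have sums: "t \<oplus> s \<oplus> \<sigma> (t \<oplus> s) = \<sigma> e \<otimes> e"
  proof -
    have "t \<oplus> s \<oplus> \<sigma> (t \<oplus> s) = (t \<oplus> \<sigma> t) \<oplus> (s \<oplus> \<sigma> s)" using tD(1) sD(1) by (simp add: a_ac)
    then show ?thesis using tt skew sD(1) tD(1) ec(1) by (simp add: r_neg)
  qed
  show ?thesis
  proof (cases "k = \<zero>")
    case True
    then have one: "e \<oplus> h = \<one>" using sum1 ec hc by simp
    have "(t \<oplus> s) \<otimes> (a \<oplus> s') = \<one>" "(a \<oplus> s') \<otimes> (t \<oplus> s) = \<one>"
      using dh unfolding dual_pair_def one by simp_all
    moreover have "e \<otimes> (a \<oplus> s') \<otimes> \<sigma> e = \<one> \<otimes> (\<one> \<oplus> u)"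
      using aD s'D(1) ec(1) es' u(1) by (simp add: r_distr) (simp add: a_def)
    ultimately have "cayley \<one> u"
      unfolding cayley_def corner_one using sums ec tD sD aD s'D by blast
    then show ?thesis ..
  next
    case False
    then have kp: "primitive k" and sym: "\<And>x. x \<in> corner (\<sigma> k) k \<Longrightarrow> \<sigma> x = x"
      using max unfolding k_def[symmetric] by blast+
    have sk2: "primitive (\<sigma> k)" by (rule sig_primitive[OF kp])
    obtain r where r: "r \<in> corner (\<sigma> k) k" "r \<noteq> \<zero>"
      using prime_ring_corner[OF pr _ _ _ False, of "\<sigma> k"] primitiveD[OF sk2] kD(1) by blast
    obtain r' where dr: "dual_pair k r r'" using primitive_dual_pair[OF v kp r] .
    have r': "r' \<in> corner k (\<sigma> k)" "r \<otimes> r' = \<sigma> k" "r' \<otimes> r = k"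
      using dr unfolding dual_pair_def by simp_all
    note rD = cornerD[OF r(1)] and r'D = cornerD[OF r'(1)]
    \<comment> \<open>The summand missed by the skew form is taken as base of the matrix units, so
      that \<open>1 - 2 k\<close> becomes a diagonal reflection of determinant -1.\<close>
    obtain n p q where mu: "matrix_units R n k p q" and n: "n > 0" "p 0 = k" "q 0 = k"
      using matrix_units_exist[OF art v pr kp symmetric_corner_comm[OF dr sym]] .
    interpret O: orthogonal_matrix_units R n k p q \<sigma> r r'
      by (intro orthogonal_matrix_units.intro mu ring_with_involution_axioms
          orthogonal_matrix_units_axioms.intro n r r' sym)
    have hk: "(e \<oplus> h) \<otimes> k = \<zero>" "k \<otimes> (e \<oplus> h) = \<zero>"
      using ek kD(3,4) ec hc kc by (simp_all add: l_distr r_distr)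
    define c where "c = t \<oplus> s \<oplus> r"
    define c' where "c' = a \<oplus> s' \<oplus> r'"
    have cc: "c \<in> carrier R" "c' \<in> carrier R" unfolding c_def c'_def using tD sD rD aD s'D r'D by simp_all
    have inv: "c \<otimes> c' = \<one>" "c' \<otimes> c = \<one>"
      using dual_pair_add[OF dh dr hk] unfolding sum1 dual_pair_def c_def c'_def by simp_all
    have er': "e \<otimes> r' = \<zero>" using corner_orth[OF idem_corner[OF ie] r'(1)] ek ec kc by simp
    \<comment> \<open>Of the three summands of \<open>c'\<close> only \<open>a\<close> survives
      multiplication by \<open>e\<close>, so \<open>e w = a = 1 + u\<close>.\<close>
    define w where "w = c' \<otimes> \<sigma> e"
    have wc: "w \<in> carrier R" unfolding w_def using cc ec by simp
    have "e \<otimes> w = a"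
      unfolding w_def c'_def using aD s'D(1) r'D(1) ec(1) es' er' by (simp add: m_assoc[symmetric] r_distr)
    then have mu1: "\<ominus> u = \<one> \<ominus> e \<otimes> w"
      unfolding a_def using u(1) by (simp add: minus_eq minus_add a_assoc[symmetric] r_neg)
    \<comment> \<open>Subtracting \<open>t + \<sigma>(t)\<close> from \<open>c\<close> leaves
      \<open>s + r - \<sigma>(t)\<close>. As \<open>s\<close> is skew and \<open>r\<close>
      symmetric, this is \<open>-\<sigma>(b)\<close>, with only the sign of \<open>r\<close>
      reversed in \<open>b\<close>.\<close>
    define b where "b = t \<oplus> s \<ominus> r"
    have bc: "b \<in> carrier R" unfolding b_def using tD sD rD by simp
    have "c \<ominus> \<sigma> e \<otimes> e = \<ominus> \<sigma> b"
    proof -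
      have "c \<ominus> \<sigma> e \<otimes> e = c \<ominus> (t \<oplus> \<sigma> t)" using tt by simp
      also have "\<dots> = s \<oplus> r \<ominus> \<sigma> t"
        unfolding c_def using tD(1) sD(1) rD(1) by (simp add: minus_eq minus_add a_ac r_neg1 r_neg2)
      also have "\<dots> = \<ominus> \<sigma> b"
        unfolding b_def using tD(1) sD(1) rD(1) skew sym[OF r(1)] by (simp add: minus_eq minus_add a_ac)
      finally show ?thesis .
    qed
    then have swap: "\<one> \<ominus> w \<otimes> e = c' \<otimes> (\<ominus> \<one> \<otimes> \<sigma> b)"
    proof -
      have "\<one> \<ominus> w \<otimes> e = c' \<otimes> (c \<ominus> \<sigma> e \<otimes> e)"
        unfolding w_def using inv(2) cc ec(1) by (simp add: minus_eq r_distr r_minus m_assoc)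
      then show ?thesis using \<open>c \<ominus> \<sigma> e \<otimes> e = \<ominus> \<sigma> b\<close> bc by (simp add: l_minus)
    qed
    have b2: "b = c \<otimes> (\<one> \<ominus> (k \<oplus> k))"
    proof -
      have tk: "t \<otimes> k = \<zero>" "s \<otimes> k = \<zero>"
        using corner_orth[OF tcor idem_corner[OF kD(1)]] corner_orth[OF scor idem_corner[OF kD(1)]] ek kD(3) ec hc kc
        by simp_all
      then have "c \<otimes> k = r" unfolding c_def using tD(1) sD(1) rD kc by (simp add: l_distr)
      then have "c \<otimes> (\<one> \<ominus> (k \<oplus> k)) = c \<ominus> (r \<oplus> r)" using cc kc by (simp add: minus_eq r_distr r_minus)
      then show ?thesis unfolding b_def c_def using tD(1) sD(1) rD(1)
        by (simp add: minus_eq minus_add a_assoc r_neg1 r_neg2) 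
    qed
    have dm: "O.det (x \<otimes> y) = O.det x \<otimes> O.det y" if "x \<in> carrier R" "y \<in> carrier R" for x y
      by (rule O.det_mult[OF double_eq_zero[OF two] that])
    have dc: "O.det x \<in> carrier R" if "x \<in> carrier R" for x using centerD(1)[OF O.det_center[OF that]] .
    let ?m = "O.det (\<ominus> \<one>)"
    have mm: "?m \<otimes> ?m = \<one>" using dm[of "\<ominus> \<one>" "\<ominus> \<one>"] O.det_one by (simp add: l_minus)
    have cc1: "O.det c' \<otimes> O.det c = \<one>" using dm[OF cc(2,1)] inv O.det_one by simp
    have "O.det (\<ominus> u) = O.det (\<one> \<ominus> w \<otimes> e)"
      unfolding mu1 by (rule O.det_one_minus_swap[OF two ie wc])
    also have "\<dots> = O.det c' \<otimes> (?m \<otimes> O.det (\<sigma> b))" unfolding swap using cc bc by (simp add: dm)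
    also have "O.det (\<sigma> b) = O.det b" by (rule O.det_sig[OF two bc])
    also have "O.det b = O.det c \<otimes> \<ominus> \<one>"
      unfolding b2 using cc kc O.det_one_minus_two_f[OF n] by (simp add: dm)
    also have "O.det c' \<otimes> (?m \<otimes> (O.det c \<otimes> \<ominus> \<one>)) = ?m \<otimes> (O.det c' \<otimes> O.det c) \<otimes> \<ominus> \<one>"
      using centerD(2)[OF O.det_center[of "\<ominus> \<one>"] dc[OF cc(2)]] dc cc by (simp add: m_assoc[symmetric])
    also have "\<dots> = ?m \<otimes> \<ominus> \<one>" using cc1 dc by simp
    finally have "O.det (\<ominus> u) = ?m \<otimes> \<ominus> \<one>" .
    moreover have "O.det (\<ominus> u) = ?m \<otimes> O.det u" using dm[of "\<ominus> \<one>" u] u(1) by (simp add: l_minus)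
    \<comment> \<open>The factor \<open>det (-1)\<close> is cancelled as its own inverse, so no
      distinction by the parity of \<open>n\<close> arises.\<close>
    ultimately have "?m \<otimes> (?m \<otimes> O.det u) = ?m \<otimes> (?m \<otimes> \<ominus> \<one>)" by simp
    moreover have mx: "?m \<otimes> (?m \<otimes> x) = x" if "x \<in> carrier R" for x
      using mm that dc[of "\<ominus> \<one>"] m_assoc[of ?m ?m x] by simp
    ultimately have "O.det u = \<ominus> \<one>" using dc[OF u(1)] by simp
    moreover have "\<ominus> \<one> \<noteq> \<one>"
    proof
      assume "\<ominus> \<one> = \<one>"
      then have "\<one> \<oplus> \<one> = \<zero>" using r_neg[of \<one>] by simp
      then show False using double_eq_zero[OF two one_closed] nz by simp
    qed
    ultimately have "mdet R n (O.mat u) \<noteq> \<one>" unfolding O.det_def by simp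
    then show ?thesis using O.orth_data by blast
  qed
qed

end

section \<open>Reduction to simple factors and lifting\<close>

context ring_with_involution
begin

text \<open>The data on the two factors are added; elements of corners at orthogonal idempotents
  annihilate each other, so all equations hold componentwise.\<close>

lemma cayley_add:
  assumes z: "idem z" "idem z'" "z \<otimes> z' = \<zero>" "z' \<otimes> z = \<zero>" "\<sigma> z = z" "\<sigma> z' = z'"
    and u: "u \<in> carrier R" and cz: "cayley z u" "cayley z' u"
  shows "cayley (z \<oplus> z') u"
proof -
  obtain y c c' where y: "y \<in> corner z z" "c \<in> corner z z" "c' \<in> corner z z" "c \<otimes> c' = z" "c' \<otimes> c = z"
      "c \<oplus> \<sigma> c = \<sigma> y \<otimes> y" "y \<otimes> c' \<otimes> \<sigma> y = z \<otimes> (\<one> \<oplus> u)"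
    using cz(1) unfolding cayley_def by blast
  obtain x d d' where x: "x \<in> corner z' z'" "d \<in> corner z' z'" "d' \<in> corner z' z'" "d \<otimes> d' = z'" "d' \<otimes> d = z'"
      "d \<oplus> \<sigma> d = \<sigma> x \<otimes> x" "x \<otimes> d' \<otimes> \<sigma> x = z' \<otimes> (\<one> \<oplus> u)"
    using cz(2) unfolding cayley_def by blast
  note zc = idemD[OF z(1)] idemD[OF z(2)]
  note c = cornerD(1)[OF y(1)] cornerD(1)[OF y(2)] cornerD(1)[OF y(3)]
    cornerD(1)[OF x(1)] cornerD(1)[OF x(2)] cornerD(1)[OF x(3)]
  have sy: "\<sigma> y \<in> corner z z" "\<sigma> x \<in> corner z' z'"
    using sig_corner[OF y(1)] sig_corner[OF x(1)] z zc by simp_all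
  have o: "v \<otimes> w = \<zero>" "w \<otimes> v = \<zero>" if "v \<in> corner z z" "w \<in> corner z' z'" for v w
    using corner_orth[OF that z(3)] corner_orth[OF that(2,1) z(4)] zc by simp_all
  have o3: "v \<otimes> w \<otimes> w' = \<zero>" "w \<otimes> v \<otimes> v' = \<zero>" "v \<otimes> v' \<otimes> w = \<zero>" "w \<otimes> w' \<otimes> v = \<zero>"
    if "v \<in> corner z z" "w \<in> corner z' z'" "v' \<in> corner z z" "w' \<in> corner z' z'" for v w v' w'
    using o[OF that(1,2)] o[OF that(3,2)] o[OF that(1,4)]
      cornerD(1)[OF that(1)] cornerD(1)[OF that(2)] cornerD(1)[OF that(3)] cornerD(1)[OF that(4)]
    by (simp_all add: m_assoc)
  note a = idem_add[OF z(1,2,3,4)]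
  have m: "v \<in> corner (z \<oplus> z') (z \<oplus> z')" if "v \<in> corner z z \<or> v \<in> corner z' z'" for v
    using that corner_mono[OF _ a(2,3) a(2,3)] corner_mono[OF _ a(4,5) a(4,5)] zc by auto
  have m2: "v \<oplus> w \<in> corner (z \<oplus> z') (z \<oplus> z')" if "v \<in> corner z z" "w \<in> corner z' z'" for v w
    using corner_add[OF m m] that zc by simp
  have 1: "(c \<oplus> d) \<otimes> (c' \<oplus> d') = z \<oplus> z'" "(c' \<oplus> d') \<otimes> (c \<oplus> d) = z \<oplus> z'"
    using c x y o zc by (simp_all add: l_distr r_distr)
  have "(c \<oplus> d) \<oplus> \<sigma> (c \<oplus> d) = (c \<oplus> \<sigma> c) \<oplus> (d \<oplus> \<sigma> d)" using c by (simp add: a_ac)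
  also have "\<dots> = \<sigma> (y \<oplus> x) \<otimes> (y \<oplus> x)"
    unfolding x(6) y(6) using c o[OF sy(1) x(1)] o[OF y(1) sy(2)] by (simp add: l_distr r_distr)
  finally have 2: "(c \<oplus> d) \<oplus> \<sigma> (c \<oplus> d) = \<sigma> (y \<oplus> x) \<otimes> (y \<oplus> x)" .
  have "(y \<oplus> x) \<otimes> (c' \<oplus> d') \<otimes> \<sigma> (y \<oplus> x) = y \<otimes> c' \<otimes> \<sigma> y \<oplus> x \<otimes> d' \<otimes> \<sigma> x"
    using c o[OF y(1) x(3)] o[OF y(3) x(1)] o3[OF y(1) sy(2) y(3) x(3)] o3[OF sy(1) x(1) y(3) x(3)]
    by (simp add: l_distr r_distr)
  also have "\<dots> = (z \<oplus> z') \<otimes> (\<one> \<oplus> u)" using zc u x(7) y(7) by (simp add: l_distr)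
  finally have 3: "(y \<oplus> x) \<otimes> (c' \<oplus> d') \<otimes> \<sigma> (y \<oplus> x) = (z \<oplus> z') \<otimes> (\<one> \<oplus> u)" .
  show ?thesis unfolding cayley_def
    using m2[OF y(1) x(1)] m2[OF y(2) x(2)] m2[OF y(3) x(3)] 1 2 3 by blast
qed

lemma sig_center: assumes "z \<in> center R" shows "\<sigma> z \<in> center R"
proof (rule centerI)
  note zD = centerD[OF assms]
  fix x assume x: "x \<in> carrier R"
  have "\<sigma> (z \<otimes> \<sigma> x) = \<sigma> (\<sigma> x \<otimes> z)" using zD(2)[of "\<sigma> x"] x by simp
  then show "\<sigma> z \<otimes> x = x \<otimes> \<sigma> z" using zD(1) x by simp
qed (use assms centerD in auto)

text \<open>On a pair of factors exchanged by \<open>\<sigma>\<close> the element \<open>y = (\<one> \<oplus> u, \<one>)\<close> works.\<close>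
lemma cayley_swapped:
  assumes e: "e \<in> center R" "e \<otimes> e = e" "e \<otimes> \<sigma> e = \<zero>"
    and u: "u \<in> carrier R" "\<sigma> u \<otimes> u = \<one>" "u \<otimes> \<sigma> u = \<one>"
  shows "cayley (e \<oplus> \<sigma> e) u"
proof -
  define e' where "e' = \<sigma> e"
  have e'z: "e' \<in> center R" unfolding e'_def by (rule sig_center[OF e(1)])
  note eD = centerD[OF e(1)] and e'D = centerD[OF e'z]
  have se: "\<sigma> e = e'" "\<sigma> e' = e" unfolding e'_def using eD(1) by simp_all
  have ee': "e \<otimes> e' = \<zero>" "e' \<otimes> e = \<zero>" using e(3) eD(2)[OF e'D(1)] unfolding se by simp_all
  have e'e': "e' \<otimes> e' = e'" using sig_mult[OF eD(1) eD(1)] e(2) unfolding e'_def by simp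
  have left: "x \<otimes> e = e \<otimes> x" "x \<otimes> e' = e' \<otimes> x"
    "x \<otimes> (e \<otimes> w) = e \<otimes> (x \<otimes> w)" "x \<otimes> (e' \<otimes> w) = e' \<otimes> (x \<otimes> w)"
    if "x \<in> carrier R" "w \<in> carrier R" for x w
    using that eD(1) e'D(1) eD(2)[OF that(1)] e'D(2)[OF that(1)] by (simp_all add: m_assoc[symmetric])
  have abs: "e \<otimes> (e \<otimes> w) = e \<otimes> w" "e' \<otimes> (e' \<otimes> w) = e' \<otimes> w" "e \<otimes> (e' \<otimes> w) = \<zero>" "e' \<otimes> (e \<otimes> w) = \<zero>"
    if "w \<in> carrier R" for w
    using that eD(1) e'D(1) e(2) e'e' ee' by (simp_all add: m_assoc[symmetric])
  let ?v = "\<one> \<oplus> u"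
  have su: "\<sigma> u \<in> carrier R" using u by simp
  \<comment> \<open>In components at \<open>e\<close> and \<open>e'\<close>, these are
    \<open>y = (1 + u, 1)\<close>, \<open>c = (1, \<sigma>(u))\<close> and
    \<open>c' = (1, u)\<close>. Since \<open>\<sigma>\<close> exchanges the components,
    \<open>\<sigma>(y) = (1, 1 + \<sigma>(u))\<close>, so the second component of
    \<open>y c' \<sigma>(y)\<close> is \<open>u (1 + \<sigma>(u)) = 1 + u\<close>.\<close>
  define y where "y = e \<otimes> ?v \<oplus> e'"
  define c where "c = e \<oplus> e' \<otimes> \<sigma> u"
  define c' where "c' = e \<oplus> e' \<otimes> u"
  note cl = eD(1) e'D(1) u(1) su
  note rules = cl l_distr r_distr m_assoc abs e(2) e'e' ee' left[OF u(1)] left[OF su]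
    left[OF u(1) one_closed] left[OF su one_closed]
  have sc: "\<sigma> c = e' \<oplus> e \<otimes> u" unfolding c_def using cl left(1)[OF u(1) one_closed] by (simp add: se)
  have sy: "\<sigma> y = e' \<otimes> (\<one> \<oplus> \<sigma> u) \<oplus> e"
    unfolding y_def using cl left(2)[OF su one_closed] by (simp add: se l_distr r_distr)
  have c1: "c \<otimes> c' = e \<oplus> e'" unfolding c_def c'_def using u by (simp add: rules)
  have c2: "c' \<otimes> c = e \<oplus> e'" unfolding c_def c'_def using u by (simp add: rules)
  have c3: "c \<oplus> \<sigma> c = \<sigma> y \<otimes> y" unfolding sc sy unfolding c_def y_def by (simp add: rules a_ac)
  have c4: "y \<otimes> c' \<otimes> \<sigma> y = (e \<oplus> e') \<otimes> ?v" unfolding sy unfolding y_def c'_def using u by (simp add: rules a_ac)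
  have cor: "x \<in> corner (e \<oplus> e') (e \<oplus> e')" if "x \<in> {y, c, c'}" for x
    using that unfolding corner_def y_def c_def c'_def by (auto simp: rules)
  show ?thesis unfolding cayley_def se(1) using cor c1 c2 c3 c4 by blast
qed

end

section \<open>Factors cut out by central idempotents\<close>

lemma factor_ring_simps [simp]:
  "monoid.mult (factor_ring R e) = monoid.mult R" "ring.add (factor_ring R e) = ring.add R"
  "ring.zero (factor_ring R e) = ring.zero R" "one (factor_ring R e) = e"
  "carrier (factor_ring R e) = {e \<otimes>\<^bsub>R\<^esub> x | x. x \<in> carrier R}"
  unfolding factor_ring_def by simp_all

context ring
begin

lemma factor_ring_carrier:
  assumes "e \<in> center R" "e \<otimes> e = e"
  shows "carrier (factor_ring R e) = corner e e"
proof -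
  note eD = centerD[OF assms(1)]
  have "e \<otimes> x \<in> corner e e" if x: "x \<in> carrier R" for x
  proof (rule cornerI)
    show "e \<otimes> (e \<otimes> x) = e \<otimes> x" using eD(1) x assms(2) by (simp add: m_assoc[symmetric])
    have "e \<otimes> x \<otimes> e = e \<otimes> (x \<otimes> e)" using eD(1) x by (simp only: m_assoc)
    also have "x \<otimes> e = e \<otimes> x" using eD(2)[OF x] by simp
    finally show "e \<otimes> x \<otimes> e = e \<otimes> x" using eD(1) x assms(2) by (simp add: m_assoc[symmetric])
  qed (use eD x in simp)
  moreover have "x \<in> {e \<otimes> x | x. x \<in> carrier R}" if "x \<in> corner e e" for x
    using cornerD[OF that] by force
  ultimately show ?thesis by auto
qed

lemma center_corner:
  assumes "e \<in> center R" "x \<in> carrier R" "e \<otimes> x = x" shows "x \<in> corner e e"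
  using assms centerD(2)[OF assms(1,2)] by (intro cornerI) simp_all

lemma factor_ring_ring:
  assumes e: "e \<in> center R" "e \<otimes> e = e"
  shows "ring (factor_ring R e)"
proof (rule ringI)
  let ?S = "factor_ring R e"
  note eD = centerD[OF e(1)]
  note car = factor_ring_carrier[OF e]
  have C: "x \<in> carrier R" "e \<otimes> x = x" "x \<otimes> e = x" if "x \<in> corner e e" for x using cornerD[OF that] by simp_all
  show "abelian_group ?S"
  proof (rule abelian_groupI; unfold car factor_ring_simps(2,3))
    fix x assume x: "x \<in> corner e e"
    show "\<exists>y\<in>corner e e. y \<oplus> x = \<zero>"
      using corner_minus[OF x eD(1) eD(1)] C(1)[OF x] by (intro bexI[of _ "\<ominus> x"]) (simp_all add: l_neg)
  next
    fix x y assume "x \<in> corner e e" "y \<in> corner e e"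
    then show "x \<oplus> y \<in> corner e e" using corner_add eD(1) by blast
  next
    show "\<zero> \<in> corner e e" using eD(1) by (intro cornerI) simp_all
  qed (use C in \<open>simp_all add: a_ac\<close>)
  show "monoid ?S"
  proof (rule monoidI; unfold car factor_ring_simps(1,4))
    fix x y assume "x \<in> corner e e" "y \<in> corner e e"
    then show "x \<otimes> y \<in> corner e e" using corner_mult_corner eD(1) by blast
  next
    show "e \<in> corner e e" using eD(1) e(2) by (intro cornerI) simp_all
  qed (use C in \<open>simp_all add: m_assoc\<close>)
qed (use factor_ring_carrier[OF e] cornerD(1) in \<open>simp_all only: factor_ring_simps(1,2) l_distr r_distr\<close>)

text \<open>For central \<open>e\<close>, every left ideal \<open>I\<close> of \<open>e R\<close> is
  already a left ideal of \<open>R\<close>, since \<open>r x = (e r) x\<close> for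
  \<open>x \<in> I\<close>.\<close>

lemma factor_ring_left_artinian:
  assumes art: "left_artinian R" and e: "e \<in> center R" "e \<otimes> e = e"
  shows "left_artinian (factor_ring R e)"
proof -
  let ?S = "factor_ring R e"
  note eD = centerD[OF e(1)] and car = factor_ring_carrier[OF e]
  have "lideal R I" if I: "lideal ?S I" for I
  proof (rule lidealI)
    note D = lidealD[OF I]
    have c: "x \<in> corner e e" if "x \<in> I" for x using D(6)[OF that] unfolding car .
    show "I \<subseteq> carrier R" using c cornerD(1) by blast
    show "\<zero> \<in> I" using D(2) by simp
    show "x \<oplus> y \<in> I" if "x \<in> I" "y \<in> I" for x y using D(3)[OF that] by simp
    fix r x assume r: "r \<in> carrier R" "x \<in> I"
    have "e \<otimes> r \<in> carrier ?S" using r by auto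
    then have "e \<otimes> r \<otimes> x \<in> I" using D(5)[OF _ r(2)] by simp
    moreover have "e \<otimes> r \<otimes> x = r \<otimes> (e \<otimes> x)"
      using eD(1) eD(2)[OF r(1)] r(1) cornerD(1)[OF c[OF r(2)]] by (simp add: m_assoc)
    ultimately show "r \<otimes> x \<in> I" using cornerD(2)[OF c[OF r(2)]] by simp
  qed
  then show ?thesis using art unfolding left_artinian_def by blast
qed

end

context ring_with_involution
begin

lemma factor_ring_involution:
  assumes e: "e \<in> center R" "e \<otimes> e = e" "\<sigma> e = e"
  shows "involution (factor_ring R e) \<sigma>"
proof -
  note eD = centerD[OF e(1)] and car = factor_ring_carrier[OF e(1,2)]
  have "\<sigma> x \<in> corner e e" if "x \<in> corner e e" for x using sig_corner[OF that eD(1) eD(1)] e(3) by simp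
  then show ?thesis unfolding involution_def car using cornerD(1) by auto
qed

text \<open>The dichotomy for simple rings is applied inside \<open>e R\<close>, where membership of
  \<open>u\<close> in \<open>U0\<close> rules out the determinant alternative. Relative inverses and
  connecting elements of \<open>R\<close> are moved into the factor by replacing \<open>x\<close>
  with \<open>e x e\<close>.\<close>

lemma cayley_factor:
  assumes ss: "semisimple_artinian R" and two: "\<one> \<oplus> \<one> \<in> Units R"
    and e: "prim_central_idem R e" "\<sigma> e = e" and u: "u \<in> U0 R \<sigma>"
  shows "cayley e u"
proof -
  let ?S = "factor_ring R e"
  have ec: "e \<in> center R" "e \<otimes> e = e" "e \<noteq> \<zero>" using e unfolding prim_central_idem_def by simp_all
  note eD = centerD[OF ec(1)] and car = factor_ring_carrier[OF ec(1,2)]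
  have art: "left_artinian R" using ss unfolding semisimple_artinian_def by simp
  interpret S: ring ?S by (rule factor_ring_ring[OF ec(1,2)])
  interpret S: ring_with_involution ?S \<sigma>
    by unfold_locales (rule factor_ring_involution[OF ec(1,2) e(2)])
  have uU: "\<sigma> u \<otimes> u = \<one>" "u \<in> carrier R" using u unfolding U0_def Ugrp_def by simp_all
  have eu: "e \<otimes> u \<in> U0_simple ?S \<sigma>" using u e unfolding U0_def by simp
  then have eu1: "e \<otimes> u \<in> carrier ?S" "\<sigma> (e \<otimes> u) \<otimes>\<^bsub>?S\<^esub> (e \<otimes> u) = \<one>\<^bsub>?S\<^esub>"
    unfolding U0_simple_def Ugrp_def by simp_all
  have v: S.vnr unfolding S.vnr_def car
  proof
    fix a assume a: "a \<in> corner e e"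
    note aD = cornerD[OF a]
    obtain x where x: "x \<in> carrier R" "a \<otimes> x \<otimes> a = a"
      using vnrE[OF semisimple_artinian_vnr[OF ss] aD(1)] .
    have "a \<otimes> (e \<otimes> x \<otimes> e) \<otimes> a = (a \<otimes> e) \<otimes> x \<otimes> (e \<otimes> a)"
      using aD(1) eD(1) x(1) by (simp only: m_assoc m_closed)
    then have "a \<otimes> (e \<otimes> x \<otimes> e) \<otimes> a = a" using aD x by simp
    moreover have "e \<otimes> x \<otimes> e \<in> corner e e" using corner_mult[OF _ _ x(1)] eD(1) ec(2) unfolding idem_def by simp
    ultimately show "\<exists>x\<in>corner e e. a \<otimes>\<^bsub>?S\<^esub> x \<otimes>\<^bsub>?S\<^esub> a = a" by auto
  qed
  have pr: S.prime_ring unfolding S.prime_ring_def car factor_ring_simps(1,3)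
  proof (intro ballI impI)
    fix a b assume ab: "a \<in> corner e e" "b \<in> corner e e" "a \<noteq> \<zero>" "b \<noteq> \<zero>"
    note aD = cornerD[OF ab(1)] and bD = cornerD[OF ab(2)]
    obtain r where r: "r \<in> carrier R" "a \<otimes> r \<otimes> b \<noteq> \<zero>"
      using prim_central_idem_prime[OF ss e(1) aD(1) bD(1) aD(2) bD(2) ab(3,4)] .
    have "a \<otimes> (e \<otimes> r \<otimes> e) \<otimes> b = (a \<otimes> e) \<otimes> r \<otimes> (e \<otimes> b)"
      using aD(1) bD(1) eD(1) r(1) by (simp only: m_assoc m_closed)
    then have "a \<otimes> (e \<otimes> r \<otimes> e) \<otimes> b \<noteq> \<zero>" using aD bD r by simp
    moreover have "e \<otimes> r \<otimes> e \<in> corner e e" using corner_mult[OF _ _ r(1)] eD(1) ec(2) unfolding idem_def by simp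
    ultimately show "\<exists>r\<in>corner e e. a \<otimes> r \<otimes> b \<noteq> \<zero>" by blast
  qed
  have tw: "\<one>\<^bsub>?S\<^esub> \<oplus>\<^bsub>?S\<^esub> \<one>\<^bsub>?S\<^esub> \<in> Units ?S"
  proof -
    obtain h where h: "h \<in> center R" "h \<oplus> h = \<one>" using half[OF two] .
    note hD = centerD[OF h(1)]
    have 1: "(e \<oplus> e) \<otimes> (e \<otimes> h) = e"
    proof -
      have "(e \<oplus> e) \<otimes> (e \<otimes> h) = (e \<otimes> e) \<otimes> (h \<oplus> h)"
        using eD(1) hD(1) by (simp add: l_distr r_distr m_assoc)
      then show ?thesis using h eD(1) ec(2) by simp
    qed
    have 2: "(e \<otimes> h) \<otimes> (e \<oplus> e) = e"
      using 1 centerD(2)[OF center_closed(3)[OF ec(1) ec(1)], of "e \<otimes> h"] eD(1) hD(1) by simp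
    have "e \<oplus> e \<in> corner e e" using eD(1) ec(2) by (intro cornerI) (simp_all add: l_distr r_distr)
    moreover have "e \<otimes> h \<in> corner e e"
      using eD(1) hD(1) ec(2) by (intro center_corner[OF ec(1)]) (simp_all add: m_assoc[symmetric])
    ultimately show ?thesis unfolding Units_def car using 1 2 by auto
  qed
  have "S.cayley \<one>\<^bsub>?S\<^esub> (e \<otimes> u) \<or> (\<exists>n \<phi> B. orth_data ?S \<sigma> n \<phi> B \<and> mdet ?S n (\<phi> (e \<otimes> u)) \<noteq> \<one>\<^bsub>?S\<^esub>)"
    by (rule S.simple_cayley_or_det[OF factor_ring_left_artinian[OF art ec(1,2)] v pr tw _ eu1])
      (use ec in simp)
  moreover have "\<not> (\<exists>n \<phi> B. orth_data ?S \<sigma> n \<phi> B \<and> mdet ?S n (\<phi> (e \<otimes> u)) \<noteq> \<one>\<^bsub>?S\<^esub>)"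
    using eu unfolding U0_simple_def by blast
  ultimately have "S.cayley \<one>\<^bsub>?S\<^esub> (e \<otimes> u)" by blast
  moreover have "S.corner \<one>\<^bsub>?S\<^esub> \<one>\<^bsub>?S\<^esub> = corner e e" using S.corner_one car by simp
  moreover have "e \<otimes> (e \<oplus> e \<otimes> u) = e \<otimes> (\<one> \<oplus> u)"
    using eD(1) uU(2) ec(2) by (simp add: r_distr m_assoc[symmetric])
  ultimately show ?thesis unfolding cayley_def S.cayley_def by simp
qed

text \<open>Instead of decomposing the ring into a product, choose a \<open>\<sigma>\<close>-stable
  central idempotent \<open>z\<close> that satisfies \<open>cayley z u\<close> with
  \<open>R (1 - z)\<close> minimal. A primitive central idempotent below \<open>1 - z\<close>,
  together with its conjugate if that is different, would enlarge \<open>z\<close>.\<close>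

theorem U0_cayley:
  assumes ss: "semisimple_artinian R" and two: "\<one> \<oplus> \<one> \<in> Units R" and u: "u \<in> U0 R \<sigma>"
  shows "cayley \<one> u"
proof -
  have art: "left_artinian R" using ss unfolding semisimple_artinian_def by simp
  have uU: "u \<in> carrier R" "\<sigma> u \<otimes> u = \<one>" using u unfolding U0_def Ugrp_def by simp_all
  have uu: "u \<otimes> \<sigma> u = \<one>" using left_artinian_inverse_comm[OF art _ uU(1) uU(2)] uU(1) by simp
  let ?P = "\<lambda>z. z \<in> center R \<and> z \<otimes> z = z \<and> \<sigma> z = z \<and> cayley z u"
  have P0: "?P \<zero>"
    using center_closed(1) uU(1) by (auto simp: cayley_def corner_def intro!: exI[of _ \<zero>])
  have Pl: "lideal R (princ (\<one> \<ominus> z))" if "?P z" for z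
    by (rule lideal_princ) (use that centerD(1) in auto)
  obtain z where z: "?P z" and min: "\<forall>y. ?P y \<longrightarrow> \<not> princ (\<one> \<ominus> y) \<subset> princ (\<one> \<ominus> z)"
    by (rule dcc_minimal[where P = ?P and L = "\<lambda>z. princ (\<one> \<ominus> z)", OF art P0 Pl])
  have zc: "z \<in> carrier R" using z centerD(1) by blast
  have iz: "idem z" and i1: "idem \<one>" using z zc unfolding idem_def by simp_all
  have z1: "z \<in> corner \<one> \<one>" using zc corner_one by simp
  define k where "k = \<one> \<ominus> z"
  note kD = idem_diff[OF i1 iz z1, folded k_def]
  note kc = idemD[OF kD(1)]
  have kz: "k \<in> center R" unfolding k_def minus_eq using center_closed z by blast
  have no: False if z': "?P z'" "k \<otimes> z' = z'" "z' \<noteq> \<zero>" for z'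
  proof -
    have z'c: "z' \<in> carrier R" using z' centerD(1) by blast
    have iz': "idem z'" unfolding idem_def using z' z'c by simp
    have z'k: "z' \<in> corner k k" using center_corner[OF kz z'c z'(2)] .
    have o: "z \<otimes> z' = \<zero>" "z' \<otimes> z = \<zero>"
      using corner_orth[OF idem_corner[OF iz] z'k] corner_orth[OF z'k idem_corner[OF iz]] kD zc kc by simp_all
    have "cayley (z \<oplus> z') u" by (rule cayley_add[OF iz iz' o _ _ uU(1)]) (use z z' in simp_all)
    moreover have "z \<oplus> z' \<in> center R" using center_closed(3) z z' by blast
    moreover have "(z \<oplus> z') \<otimes> (z \<oplus> z') = z \<oplus> z'" using idemD(2)[OF idem_add(1)[OF iz iz' o]] .
    moreover have "\<sigma> (z \<oplus> z') = z \<oplus> z'" using z z' zc z'c by simp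
    ultimately have "?P (z \<oplus> z')" by blast
    then have "\<not> princ (\<one> \<ominus> (z \<oplus> z')) \<subset> princ (\<one> \<ominus> z)" using min by blast
    moreover have "\<one> \<ominus> (z \<oplus> z') = k \<ominus> z'"
      unfolding k_def using zc z'c by (simp add: minus_eq minus_add a_assoc)
    ultimately show False using princ_diff_strict[OF kD(1) iz' z'k z'(3)] unfolding k_def[symmetric] by simp
  qed
  have "k = \<zero>"
  proof (rule ccontr)
    assume "k \<noteq> \<zero>"
    then obtain e where e: "prim_central_idem R e" "k \<otimes> e = e"
      using prim_central_idem_below[OF art kz kc(2)] by blast
    have ec: "e \<in> center R" "e \<otimes> e = e" "e \<noteq> \<zero>"
      and ep: "\<And>f. f \<in> center R \<Longrightarrow> f \<otimes> f = f \<Longrightarrow> f \<otimes> e = \<zero> \<or> f \<otimes> e = e"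
      using e(1) unfolding prim_central_idem_def by simp_all
    note eD = centerD[OF ec(1)]
    have se: "\<sigma> e \<in> center R" "\<sigma> e \<otimes> \<sigma> e = \<sigma> e"
      using sig_center[OF ec(1)] sig_mult[OF eD(1) eD(1)] ec(2) by simp_all
    \<comment> \<open>By primitivity the product \<open>\<sigma>(e) e\<close> is \<open>0\<close> or
      \<open>e\<close>. It is always symmetric, so in the second case
      \<open>\<sigma>(e) = e\<close>; in the first case \<open>e\<close> and
      \<open>\<sigma>(e)\<close> are exchanged orthogonal idempotents.\<close>
    show False
    proof (cases "\<sigma> e \<otimes> e = \<zero>")
      case False
      then have see: "\<sigma> e \<otimes> e = e" using ep[OF se] by simp
      have "\<sigma> (\<sigma> e \<otimes> e) = \<sigma> e \<otimes> e" using eD(1) by simp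
      then have "\<sigma> e = e" unfolding see by simp
      then have "?P e" using ec cayley_factor[OF ss two e(1) _ u] by simp
      then show False using no e(2) ec(3) by blast
    next
      case True
      let ?z = "e \<oplus> \<sigma> e"
      have es: "e \<otimes> \<sigma> e = \<zero>" using True eD(2)[of "\<sigma> e"] eD(1) by simp
      have "cayley ?z u" by (rule cayley_swapped[OF ec(1,2) es uU uu])
      moreover have "?z \<in> center R" by (rule center_closed(3)[OF ec(1) se(1)])
      moreover have "?z \<otimes> ?z = ?z" using eD(1) ec(2) se es True by (simp add: l_distr r_distr)
      moreover have "\<sigma> ?z = ?z" using eD(1) by (simp add: a_comm)
      ultimately have "?P ?z" by blast
      moreover have "k \<otimes> ?z = ?z"
      proof -
        have "\<sigma> k = k" unfolding k_def using z zc by simp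
        then have "\<sigma> e \<otimes> k = \<sigma> e" using sig_mult[OF kc(1) eD(1)] e(2) by simp
        then have "k \<otimes> \<sigma> e = \<sigma> e" using centerD(2)[OF kz, of "\<sigma> e"] eD(1) by simp
        then show ?thesis using e(2) kc(1) eD(1) by (simp add: r_distr)
      qed
      moreover have "?z \<noteq> \<zero>"
      proof
        assume "?z = \<zero>"
        then have "e \<otimes> ?z = \<zero>" using eD(1) by simp
        then show False using es ec eD(1) by (simp add: r_distr)
      qed
      ultimately show False by (rule no)
    qed
  qed
  then have "z = \<one>" unfolding k_def using zc by simp
  then show ?thesis using z by simp
qed

section \<open>Lifting along the Jacobson radical\<close>

text \<open>Half the prescribed symmetrization plus the skew part of an arbitrary \<open>c\<close>.\<close>
lemma prescribed_symmetrization: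
  assumes h: "h \<in> center R" "h \<oplus> h = \<one>" and s: "s \<in> carrier R" "\<sigma> s = s" and c: "c \<in> carrier R"
  shows "h \<otimes> (s \<oplus> (c \<ominus> \<sigma> c)) \<oplus> \<sigma> (h \<otimes> (s \<oplus> (c \<ominus> \<sigma> c))) = s"
proof -
  note hD = centerD[OF h(1)]
  have "\<sigma> h \<oplus> \<sigma> h = \<one>" using sig_add[OF hD(1) hD(1)] h(2) by simp
  then have sh: "\<sigma> h = h" using half_mult[OF h, of "\<sigma> h"] hD(1) by simp
  define w where "w = c \<ominus> \<sigma> c"
  have w: "w \<in> carrier R" "\<sigma> w = \<ominus> w"
    unfolding w_def using c by (simp_all add: minus_eq minus_add a_comm)
  have "\<sigma> (h \<otimes> (s \<oplus> w)) = (s \<oplus> \<ominus> w) \<otimes> h" using hD(1) s w sh by simp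
  also have "\<dots> = h \<otimes> (s \<oplus> \<ominus> w)" using hD(2)[of "s \<oplus> \<ominus> w"] s w by simp
  finally have "h \<otimes> (s \<oplus> w) \<oplus> \<sigma> (h \<otimes> (s \<oplus> w)) = h \<otimes> ((s \<oplus> w) \<oplus> (s \<oplus> \<ominus> w))"
    using hD(1) s w by (simp add: r_distr)
  also have "(s \<oplus> w) \<oplus> (s \<oplus> \<ominus> w) = (s \<oplus> s) \<oplus> (w \<oplus> \<ominus> w)" using s w by (simp add: a_ac)
  also have "\<dots> = s \<oplus> s" using s w by (simp add: r_neg)
  finally show ?thesis using half_mult[OF h s(1)] unfolding w_def by simp
qed

text \<open>For \<open>w = y c' \<sigma>(y)\<close>, substituting \<open>c + \<sigma>(c)\<close> for
  \<open>\<sigma>(y) y\<close> turns \<open>\<sigma>(w) w\<close> into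
  \<open>\<sigma>(w) + w\<close>, which says exactly that
  \<open>\<sigma>(w - 1) (w - 1) = 1\<close>.\<close>

lemma cayley_unitary:
  assumes c: "y \<in> carrier R" "c \<in> carrier R" "c' \<in> carrier R" "c \<otimes> c' = \<one>" "c' \<otimes> c = \<one>"
    and cy: "c \<oplus> \<sigma> c = \<sigma> y \<otimes> y"
  shows "y \<otimes> c' \<otimes> \<sigma> y \<ominus> \<one> \<in> Ugrp R \<sigma>"
proof -
  define w where "w = y \<otimes> c' \<otimes> \<sigma> y"
  have wc: "w \<in> carrier R" unfolding w_def using c by simp
  have sw: "\<sigma> w = y \<otimes> \<sigma> c' \<otimes> \<sigma> y" unfolding w_def using c(1-3) by (simp add: m_assoc)
  have scc: "\<sigma> c' \<otimes> \<sigma> c = \<one>" using sig_mult[OF c(2,3)] c(4) by simp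
  have "\<sigma> w \<otimes> w = y \<otimes> (\<sigma> c' \<otimes> (\<sigma> y \<otimes> y) \<otimes> c') \<otimes> \<sigma> y"
    unfolding sw unfolding w_def using c(1-3) by (simp add: m_assoc)
  also have "\<sigma> c' \<otimes> (\<sigma> y \<otimes> y) \<otimes> c' = \<sigma> c' \<otimes> (c \<otimes> c') \<oplus> (\<sigma> c' \<otimes> \<sigma> c) \<otimes> c'"
    unfolding cy[symmetric] using c(1-3) by (simp add: l_distr r_distr m_assoc)
  also have "\<dots> = \<sigma> c' \<oplus> c'" using c scc by simp
  also have "y \<otimes> (\<sigma> c' \<oplus> c') \<otimes> \<sigma> y = \<sigma> w \<oplus> w"
    unfolding sw unfolding w_def using c(1-3) by (simp add: l_distr r_distr)
  finally have ww: "\<sigma> w \<otimes> w = \<sigma> w \<oplus> w" .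
  have "\<sigma> (w \<ominus> \<one>) \<otimes> (w \<ominus> \<one>) = (\<sigma> w \<otimes> w \<ominus> (\<sigma> w \<oplus> w)) \<oplus> \<one>"
    using wc by (simp add: minus_eq minus_add l_distr r_distr l_minus r_minus a_ac)
  also have "\<dots> = \<one>" unfolding ww using wc by (simp add: minus_eq r_neg)
  finally show ?thesis unfolding Ugrp_def w_def[symmetric] using wc by simp
qed

end

theorem theorem6:
  fixes A :: "('a, 'b) ring_scheme" and \<sigma> :: "'a \<Rightarrow> 'a"
    and \<sigma>bar :: "'a set \<Rightarrow> 'a set"
  assumes "ring A"
    and "involution A \<sigma>"
    and "semilocal A"
    and "\<one>\<^bsub>A\<^esub> \<oplus>\<^bsub>A\<^esub> \<one>\<^bsub>A\<^esub> \<in> Units A"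
    and "\<forall>a\<in>carrier A. \<sigma>bar (Jac A +>\<^bsub>A\<^esub> a) = Jac A +>\<^bsub>A\<^esub> \<sigma> a"
  shows "U0 (A Quot Jac A) \<sigma>bar \<subseteq> (\<lambda>u. Jac A +>\<^bsub>A\<^esub> u) ` Ugrp A \<sigma>"
proof
  fix ub assume ub: "ub \<in> U0 (A Quot Jac A) \<sigma>bar"
  interpret A: ring A by (rule assms(1))
  interpret A: ring_with_involution A \<sigma> by unfold_locales (rule assms(2))
  interpret J: ideal "Jac A" A by (rule A.ideal_Jac)
  define Q where "Q = A Quot Jac A"
  define \<pi> where "\<pi> a = Jac A +>\<^bsub>A\<^esub> a" for a
  interpret Q: ring Q unfolding Q_def by (rule J.quotient_is_ring)
  have hom: "\<pi> \<in> ring_hom A Q" unfolding \<pi>_def Q_def by (rule J.rcos_ring_hom)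
  note hE = ring_hom_memE[OF hom]
  have surj: "\<exists>a\<in>carrier A. x = \<pi> a" if "x \<in> carrier Q" for x
    using that unfolding Q_def \<pi>_def by (auto simp: FactRing_def A_RCOSETS_def')
  have sbar: "\<sigma>bar (\<pi> a) = \<pi> (\<sigma> a)" if "a \<in> carrier A" for a using assms(5) that unfolding \<pi>_def by simp
  have "involution Q \<sigma>bar"
    unfolding involution_def
  proof (intro conjI ballI)
    show "\<sigma>bar \<in> carrier Q \<rightarrow> carrier Q" using surj sbar hE(1) by fastforce
    fix x assume "x \<in> carrier Q"
    then obtain a where a: "a \<in> carrier A" "x = \<pi> a" using surj by blast
    show "\<sigma>bar (\<sigma>bar x) = x" using a sbar by simp
    fix y assume "y \<in> carrier Q"
    then obtain b where b: "b \<in> carrier A" "y = \<pi> b" using surj by blast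
    show "\<sigma>bar (x \<oplus>\<^bsub>Q\<^esub> y) = \<sigma>bar x \<oplus>\<^bsub>Q\<^esub> \<sigma>bar y"
      using a b sbar hE(3) A.sig_closed A.sig_add by (metis A.add.m_closed)
    show "\<sigma>bar (x \<otimes>\<^bsub>Q\<^esub> y) = \<sigma>bar y \<otimes>\<^bsub>Q\<^esub> \<sigma>bar x"
      using a b sbar hE(2) A.sig_closed A.sig_mult by (metis A.m_closed)
  qed
  then interpret Q: ring_with_involution Q \<sigma>bar by unfold_locales
  obtain h where h: "h \<in> center A" "h \<oplus>\<^bsub>A\<^esub> h = \<one>\<^bsub>A\<^esub>" using A.half[OF assms(4)] .
  note hD = A.centerD[OF h(1)]
  have two: "\<one>\<^bsub>Q\<^esub> \<oplus>\<^bsub>Q\<^esub> \<one>\<^bsub>Q\<^esub> \<in> Units Q"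
  proof -
    have e: "(\<one>\<^bsub>A\<^esub> \<oplus>\<^bsub>A\<^esub> \<one>\<^bsub>A\<^esub>) \<otimes>\<^bsub>A\<^esub> h = \<one>\<^bsub>A\<^esub>" "h \<otimes>\<^bsub>A\<^esub> (\<one>\<^bsub>A\<^esub> \<oplus>\<^bsub>A\<^esub> \<one>\<^bsub>A\<^esub>) = \<one>\<^bsub>A\<^esub>"
      using h hD(1) by (simp_all add: A.l_distr A.r_distr)
    have "\<pi> (\<one>\<^bsub>A\<^esub> \<oplus>\<^bsub>A\<^esub> \<one>\<^bsub>A\<^esub>) \<otimes>\<^bsub>Q\<^esub> \<pi> h = \<one>\<^bsub>Q\<^esub>"
      "\<pi> h \<otimes>\<^bsub>Q\<^esub> \<pi> (\<one>\<^bsub>A\<^esub> \<oplus>\<^bsub>A\<^esub> \<one>\<^bsub>A\<^esub>) = \<one>\<^bsub>Q\<^esub>"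
      using hE(2)[of "\<one>\<^bsub>A\<^esub> \<oplus>\<^bsub>A\<^esub> \<one>\<^bsub>A\<^esub>" h] hE(2)[of h "\<one>\<^bsub>A\<^esub> \<oplus>\<^bsub>A\<^esub> \<one>\<^bsub>A\<^esub>"] e hD(1) hE(4) by simp_all
    then have "\<pi> (\<one>\<^bsub>A\<^esub> \<oplus>\<^bsub>A\<^esub> \<one>\<^bsub>A\<^esub>) \<in> Units Q"
      by (intro Q.Units_of_two_sided_inverse(1)[of _ "\<pi> h"]) (use hD(1) hE(1) in auto)
    then show ?thesis using hE by simp
  qed
  have ss: "semisimple_artinian Q" using assms(3) unfolding semilocal_def Q_def .
  have "Q.cayley \<one>\<^bsub>Q\<^esub> ub" by (rule Q.U0_cayley[OF ss two]) (use ub Q_def in simp)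
  then obtain Y C C' where Q1: "Y \<in> carrier Q" "C \<in> carrier Q" "C' \<in> carrier Q" "C \<otimes>\<^bsub>Q\<^esub> C' = \<one>\<^bsub>Q\<^esub>" "C' \<otimes>\<^bsub>Q\<^esub> C = \<one>\<^bsub>Q\<^esub>"
    "C \<oplus>\<^bsub>Q\<^esub> \<sigma>bar C = \<sigma>bar Y \<otimes>\<^bsub>Q\<^esub> Y" "Y \<otimes>\<^bsub>Q\<^esub> C' \<otimes>\<^bsub>Q\<^esub> \<sigma>bar Y = \<one>\<^bsub>Q\<^esub> \<otimes>\<^bsub>Q\<^esub> (\<one>\<^bsub>Q\<^esub> \<oplus>\<^bsub>Q\<^esub> ub)"
    unfolding Q.cayley_def Q.corner_one by blast
  have ubc: "ub \<in> carrier Q" using ub unfolding U0_def Ugrp_def Q_def by simp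
  obtain y where y: "y \<in> carrier A" "Y = \<pi> y" using surj[OF Q1(1)] by blast
  obtain c0 where c0: "c0 \<in> carrier A" "C = \<pi> c0" using surj[OF Q1(2)] by blast
  obtain d where d: "d \<in> carrier A" "C' = \<pi> d" using surj[OF Q1(3)] by blast
  define s where "s = \<sigma> y \<otimes>\<^bsub>A\<^esub> y"
  have sc: "s \<in> carrier A" "\<sigma> s = s" unfolding s_def using y by simp_all
  \<comment> \<open>An arbitrary lift \<open>c0\<close> satisfies
    \<open>c0 + \<sigma>(c0) = s\<close> only modulo the radical. Keeping its skew part and
    replacing its symmetric part by half of \<open>s\<close> makes the equation exact in
    \<open>A\<close>; the correction lies in the radical, so \<open>c\<close> still lifts
    \<open>C\<close>.\<close>
  define c where "c = h \<otimes>\<^bsub>A\<^esub> (s \<oplus>\<^bsub>A\<^esub> (c0 \<ominus>\<^bsub>A\<^esub> \<sigma> c0))"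
  have cc: "c \<in> carrier A" unfolding c_def using hD(1) sc c0 by simp
  have cs: "c \<oplus>\<^bsub>A\<^esub> \<sigma> c = s"
    unfolding c_def by (rule A.prescribed_symmetrization[OF h sc c0(1)])
  have \<pi>c: "\<pi> c = C"
  proof -
    have pm: "\<pi> (x \<ominus>\<^bsub>A\<^esub> w) \<oplus>\<^bsub>Q\<^esub> \<pi> w = \<pi> x" if "x \<in> carrier A" "w \<in> carrier A" for x w
      using that hE(3)[of "x \<ominus>\<^bsub>A\<^esub> w" w] by (simp add: A.minus_eq A.a_assoc A.l_neg)
    have "\<pi> s = \<pi> c0 \<oplus>\<^bsub>Q\<^esub> \<pi> (\<sigma> c0)"
      unfolding s_def using Q1(6) y c0 sbar hE by simp
    then have "\<pi> (s \<oplus>\<^bsub>A\<^esub> (c0 \<ominus>\<^bsub>A\<^esub> \<sigma> c0)) = \<pi> c0 \<oplus>\<^bsub>Q\<^esub> (\<pi> (c0 \<ominus>\<^bsub>A\<^esub> \<sigma> c0) \<oplus>\<^bsub>Q\<^esub> \<pi> (\<sigma> c0))"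
      using sc c0 hE by (simp add: Q.a_ac)
    also have "\<dots> = \<pi> (c0 \<oplus>\<^bsub>A\<^esub> c0)" using pm c0 hE by simp
    finally have "\<pi> c = \<pi> (h \<otimes>\<^bsub>A\<^esub> (c0 \<oplus>\<^bsub>A\<^esub> c0))"
      unfolding c_def using hD(1) sc c0 hE by simp
    also have "h \<otimes>\<^bsub>A\<^esub> (c0 \<oplus>\<^bsub>A\<^esub> c0) = c0" by (rule A.half_mult[OF h c0(1)])
    finally show ?thesis using c0 by simp
  qed
  have inJ: "\<one>\<^bsub>A\<^esub> \<ominus>\<^bsub>A\<^esub> x \<in> Jac A" if x: "x \<in> carrier A" "\<pi> x = \<one>\<^bsub>Q\<^esub>" for x
  proof -
    have "Jac A +>\<^bsub>A\<^esub> x = Jac A +>\<^bsub>A\<^esub> \<one>\<^bsub>A\<^esub>" using x(2) hE(4) unfolding \<pi>_def by simp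
    then have "\<one>\<^bsub>A\<^esub> \<in> Jac A +>\<^bsub>A\<^esub> x" using J.a_repr_independenceD by simp
    then show ?thesis using J.a_rcos_module_minus[OF assms(1) x(1) A.one_closed] by simp
  qed
  \<comment> \<open>Any lift \<open>d\<close> of \<open>C'\<close> inverts \<open>c\<close> modulo
    the radical; the true inverse \<open>c'\<close> then also reduces to \<open>C'\<close>, by
    uniqueness of inverses.\<close>
  have "c \<in> Units A"
    by (rule A.Jac_Units_lift[OF cc d(1)]; rule inJ) (use cc d hE \<pi>c Q1 in simp_all)
  then obtain c' where c': "c' \<in> carrier A" "c \<otimes>\<^bsub>A\<^esub> c' = \<one>\<^bsub>A\<^esub>" "c' \<otimes>\<^bsub>A\<^esub> c = \<one>\<^bsub>A\<^esub>"
    unfolding Units_def by auto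
  have \<pi>c': "\<pi> c' = C'"
  proof -
    have "\<pi> c' \<otimes>\<^bsub>Q\<^esub> C = \<one>\<^bsub>Q\<^esub>" using hE(2)[OF c'(1) cc] c' \<pi>c hE(4) by simp
    moreover have "\<pi> c' \<in> carrier Q" using hE(1) c'(1) by simp
    ultimately show ?thesis using Q1(2-4) by (metis Q.m_assoc Q.l_one Q.r_one)
  qed
  \<comment> \<open>The negative of the lifted quasi-reflection, which reduces to \<open>ub\<close>
    because \<open>Y C' \<sigma>bar(Y) = 1 + ub\<close> in the quotient.\<close>
  define u where "u = y \<otimes>\<^bsub>A\<^esub> c' \<otimes>\<^bsub>A\<^esub> \<sigma> y \<ominus>\<^bsub>A\<^esub> \<one>\<^bsub>A\<^esub>"
  have uU: "u \<in> Ugrp A \<sigma>" unfolding u_def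
    by (rule A.cayley_unitary[OF y(1) cc c' cs[unfolded s_def]])
  have uc: "u \<in> carrier A" using uU unfolding Ugrp_def by simp
  have "\<one>\<^bsub>A\<^esub> \<oplus>\<^bsub>A\<^esub> u = y \<otimes>\<^bsub>A\<^esub> c' \<otimes>\<^bsub>A\<^esub> \<sigma> y"
    unfolding u_def using y c' by (intro A.add_diff_cancel_right) simp_all
  then have "\<one>\<^bsub>Q\<^esub> \<oplus>\<^bsub>Q\<^esub> \<pi> u = \<one>\<^bsub>Q\<^esub> \<oplus>\<^bsub>Q\<^esub> ub"
    using hE(3)[OF A.one_closed uc] hE y c' \<pi>c' sbar Q1(7) ubc by simp
  then have "\<pi> u = ub" using Q.add.l_cancel[OF _ hE(1)[OF uc] ubc Q.one_closed] by blast
  then show "ub \<in> (\<lambda>u. Jac A +>\<^bsub>A\<^esub> u) ` Ugrp A \<sigma>" using uU unfolding \<pi>_def by blast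
qed

end
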